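(* Consider the reach-avoid game described in the context, with speed ratio $\alpha=v_E/v_P\in(0,1)$. Assume all players have pairwise distinct initial positions, the pursuers' initial positions lie in $\Omega$, the evaders' initial positions lie in $\Omega_{\rm play}$, and no virtual pursuer coincides with a pursuer other than its own original. For a pursuit coalition $k$ with joint initial position $\mathcal X_k^0$, let $\mathcal X_{k,1}^0$ and $\mathcal X_{k,2}^0$ (possibly empty) be the sets of initial positions of its pursuers lying in $\Omega_{\rm play}$ and in $\Omega_{\rm tar}$ respectively, and let $\tilde{\mathcal X}_{k,2}^0=\{(x,-y):(x,y)\in\mathcal X_{k,2}^0\}$ be the set of the corresponding virtual pursuers. Then the barriers against one evader satisfy $$\mathcal B^{n_k}(\mathcal X_k^0)=\mathcal B^{n_k}(\mathcal X_{k,1}^0\cup\tilde{\mathcal X}_{k,2}^0),$$ and the right-hand side is computed as follows: if $\bm h_1,\dots,\bm h_{\bar n}$ are the initial positions of the active pursuers of the coalition $\mathcal X_{k,1}^0\cup\tilde{\mathcal X}_{k,2}^0$, listed in order of increasing $x$-coordinate, then it equals $\Phi_{\bar n}(\bm h_1,\dots,\bm h_{\bar n})\cap\Omega_{\rm play}$, with $\Phi_n$ the explicit curves defined in the context.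
   Context: Domain. $\Omega\subset\mathbb R^2$ is a bounded convex domain. A straight segment $\mathcal T\subset\Omega$ (the target line) with endpoints $\bm m=(0,0)$ and $\bm n=(l,0)$, $l>0$, both on $\partial\Omega$, cuts $\Omega$ into the compact target region $\Omega_{\rm tar}\supset\mathcal T$ (the part in $y\ge 0$) and the play region $\Omega_{\rm play}=\Omega\setminus\Omega_{\rm tar}$ (the part in $y<0$). Players. There are pursuers $P_1,\dots,P_{N_p}$ and evaders $E_1,\dots,E_{N_e}$, which are points moving in $\Omega$ with $\dot{\mathbf x}_{P_i}=v_P\mathbf u_{P_i}$, $\dot{\mathbf x}_{E_j}=v_E\mathbf u_{E_j}$, controls in $\mathcal U=\{\mathbf u\in\mathbb R^2:\|\mathbf u\|_2=1\}$, and initial positions $\mathbf x^0_{P_i},\mathbf x^0_{E_j}$; $\alpha=v_E/v_P$. An evader is captured when its position in $\Omega_{\rm play}$ coincides with that of a pursuer; once it enters $\Omega_{\rm tar}$ it can no longer be captured. Information structure: the evader uses state feedback; the pursuit team uses state feedback together with the evader's current input (non-anticipative strategies). Winning regions and barrier. A pursuit coalition $k$ is a nonempty set of $n_k$ pursuers with joint initial position $\mathcal X_k^0$. For a game between coalition $k$ and one evader: $\mathcal W_P^{n_k}(\mathcal X_k^0)\subset\Omega_{\rm play}$ is the set of initial evader positions from which the coalition can guarantee capture before the evader enters $\Omega_{\rm tar}$, whatever the evader does; $\mathcal W_E^{n_k}(\mathcal X_k^0)\subset\Omega_{\rm play}$ is the set of initial evader positions from which the evader can guarantee entering $\Omega_{\rm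 tar}$ without being captured, whatever the coalition does. The barrier $\mathcal B^{n_k}(\mathcal X_k^0)\subset\Omega_{\rm play}$ is the curve separating these two regions, i.e. the set of positions from which neither side can guarantee its own winning (under optimal play capture and arrival at $\mathcal T$ happen simultaneously), with $\mathcal B^{n_k}\cup\mathcal W_P^{n_k}\cup\mathcal W_E^{n_k}=\Omega_{\rm play}$. $\breve{\mathcal B}^{n_k}$ denotes the barrier of the same game when the boundary of $\Omega_{\rm play}$ is ignored (players move in $\mathbb R^2$, the evader starts in $\{y<0\}$ and wants to reach $\mathcal T$). Virtual pursuers. For a pursuer $P_i$ with $\mathbf x^0_{P_i}=(x^0_{P_i},y^0_{P_i})\in\Omega_{\rm tar}$, its virtual pursuer is a pursuer with initial position $\tilde{\mathbf x}^0_{P_i}=(x^0_{P_i},-y^0_{P_i})$. A virtual pursuer may lie outside $\Omega$; for a coalition containing virtual pursuers the barrier is understood as $\breve{\mathcal B}^{n_k}\cap\Omega_{\rm play}$. A virtual pursuer may coincide with its own original (when the latter is on $\mathcal T$). Active pursuers. A pursuer of a coalition is active in it if there is $\bm p\in\mathcal T$ whose distance to that pursuer's initial position is strictly smaller than its distance to the initial position of every other pursuer of the coalition. (Active pursuers with initial positions in $\{y\le 0\}$ have pairwise different $x$-coordinates.) Base curves. Let $\bm h_i=(x_i,y_i)$, $y_i\le0$, $x_1<x_2<x_3$, and write $\mathbf z=(x,y)\in\mathbb R^2$. One pursuer: with $k_1=\alpha^2x_1$, $k_2=(1-\alpha^2)l+\alpha^2x_1$, $$F^1_1(\bm h_1)=\{\mathbf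 z:\|\mathbf z-\bm m\|_2=\alpha\|\bm h_1-\bm m\|_2,\ x\le k_1,\ y<0\},$$ $$F^1_2(\bm h_1)=\{\mathbf z:(x-x_1)^2+(1-1/\alpha^2)y^2+(1-\alpha^2)y_1^2=0,\ x\in(k_1,k_2),\ y<0\},$$ $$F^1_3(\bm h_1)=\{\mathbf z:\|\mathbf z-\bm n\|_2=\alpha\|\bm h_1-\bm n\|_2,\ x\ge k_2,\ y<0\}.$$ Two pursuers: let $\bm p_c=(x_c,0)$ be the unique point of the $x$-axis with $\|\bm p_c-\bm h_1\|_2=\|\bm p_c-\bm h_2\|_2$, $k_3=\alpha^2x_1$, $k_4=(1-\alpha^2)x_c+\alpha^2x_1$, $k_5=(1-\alpha^2)x_c+\alpha^2x_2$, $k_6=(1-\alpha^2)l+\alpha^2x_2$; $$F^2_1(\bm h_1,\bm h_2)=F^1_1(\bm h_1),\qquad F^2_5(\bm h_1,\bm h_2)=F^1_3(\bm h_2),$$ $$F^2_2(\bm h_1,\bm h_2)=\{\mathbf z:(x-x_1)^2+(1-1/\alpha^2)y^2+(1-\alpha^2)y_1^2=0,\ x\in(k_3,k_4),\ y<0\},$$ $$F^2_3(\bm h_1,\bm h_2)=\{\mathbf z:\|\mathbf z-\bm p_c\|_2=\alpha\|\bm h_1-\bm p_c\|_2,\ x\in[k_4,k_5],\ y<0\},$$ $$F^2_4(\bm h_1,\bm h_2)=\{\mathbf z:(x-x_2)^2+(1-1/\alpha^2)y^2+(1-\alpha^2)y_2^2=0,\ x\in(k_5,k_6),\ y<0\}.$$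 Three pursuers: let $\bm p_{c1}=(x_{c1},0)$, $\bm p_{c2}=(x_{c2},0)$ satisfy $\|\bm h_1-\bm p_{c1}\|_2=\|\bm h_2-\bm p_{c1}\|_2$ and $\|\bm h_2-\bm p_{c2}\|_2=\|\bm h_3-\bm p_{c2}\|_2$, $k_7=(1-\alpha^2)x_{c1}+\alpha^2x_2$, $k_8=(1-\alpha^2)x_{c2}+\alpha^2x_2$; $$F^3(\bm h_1,\bm h_2,\bm h_3)=\{\mathbf z:(x-x_2)^2+(1-1/\alpha^2)y^2+(1-\alpha^2)y_2^2=0,\ x\in(k_7,k_8),\ y<0\}.$$ Curves $\Phi_n$, for $\bm h_1,\dots,\bm h_n$ with increasing $x$-coordinates: $\Phi_1=\bigcup_{s=1}^3F^1_s(\bm h_1)$, $\Phi_2=\bigcup_{s=1}^5F^2_s(\bm h_1,\bm h_2)$, and for $n\ge3$ $$\Phi_n=\bigcup_{i=1}^2F^2_i(\bm h_1,\bm h_2)\cup\bigcup_{i=1}^{n-1}F^2_3(\bm h_i,\bm h_{i+1})\cup\bigcup_{i=2}^{n-1}F^3(\bm h_{i-1},\bm h_i,\bm h_{i+1})\cup\bigcup_{i=4}^5F^2_i(\bm h_{n-1},\bm h_n).$$ *)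

theory Defs
  imports "HOL-Analysis.Analysis"
begin

text \<open>The plane with its Euclidean norm is \<open>real \<times> real\<close>. Players carry no names of their own: in a
  coalition, a pursuer is identified with its initial position, so a coalition is a set of points.\<close>

type_synonym point = "real \<times> real"

section \<open>The domain\<close>

definition target_line :: "real \<Rightarrow> point set" where
  "target_line l = closed_segment (0, 0) (l, 0)"

definition target_region :: "point set \<Rightarrow> point set" where
  "target_region \<Omega> = {z \<in> \<Omega>. snd z \<ge> 0}"

definition play_region :: "point set \<Rightarrow> point set" where
  "play_region \<Omega> = {z \<in> \<Omega>. snd z < 0}"

text \<open>\<open>\<Omega>\<close> contains the target line, whose endpoints are boundary points, so it is not open; it is not
  required to be closed either. That the line cuts \<open>\<Omega>\<close> into the two regions means that it is the
  whole of \<open>\<Omega> \<inter> {y = 0}\<close>.\<close>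

definition game_domain :: "point set \<Rightarrow> real \<Rightarrow> bool" where
  "game_domain \<Omega> l \<longleftrightarrow>
     l > 0 \<and> bounded \<Omega> \<and> convex \<Omega> \<and> interior \<Omega> \<noteq> {} \<and>
     (0, 0) \<in> frontier \<Omega> \<and> (l, 0) \<in> frontier \<Omega> \<and>
     {z \<in> \<Omega>. snd z = 0} = target_line l \<and>
     compact (target_region \<Omega>)"

section \<open>The game of a coalition against one evader\<close>

text \<open>Everything in this section depends on a set \<open>D\<close> in which the players have to stay and a set
  \<open>G\<close> that the evader wants to reach, so that the game in \<open>\<Omega>\<close> and the game in the whole plane are
  both instances.\<close>

text \<open>Only the restriction of \<open>x\<close> to \<open>t \<ge> 0\<close> matters.\<close>

definition trajectory :: "point set \<Rightarrow> real \<Rightarrow> point \<Rightarrow> (real \<Rightarrow> point) \<Rightarrow> bool" where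
  "trajectory D v a x \<longleftrightarrow>
     x 0 = a \<and> (\<forall>t\<ge>0. x t \<in> D) \<and>
     (\<exists>u. u \<in> borel_measurable lebesgue \<and> (\<forall>s. norm (u s) = 1) \<and>
          (\<forall>t\<ge>0. ((\<lambda>s. v *\<^sub>R u s) has_integral (x t - a)) {0..t}))"

text \<open>A strategy of the coalition \<open>X\<close> answers an evader trajectory \<open>e\<close> starting at \<open>z\<close> with the
  trajectory \<open>S e h\<close> of each pursuer \<open>h \<in> X\<close>, without using the future of \<open>e\<close>. Agreement of two
  evader trajectories on \<open>{0..t}\<close> is agreement of their controls almost everywhere on \<open>{0..t}\<close>.\<close>

definition pursuit_strategy ::
    "point set \<Rightarrow> real \<Rightarrow> real \<Rightarrow> point set \<Rightarrow> point
      \<Rightarrow> ((real \<Rightarrow> point) \<Rightarrow> point \<Rightarrow> real \<Rightarrow> point) \<Rightarrow> bool" where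
  "pursuit_strategy D vP vE X z S \<longleftrightarrow>
     (\<forall>e. trajectory D vE z e \<longrightarrow> (\<forall>h\<in>X. trajectory D vP h (S e h))) \<and>
     (\<forall>e e' t. trajectory D vE z e \<and> trajectory D vE z e' \<and> (\<forall>s\<in>{0..t}. e s = e' s)
        \<longrightarrow> (\<forall>h\<in>X. \<forall>s\<in>{0..t}. S e h s = S e' h s))"

text \<open>While the game lasts, the evader's control is given by the feedback law \<open>\<sigma>\<close>, evaluated at its
  own position and the positions of the pursuers in \<open>X\<close>. (\<open>P h\<close> is the trajectory of pursuer \<open>h\<close>.)\<close>

definition follows_feedback ::
    "point set \<Rightarrow> real \<Rightarrow> point set \<Rightarrow> (point \<Rightarrow> (point \<Rightarrow> point) \<Rightarrow> point)
      \<Rightarrow> (point \<Rightarrow> real \<Rightarrow> point) \<Rightarrow> (real \<Rightarrow> point) \<Rightarrow> bool" where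
  "follows_feedback G vE X \<sigma> P e \<longleftrightarrow>
     (\<forall>t\<ge>0. (\<forall>s\<in>{0..<t}. e s \<notin> G \<and> (\<forall>h\<in>X. P h s \<noteq> e s)) \<longrightarrow>
        ((\<lambda>s. vE *\<^sub>R \<sigma> (e s) (\<lambda>h\<in>X. P h s)) has_integral (e t - e 0)) {0..t})"

definition pursuers_win ::
    "point set \<Rightarrow> point set \<Rightarrow> (point \<Rightarrow> real \<Rightarrow> point) \<Rightarrow> (real \<Rightarrow> point) \<Rightarrow> bool" where
  "pursuers_win G X P e \<longleftrightarrow> (\<exists>t\<ge>0. (\<exists>h\<in>X. P h t = e t) \<and> (\<forall>s\<in>{0..t}. e s \<notin> G))"

text \<open>The evader must not meet a pursuer up to and including the moment of arrival; what happens after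
  its first arrival is irrelevant, as \<open>t\<close> can be taken to be that moment. If the evader meets its first
  pursuer at the very moment of its first arrival, neither side wins.\<close>

definition evader_wins ::
    "point set \<Rightarrow> point set \<Rightarrow> (point \<Rightarrow> real \<Rightarrow> point) \<Rightarrow> (real \<Rightarrow> point) \<Rightarrow> bool" where
  "evader_wins G X P e \<longleftrightarrow> (\<exists>t\<ge>0. e t \<in> G \<and> (\<forall>s\<in>{0..t}. \<forall>h\<in>X. P h s \<noteq> e s))"

definition pursuit_winning_region ::
    "point set \<Rightarrow> point set \<Rightarrow> real \<Rightarrow> real \<Rightarrow> point set \<Rightarrow> point set" where
  "pursuit_winning_region D G vP vE X =
     {z \<in> D - G. \<exists>S. pursuit_strategy D vP vE X z S \<and>
        (\<forall>e. trajectory D vE z e \<longrightarrow> pursuers_win G X (S e) e)}"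

text \<open>Feedback laws may be discontinuous, so a law could fail to generate any play at all. A law
  guarantees the evader's winning only if it generates a play against every strategy of the coalition
  and every play it generates is won.\<close>

definition evasion_winning_region ::
    "point set \<Rightarrow> point set \<Rightarrow> real \<Rightarrow> real \<Rightarrow> point set \<Rightarrow> point set" where
  "evasion_winning_region D G vP vE X =
     {z \<in> D - G. \<exists>\<sigma>. (\<forall>a p. norm (\<sigma> a p) = 1) \<and>
        (\<forall>S. pursuit_strategy D vP vE X z S \<longrightarrow>
           (\<exists>e. trajectory D vE z e \<and> follows_feedback G vE X \<sigma> (S e) e) \<and>
           (\<forall>e. trajectory D vE z e \<and> follows_feedback G vE X \<sigma> (S e) e \<longrightarrow>
                evader_wins G X (S e) e))}"

definition barrier :: "point set \<Rightarrow> real \<Rightarrow> real \<Rightarrow> point set \<Rightarrow> point set" where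
  "barrier \<Omega> vP vE X =
     play_region \<Omega> - pursuit_winning_region \<Omega> (target_region \<Omega>) vP vE X
                   - evasion_winning_region \<Omega> (target_region \<Omega>) vP vE X"

definition free_barrier :: "real \<Rightarrow> real \<Rightarrow> real \<Rightarrow> point set \<Rightarrow> point set" where
  "free_barrier l vP vE X =
     {z. snd z < 0} - pursuit_winning_region UNIV (target_line l) vP vE X
                    - evasion_winning_region UNIV (target_line l) vP vE X"

section \<open>Virtual and active pursuers\<close>

definition mirror :: "point \<Rightarrow> point" where
  "mirror z = (fst z, - snd z)"

text \<open>Barrier of the coalition consisting of the actual pursuers \<open>X1\<close> and the virtual pursuers
  \<open>X2\<close>, the latter possibly outside of \<open>\<Omega>\<close>.\<close>

definition mixed_barrier ::
    "point set \<Rightarrow> real \<Rightarrow> real \<Rightarrow> real \<Rightarrow> point set \<Rightarrow> point set \<Rightarrow> point set" where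
  "mixed_barrier \<Omega> l vP vE X1 X2 =
     (if X2 = {} then barrier \<Omega> vP vE X1
      else free_barrier l vP vE (X1 \<union> X2) \<inter> play_region \<Omega>)"

definition active :: "real \<Rightarrow> point set \<Rightarrow> point set" where
  "active l X = {h \<in> X. \<exists>p \<in> target_line l. \<forall>h' \<in> X - {h}. dist p h < dist p h'}"

definition lists_increasing :: "point list \<Rightarrow> point set \<Rightarrow> bool" where
  "lists_increasing hs A \<longleftrightarrow> set hs = A \<and> sorted_wrt (\<lambda>a b. fst a < fst b) hs"

section \<open>The explicit curves\<close>

text \<open>The common form of the hyperbolic pieces: the branch in \<open>{y < 0}\<close> belonging to the pursuer \<open>h\<close>,
  over the open interval \<open>(a, b)\<close>.\<close>

definition hyp_arc :: "real \<Rightarrow> point \<Rightarrow> real \<Rightarrow> real \<Rightarrow> point set" where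
  "hyp_arc \<alpha> h a b =
     {(x, y). (x - fst h)\<^sup>2 + (1 - 1 / \<alpha>\<^sup>2) * y\<^sup>2 + (1 - \<alpha>\<^sup>2) * (snd h)\<^sup>2 = 0 \<and>
              a < x \<and> x < b \<and> y < 0}"

definition F1_1 :: "real \<Rightarrow> point \<Rightarrow> point set" where
  "F1_1 \<alpha> h = {z. norm (z - (0, 0)) = \<alpha> * norm (h - (0, 0)) \<and> fst z \<le> \<alpha>\<^sup>2 * fst h \<and> snd z < 0}"

definition F1_2 :: "real \<Rightarrow> real \<Rightarrow> point \<Rightarrow> point set" where
  "F1_2 \<alpha> l h = hyp_arc \<alpha> h (\<alpha>\<^sup>2 * fst h) ((1 - \<alpha>\<^sup>2) * l + \<alpha>\<^sup>2 * fst h)"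

definition F1_3 :: "real \<Rightarrow> real \<Rightarrow> point \<Rightarrow> point set" where
  "F1_3 \<alpha> l h = {z. norm (z - (l, 0)) = \<alpha> * norm (h - (l, 0)) \<and>
                     fst z \<ge> (1 - \<alpha>\<^sup>2) * l + \<alpha>\<^sup>2 * fst h \<and> snd z < 0}"

definition equidist_x :: "point \<Rightarrow> point \<Rightarrow> real" where
  "equidist_x h h' = (THE x. norm ((x, 0) - h) = norm ((x, 0) - h'))"

definition F2_2 :: "real \<Rightarrow> point \<Rightarrow> point \<Rightarrow> point set" where
  "F2_2 \<alpha> h1 h2 =
     hyp_arc \<alpha> h1 (\<alpha>\<^sup>2 * fst h1) ((1 - \<alpha>\<^sup>2) * equidist_x h1 h2 + \<alpha>\<^sup>2 * fst h1)"

definition F2_3 :: "real \<Rightarrow> point \<Rightarrow> point \<Rightarrow> point set" where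
  "F2_3 \<alpha> h1 h2 =
     (let xc = equidist_x h1 h2 in
      {z. norm (z - (xc, 0)) = \<alpha> * norm (h1 - (xc, 0)) \<and>
          fst z \<in> {(1 - \<alpha>\<^sup>2) * xc + \<alpha>\<^sup>2 * fst h1 .. (1 - \<alpha>\<^sup>2) * xc + \<alpha>\<^sup>2 * fst h2} \<and> snd z < 0})"

definition F2_4 :: "real \<Rightarrow> real \<Rightarrow> point \<Rightarrow> point \<Rightarrow> point set" where
  "F2_4 \<alpha> l h1 h2 =
     hyp_arc \<alpha> h2 ((1 - \<alpha>\<^sup>2) * equidist_x h1 h2 + \<alpha>\<^sup>2 * fst h2) ((1 - \<alpha>\<^sup>2) * l + \<alpha>\<^sup>2 * fst h2)"

definition F3 :: "real \<Rightarrow> point \<Rightarrow> point \<Rightarrow> point \<Rightarrow> point set" where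
  "F3 \<alpha> h1 h2 h3 =
     hyp_arc \<alpha> h2 ((1 - \<alpha>\<^sup>2) * equidist_x h1 h2 + \<alpha>\<^sup>2 * fst h2)
                   ((1 - \<alpha>\<^sup>2) * equidist_x h2 h3 + \<alpha>\<^sup>2 * fst h2)"

text \<open>In \<open>Phi\<close>, the pieces \<open>F\<^sup>2\<^sub>1\<close> and \<open>F\<^sup>2\<^sub>5\<close> are \<open>F1_1\<close> of the first and \<open>F1_3\<close> of the
  last pursuer. Points are numbered from 1 as in \<open>h\<^sub>1, \<dots>, h\<^sub>n\<close>.\<close>

definition Phi :: "real \<Rightarrow> real \<Rightarrow> point list \<Rightarrow> point set" where
  "Phi \<alpha> l hs =
     (let n = length hs; h = (\<lambda>i. hs ! (i - 1)) in
      if n = 0 then {}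
      else if n = 1 then F1_1 \<alpha> (h 1) \<union> F1_2 \<alpha> l (h 1) \<union> F1_3 \<alpha> l (h 1)
      else if n = 2 then
        F1_1 \<alpha> (h 1) \<union> F2_2 \<alpha> (h 1) (h 2) \<union> F2_3 \<alpha> (h 1) (h 2)
          \<union> F2_4 \<alpha> l (h 1) (h 2) \<union> F1_3 \<alpha> l (h 2)
      else
        F1_1 \<alpha> (h 1) \<union> F2_2 \<alpha> (h 1) (h 2)
          \<union> (\<Union>i\<in>{1..n - 1}. F2_3 \<alpha> (h i) (h (i + 1)))
          \<union> (\<Union>i\<in>{2..n - 1}. F3 \<alpha> (h (i - 1)) (h i) (h (i + 1)))
          \<union> F2_4 \<alpha> l (h (n - 1)) (h n) \<union> F1_3 \<alpha> l (h n))"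

end

(* For p on the target line T put m(p) = |z - p| - alpha * min |h - p| over the pursuers h. The evader
   starting at z wins iff m(p) < 0 for some p, by running straight to p, and the coalition wins iff
   m > 0 on T; so z lies on the barrier iff min m = 0 on T. This depends on the pursuers only through
   their distances to T and is therefore unchanged by reflecting them in T, with or without the
   boundary of Omega.

   If m > 0 on T, then for a slightly larger ratio each p in T is still outside the Apollonius disc
   of some pursuer. Parallel pursuit keeps an uncaptured evader inside all these discs. It is sampled
   in small time steps, projected to a closed convex subset of the domain, and realised at exact
   speed by detours, which the slack in the ratio pays for; once a pursuer is close enough to the
   evader, it catches it before T by running to the evader's last observed positions. If min m = 0,
   the minimum is attained at one point c only. The coalition then runs straight to c and switches to
   the strategy for m > 0 as soon as the evader has deviated from its segment to c.

   Squaring makes m a maximum of quadratics x |-> (1 - alpha^2) x^2 + ... along the axis, one per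
   active pursuer h_i, which dominates the others on an interval between consecutive equidistant
   points. The pieces of Phi correspond to the position of the minimiser: inside such an interval
   (hyperbola), at a border of two of them, or at an endpoint of T (circles). *)

theory Submission
  imports Defs
begin


section \<open>Paths of constant speed\<close>

text \<open>Controls are unit vectors, so nobody can wait: a player ahead of schedule must burn the
  surplus length on a detour, for which the convex domain must offer room. The domain may lack
  boundary points, hence the projection to closed convex subsets that nearly exhaust it.

  Parallel pursuit alone need not end: an evader lingering near its start keeps the pursuers at
  almost their initial distance. The remaining advantage at the target line, uniform by compactness,
  absorbs the errors of sampling, projection and final chase.

  In a critical position there is no slack, and at the last moment on the segment the position is
  still critical. The switch is therefore delayed by a fixed fraction of the remaining time: by then
  the deviation has cost the evader strictly at every point of the target line, while it has had no
  time to get there. This moment is recognisable from the past because of the speed limit: an evader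
  that has left the segment cannot return to it on schedule.\<close>

definition speed_arc :: "real \<Rightarrow> real \<Rightarrow> (real \<Rightarrow> 'a::euclidean_space) \<Rightarrow> bool" where
  "speed_arc v T x \<longleftrightarrow> (\<exists>u. (\<forall>s. norm (u s) = 1) \<and>
     (\<forall>t\<in>{0..T}. ((\<lambda>s. v *\<^sub>R u s) has_integral (x t - x 0)) {0..t}))"

text \<open>Each horizon may have its own control, not assumed measurable, so that paths are easy to
  join. \<open>speed_arc_patch\<close> and integrability recover the single measurable control that
  \<open>trajectory\<close> demands.\<close>

definition speed_path :: "real \<Rightarrow> (real \<Rightarrow> 'a::euclidean_space) \<Rightarrow> bool" where
  "speed_path v x \<longleftrightarrow> (\<forall>T\<ge>0. speed_arc v T x)"

lemma has_integral_increment: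
  fixes f :: "real \<Rightarrow> 'a::euclidean_space"
  assumes "(f has_integral (x t - a)) {0..t}" "(f has_integral (x s - a)) {0..s}" "0 \<le> s" "s \<le> t"
  shows "(f has_integral (x t - x s)) {s..t}"
proof -
  have "f integrable_on {s..t}"
    using assms by (meson atLeastatMost_subset_iff has_integral_integrable integrable_on_subinterval order_refl)
  then obtain j where j: "(f has_integral j) {s..t}" by (auto simp: integrable_on_def)
  have "(f has_integral (x s - a + j)) {0..t}"
    using has_integral_combine[OF assms(3,4,2) j] .
  then have "x s - a + j = x t - a" using assms(1) has_integral_unique by blast
  then have "j = x t - x s" by (simp add: algebra_simps)
  then show ?thesis using j by simp
qed

lemma increment_bound:
  fixes u x :: "real \<Rightarrow> 'a::euclidean_space"
  assumes "\<And>s. norm (u s) = 1" "0 \<le> v" "0 \<le> s" "s \<le> t"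
    and "((\<lambda>s. v *\<^sub>R u s) has_integral (x t - a)) {0..t}"
    and "((\<lambda>s. v *\<^sub>R u s) has_integral (x s - a)) {0..s}"
  shows "norm (x t - x s) \<le> v * (t - s)"
proof -
  have "((\<lambda>s. v *\<^sub>R u s) has_integral (x t - x s)) (cbox s t)"
    using has_integral_increment[OF assms(5,6,3,4)] by simp
  from has_integral_bound[OF assms(2) this] show ?thesis
    using assms(1,2,4) by simp
qed

lemma speed_arc_subset: "speed_arc v T x \<Longrightarrow> S \<le> T \<Longrightarrow> speed_arc v S x"
  unfolding speed_arc_def by (meson atLeastAtMost_iff order_trans)

lemma speed_arc_patch:
  fixes \<tau> :: "nat \<Rightarrow> real" and x :: "real \<Rightarrow> 'a::euclidean_space"
  assumes "\<tau> 0 = 0" "\<And>k. \<tau> k \<le> \<tau> (Suc k)" "\<And>k. speed_arc v (\<tau> k) x"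
  obtains u where "\<And>s. norm (u s) = 1"
    "\<And>k t. t \<in> {0..\<tau> k} \<Longrightarrow> ((\<lambda>s. v *\<^sub>R u s) has_integral (x t - x 0)) {0..t}"
proof -
  have "\<forall>k. \<exists>u. (\<forall>s. norm (u s) = 1) \<and>
     (\<forall>t\<in>{0..\<tau> k}. ((\<lambda>s. v *\<^sub>R u s) has_integral (x t - x 0)) {0..t})"
    using assms(3) by (simp add: speed_arc_def)
  then obtain w where w: "\<And>k s. norm (w k s) = 1"
     "\<And>k t. t\<in>{0..\<tau> k} \<Longrightarrow> ((\<lambda>s. v *\<^sub>R w k s) has_integral (x t - x 0)) {0..t}"
    by metis
  have mono: "\<tau> i \<le> \<tau> j" if "i \<le> j" for i j using that assms(2) by (rule lift_Suc_mono_le[rotated])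
  \<comment> \<open>At time \<open>s\<close> the control of the first horizon beyond
    \<open>s\<close> is used. If there is none, the index is unspecified, but every
    \<open>w k\<close> takes unit values.\<close>
  define u where "u s = w (LEAST k. s < \<tau> k) s" for s
  have u1: "norm (u s) = 1" for s using w(1) by (simp add: u_def)
  have "((\<lambda>s. v *\<^sub>R u s) has_integral (x t - x 0)) {0..t}" if "t \<in> {0..\<tau> k}" for k t
    using that
  proof (induction k arbitrary: t)
    case 0
    then have "t = 0" using assms(1) by auto
    then show ?case by (simp add: has_integral_refl)
  next
    case (Suc k)
    show ?case
    proof (cases "t \<le> \<tau> k")
      case True
      then show ?thesis using Suc by auto
    next
      case False
      have k0: "0 \<le> \<tau> k" using mono[of 0 k] assms(1) by simp
      have 1: "((\<lambda>s. v *\<^sub>R u s) has_integral (x (\<tau> k) - x 0)) {0..\<tau> k}" using Suc.IH k0 by simp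
      have "((\<lambda>s. v *\<^sub>R w (Suc k) s) has_integral (x t - x (\<tau> k))) {\<tau> k..t}"
        by (rule has_integral_increment[OF w(2) w(2)]) (use Suc.prems False k0 assms(2)[of k] in auto)
      moreover have "u s = w (Suc k) s" if "s \<in> {\<tau> k..t} - {t}" for s
      proof -
        have "(LEAST k. s < \<tau> k) = Suc k"
        proof (rule Least_equality)
          show "s < \<tau> (Suc k)" using that Suc.prems by auto
        next
          fix j assume "s < \<tau> j"
          then show "Suc k \<le> j" using mono[of j k] that by force
        qed
        then show ?thesis by (simp add: u_def)
      qed
      ultimately have "((\<lambda>s. v *\<^sub>R u s) has_integral (x t - x (\<tau> k))) {\<tau> k..t}"
        using has_integral_spike_finite[of "{t}" "{\<tau> k..t}" "\<lambda>s. v *\<^sub>R u s" "\<lambda>s. v *\<^sub>R w (Suc k) s"] by auto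
      from has_integral_combine[OF k0 _ 1 this] False show ?thesis by simp
    qed
  qed
  with u1 that show ?thesis by blast
qed

lemma speed_path_trajectory:
  fixes x :: "real \<Rightarrow> point"
  assumes "speed_path v x" "v > 0" "x 0 = a" "\<And>t. t \<ge> 0 \<Longrightarrow> x t \<in> D"
  shows "trajectory D v a x"
proof -
  obtain u where u: "\<And>s. norm (u s) = 1"
    "\<And>k t. t \<in> {0..real k} \<Longrightarrow> ((\<lambda>s. v *\<^sub>R u s) has_integral (x t - x 0)) {0..t}"
    using speed_arc_patch[of "\<lambda>k. real k" v x] assms(1) unfolding speed_path_def by auto
  \<comment> \<open>Integrability says nothing about negative times, so the control is replaced by a
    constant unit vector there.\<close>
  define w where "w s = (if s < 0 then (1, 0) else u s)" for s :: real
  have I: "((\<lambda>s. v *\<^sub>R u s) has_integral (x t - x 0)) {0..t}" if "t \<ge> 0" for t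
    using u(2)[of t "nat \<lceil>t\<rceil>"] that by (simp add: real_nat_ceiling_ge)
  have m: "(\<lambda>s. indicator {0..real n} s *\<^sub>R (v *\<^sub>R u s)) \<in> borel_measurable lebesgue" for n
    using has_integral_implies_lebesgue_measurable[OF I, of "real n"] by simp
  have A: "(\<lambda>s. indicator {0..} s *\<^sub>R (v *\<^sub>R u s)) \<in> borel_measurable lebesgue"
  proof (rule borel_measurable_LIMSEQ_metric[OF m])
    fix s :: real
    have "eventually (\<lambda>n. indicator {0..real n} s *\<^sub>R (v *\<^sub>R u s) = indicator {0..} s *\<^sub>R (v *\<^sub>R u s)) sequentially"
      using eventually_ge_at_top[of "nat \<lceil>s\<rceil>"]
      by eventually_elim (auto simp: indicator_def le_nat_iff ceiling_le_iff split: if_splits)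
    then show "(\<lambda>n. indicator {0..real n} s *\<^sub>R (v *\<^sub>R u s)) \<longlonglongrightarrow> indicator {0..} s *\<^sub>R (v *\<^sub>R u s)"
      by (rule tendsto_eventually)
  qed
  have "(\<lambda>s. (1/v) *\<^sub>R (indicator {0..} s *\<^sub>R (v *\<^sub>R u s)) + indicator {..<0} s *\<^sub>R (1, 0)) \<in> borel_measurable lebesgue"
    by (rule borel_measurable_add[OF borel_measurable_scaleR[OF borel_measurable_const A]
          borel_measurable_scaleR[OF borel_measurable_indicator borel_measurable_const]]) auto
  moreover have "(\<lambda>s. (1/v) *\<^sub>R (indicator {0..} s *\<^sub>R (v *\<^sub>R u s)) + indicator {..<0} s *\<^sub>R (1, 0)) = w"
    using assms(2) by (intro ext) (simp add: w_def indicator_def flip: zero_prod_def)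
  ultimately have "w \<in> borel_measurable lebesgue" by simp
  moreover have "norm (w s) = 1" for s using u(1) by (simp add: w_def)
  moreover have "((\<lambda>s. v *\<^sub>R w s) has_integral (x t - a)) {0..t}" if "t \<ge> 0" for t
    using I[OF that] assms(3) by (subst has_integral_cong[of _ _ "\<lambda>s. v *\<^sub>R u s"]) (auto simp: w_def)
  ultimately show ?thesis using assms(3,4) unfolding trajectory_def by blast
qed

lemma trajectory_lipschitz:
  assumes "trajectory D v a x" "0 \<le> v" "0 \<le> s" "s \<le> t"
  shows "norm (x t - x s) \<le> v * (t - s)"
proof -
  obtain u where u: "\<And>s. norm (u s) = 1" "\<And>t. t\<ge>0 \<Longrightarrow> ((\<lambda>s. v *\<^sub>R u s) has_integral (x t - a)) {0..t}"
    using assms(1) unfolding trajectory_def by blast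
  show ?thesis
    by (rule increment_bound[OF u(1) assms(2-4) u(2) u(2)]) (use assms in auto)
qed

definition join :: "real \<Rightarrow> (real \<Rightarrow> 'a) \<Rightarrow> (real \<Rightarrow> 'a) \<Rightarrow> real \<Rightarrow> 'a" where
  "join T x y t = (if t < T then x t else y (t - T))"

lemma speed_arc_join:
  assumes x: "speed_arc v T x" and y: "speed_arc v S y" and xy: "x T = y 0" and "0 \<le> T" "0 \<le> S"
  shows "speed_arc v (T + S) (join T x y)"
proof -
  obtain u where u: "\<And>s. norm (u s) = 1"
    "\<And>t. t\<in>{0..T} \<Longrightarrow> ((\<lambda>s. v *\<^sub>R u s) has_integral (x t - x 0)) {0..t}"
    using x unfolding speed_arc_def by blast
  obtain w where w: "\<And>s. norm (w s) = 1"
    "\<And>t. t\<in>{0..S} \<Longrightarrow> ((\<lambda>s. v *\<^sub>R w s) has_integral (y t - y 0)) {0..t}"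
    using y unfolding speed_arc_def by blast
  have j0: "join T x y 0 = x 0" using xy \<open>0 \<le> T\<close> by (auto simp: join_def)
  let ?u = "\<lambda>s. if s < T then u s else w (s - T)"
  have 1: "((\<lambda>s. v *\<^sub>R ?u s) has_integral (x t - x 0)) {0..t}" if "0 \<le> t" "t \<le> T" for t
    by (rule has_integral_spike_finite[of "{T}" _ _ "\<lambda>s. v *\<^sub>R u s"]) (use that u(2) in auto)
  have "((\<lambda>s. v *\<^sub>R ?u s) has_integral (join T x y t - join T x y 0)) {0..t}" if "t \<in> {0..T + S}" for t
  proof (cases "t < T")
    case True
    then show ?thesis using 1[of t] that j0 by (simp add: join_def)
  next
    case False
    have "((\<lambda>s. v *\<^sub>R w s) has_integral (y (t - T) - y 0)) {0..t - T}"
      using w(2) that False by auto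
    from has_integral_affinity[of _ _ 0 "t - T" 1 "- T", simplified, OF this]
    have "((\<lambda>s. v *\<^sub>R w (s - T)) has_integral (y (t - T) - y 0)) ((\<lambda>s. s + T) ` {0..t - T})"
      by (simp add: add.commute)
    moreover have "(\<lambda>s. s + T) ` {0..t - T} = {T..t}"
      using image_add_atLeastAtMost'[of T 0 "t - T"] by (simp)
    ultimately have 2: "((\<lambda>s. v *\<^sub>R ?u s) has_integral (y (t - T) - y 0)) {T..t}"
      by (subst has_integral_cong[of _ _ "\<lambda>s. v *\<^sub>R w (s - T)"]) auto
    show ?thesis
      using has_integral_combine[OF \<open>0 \<le> T\<close> _ 1[of T] 2] False \<open>0 \<le> T\<close> xy j0 by (simp add: join_def)
  qed
  moreover have "norm (?u s) = 1" for s using u(1) w(1) by simp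
  ultimately show ?thesis unfolding speed_arc_def by (intro exI[of _ ?u]) blast
qed

lemma speed_path_join:
  assumes "speed_arc v T x" "speed_path v y" "x T = y 0" "0 \<le> T"
  shows "speed_path v (join T x y)"
  unfolding speed_path_def
proof (intro allI impI)
  fix S :: real assume "0 \<le> S"
  then show "speed_arc v S (join T x y)"
    using speed_arc_join[of v T x S y] assms
    by (auto simp: speed_path_def intro: speed_arc_subset)
qed

lemma speed_arc_cong:
  assumes "speed_arc v T x" "\<And>t. 0 \<le> t \<Longrightarrow> t \<le> T \<Longrightarrow> x t = y t"
  shows "speed_arc v T y"
  using assms unfolding speed_arc_def by (cases "T \<ge> 0") auto

text \<open>A chase has infinitely many legs accumulating at the moment of capture; this closes the
  path at that moment. The controls, cut off at \<open>\<tau> k\<close>, are bounded by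
  \<open>v\<close>, so dominated convergence applies.\<close>

lemma speed_arc_limit:
  fixes \<tau> :: "nat \<Rightarrow> real" and x :: "real \<Rightarrow> 'a::euclidean_space"
  assumes "\<tau> 0 = 0" "\<And>k. \<tau> k \<le> \<tau> (Suc k)" "\<And>k. speed_arc v (\<tau> k) x"
    and lim: "\<tau> \<longlonglongrightarrow> T" and xlim: "(\<lambda>k. x (\<tau> k)) \<longlonglongrightarrow> x T" and "v \<ge> 0"
  shows "speed_arc v T x"
proof -
  obtain u where u: "\<And>s. norm (u s) = 1"
    "\<And>k t. t \<in> {0..\<tau> k} \<Longrightarrow> ((\<lambda>s. v *\<^sub>R u s) has_integral (x t - x 0)) {0..t}"
    using speed_arc_patch[OF assms(1-3)] by blast
  have mono: "incseq \<tau>" using assms(2) by (simp add: incseq_SucI)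
  have le: "\<tau> k \<le> T" for k using incseq_le[OF mono lim] .
  have pos: "0 \<le> \<tau> k" for k using mono assms(1) by (metis incseqD zero_le)
  define f where "f k s = (if s \<in> {0..\<tau> k} then v *\<^sub>R u s else 0)" for k s
  have fi: "(f k has_integral (x (\<tau> k) - x 0)) {0..T}" for k
    unfolding f_def using u(2)[of "\<tau> k" k] pos le
    by (subst has_integral_restrict) auto
  define g where "g s = (if s = T then 0 else v *\<^sub>R u s)" for s
  have conv: "(\<lambda>k. f k s) \<longlonglongrightarrow> g s" if s: "s \<in> {0..T} - {T}" for s
  proof -
    have "eventually (\<lambda>k. \<tau> k > s) sequentially"
      using lim s by (intro order_tendstoD(1)) auto
    then have "eventually (\<lambda>k. f k s = g s) sequentially"
      by eventually_elim (use s in \<open>auto simp: f_def g_def\<close>)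
    then show ?thesis by (rule tendsto_eventually)
  qed
  show ?thesis
  proof (cases "\<exists>k. \<tau> k = T")
    case True
    then show ?thesis using assms(3) by auto
  next
    case False
    have conv': "(\<lambda>k. f k s) \<longlonglongrightarrow> g s" if "s \<in> {0..T}" for s
    proof (cases "s = T")
      case True
      have "f k s = g s" for k using le[of k] False True by (auto simp: f_def g_def)
      then show ?thesis by simp
    qed (use conv that in auto)
    have fint: "f k integrable_on {0..T}" for k using fi has_integral_integrable by blast
    have bd: "norm (f k s) \<le> v" if "s \<in> {0..T}" for k s using u(1) \<open>v \<ge> 0\<close> by (simp add: f_def)
    have "g integrable_on {0..T}" "(\<lambda>k. integral {0..T} (f k)) \<longlonglongrightarrow> integral {0..T} g"
      using dominated_convergence[OF fint integrable_const_ivl[of v] bd conv'] by auto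
    moreover have "integral {0..T} (f k) = x (\<tau> k) - x 0" for k using fi by (rule integral_unique)
    moreover have "(\<lambda>k. x (\<tau> k) - x 0) \<longlonglongrightarrow> x T - x 0" by (intro tendsto_intros xlim)
    ultimately have "(g has_integral (x T - x 0)) {0..T}"
      by (metis (no_types, lifting) LIMSEQ_unique ext has_integral_integral)
    then have IT: "((\<lambda>s. v *\<^sub>R u s) has_integral (x T - x 0)) {0..T}"
      by (rule has_integral_spike_finite[of "{T}", rotated 2]) (auto simp: g_def)
    have "((\<lambda>s. v *\<^sub>R u s) has_integral (x t - x 0)) {0..t}" if "t \<in> {0..T}" for t
    proof (cases "t = T")
      case True then show ?thesis using IT by simp
    next
      case False
      then have "eventually (\<lambda>k. \<tau> k > t) sequentially" using lim that by (intro order_tendstoD(1)) auto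
      then obtain k where "t < \<tau> k" by (auto simp: eventually_sequentially)
      then show ?thesis using u(2)[of t k] that by auto
    qed
    then show ?thesis unfolding speed_arc_def using u(1) by blast
  qed
qed


section \<open>Straight motion, glued pieces and detours in a convex set\<close>

definition line :: "real \<Rightarrow> 'a::euclidean_space \<Rightarrow> 'a \<Rightarrow> real \<Rightarrow> 'a" where
  "line v A B t = A + (v * t) *\<^sub>R sgn (B - A)"

lemma line_0 [simp]: "line v A B 0 = A"
  by (simp add: line_def)

lemma line_end [simp]: "v \<noteq> 0 \<Longrightarrow> line v A B (norm (B - A) / v) = B"
  by (cases "A = B") (simp_all add: line_def sgn_div_norm)

text \<open>For \<open>A = B\<close> the direction is \<open>sgn 0 = 0\<close>, which is no unit
  control, so only the trivial duration is left.\<close>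

lemma speed_arc_line:
  assumes "A \<noteq> B \<or> T \<le> 0"
  shows "speed_arc v T (line v A B)"
proof (cases "A = B")
  case True
  then have "T \<le> 0" using assms by simp
  moreover obtain w :: 'a where "norm w = 1" using vector_choose_size[of 1] by auto
  ultimately show ?thesis unfolding speed_arc_def using True
    by (intro exI[of _ "\<lambda>_. w"]) (auto simp: line_def has_integral_refl)
next
  case False
  have "((\<lambda>s. v *\<^sub>R sgn (B - A)) has_integral (line v A B t - line v A B 0)) {0..t}" if "t \<in> {0..T}" for t
    using has_integral_const_real[of "v *\<^sub>R sgn (B - A)" 0 t] that
    by (simp add: line_def mult.commute)
  then show ?thesis unfolding speed_arc_def using False
    by (intro exI[of _ "\<lambda>_. sgn (B - A)"]) (simp add: norm_sgn)
qed

lemma speed_arc_segment: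
  assumes "v > 0"
  shows "speed_arc v (norm (B - A) / v) (line v A B)"
  by (rule speed_arc_line) auto

lemma line_segment:
  assumes "0 \<le> t" "t \<le> norm (B - A) / v" "v > 0"
  shows "line v A B t \<in> closed_segment A B"
proof (cases "A = B")
  case False
  define r where "r = v * t / norm (B - A)"
  have "line v A B t = (1 - r) *\<^sub>R A + r *\<^sub>R B"
    using False by (simp add: line_def r_def sgn_div_norm algebra_simps divide_inverse)
  moreover have "0 \<le> r" "r \<le> 1" using assms False by (auto simp: r_def field_simps)
  ultimately show ?thesis by (auto simp: closed_segment_def)
qed (simp add: line_def)

lemma line_in_convex:
  assumes "convex D" "A \<in> D" "B \<in> D" "0 \<le> t" "t \<le> norm (B - A) / v" "v > 0"
  shows "line v A B t \<in> D"
  using line_segment[OF assms(4-6)] assms(1-3) closed_segment_subset by blast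

primrec chain :: "(nat \<Rightarrow> real) \<Rightarrow> (nat \<Rightarrow> real \<Rightarrow> 'a) \<Rightarrow> nat \<Rightarrow> real \<Rightarrow> 'a" where
  "chain \<tau> a 0 = (\<lambda>_. a 0 0)"
| "chain \<tau> a (Suc k) = join (\<tau> k) (chain \<tau> a k) (a k)"

text \<open>Chains are only ever extended (\<open>chain_stable\<close>), so the first one that
  reaches beyond \<open>t\<close> already has the final value at \<open>t\<close>.\<close>

definition glue :: "(nat \<Rightarrow> real) \<Rightarrow> (nat \<Rightarrow> real \<Rightarrow> 'a) \<Rightarrow> real \<Rightarrow> 'a" where
  "glue \<tau> a t = chain \<tau> a (LEAST k. t < \<tau> k) t"

text \<open>Pieces of zero length are allowed: the legs of a chase degenerate once the evader is
  caught.\<close>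

locale pieces =
  fixes v :: real and \<tau> :: "nat \<Rightarrow> real" and a :: "nat \<Rightarrow> real \<Rightarrow> 'a::euclidean_space"
  assumes start: "\<tau> 0 = 0" and mono: "\<tau> k \<le> \<tau> (Suc k)"
    and arcs: "speed_arc v (\<tau> (Suc k) - \<tau> k) (a k)"
    and link: "a k (\<tau> (Suc k) - \<tau> k) = a (Suc k) 0"
begin

lemma times_mono: "i \<le> j \<Longrightarrow> \<tau> i \<le> \<tau> j"
  using mono by (rule lift_Suc_mono_le)

lemma times_nonneg: "0 \<le> \<tau> k"
  using times_mono[of 0 k] start by simp

lemma chain_end: "chain \<tau> a k (\<tau> k) = a k 0"
  using mono[of "k - 1"] link[of "k - 1"] by (cases k) (auto simp: join_def)

lemma speed_arc_chain: "speed_arc v (\<tau> k) (chain \<tau> a k)"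
proof (induction k)
  case 0
  obtain w :: 'a where "norm w = 1" using vector_choose_size[of 1] by auto
  then show ?case unfolding speed_arc_def using start by (intro exI[of _ "\<lambda>_. w"]) auto
next
  case (Suc k)
  show ?case
    using speed_arc_join[OF Suc arcs[of k]] chain_end times_nonneg mono[of k] by simp
qed

lemma chain_stable: "k \<le> m \<Longrightarrow> t \<le> \<tau> k \<Longrightarrow> chain \<tau> a m t = chain \<tau> a k t"
proof (induction m rule: dec_induct)
  case (step m)
  then have "t < \<tau> m \<or> t = \<tau> m" using times_mono[of k m] by linarith
  then show ?case using step chain_end[of m] by (auto simp: join_def)
qed simp

lemma glue_eq: "t < \<tau> k \<Longrightarrow> glue \<tau> a t = chain \<tau> a k t"
  unfolding glue_def by (metis LeastI Least_le chain_stable less_imp_le)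

lemma piece_exists:
  assumes "0 \<le> t" "t < \<tau> k"
  obtains j where "j < k" "\<tau> j \<le> t" "t < \<tau> (Suc j)"
proof -
  define m where "m = (LEAST k. t < \<tau> k)"
  have "t < \<tau> m" "m \<le> k" using assms(2) unfolding m_def by (auto intro: LeastI Least_le)
  moreover have "m \<noteq> 0" using \<open>t < \<tau> m\<close> start assms(1) by (metis not_less)
  ultimately show ?thesis
    using that[of "m - 1"] not_less_Least[of "m - 1" "\<lambda>k. t < \<tau> k"] by (auto simp: m_def)
qed

lemma glue_piece: "\<tau> k \<le> t \<Longrightarrow> t < \<tau> (Suc k) \<Longrightarrow> glue \<tau> a t = a k (t - \<tau> k)"
  using glue_eq[of t "Suc k"] by (simp add: join_def)

lemma glue_in:
  assumes "0 \<le> t" "t < \<tau> k" "\<And>k s. 0 \<le> s \<Longrightarrow> s \<le> \<tau> (Suc k) - \<tau> k \<Longrightarrow> a k s \<in> D"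
  shows "glue \<tau> a t \<in> D"
  using piece_exists[OF assms(1,2)] glue_piece assms(3)
  by (metis diff_ge_0_iff_ge diff_right_mono less_eq_real_def)

lemma speed_path_glue:
  assumes "\<And>t. \<exists>k. t < \<tau> k"
  shows "speed_path v (glue \<tau> a)"
  unfolding speed_path_def
proof (intro allI impI)
  fix T :: real
  obtain k where k: "T < \<tau> k" using assms by blast
  show "speed_arc v T (glue \<tau> a)"
    by (rule speed_arc_cong[OF speed_arc_subset[OF speed_arc_chain[of k]]])
      (use k glue_eq[of _ k] in auto)
qed

end

text \<open>The detour runs from \<open>A\<close> along the segment towards \<open>c\<close> and
  from some turning point straight to \<open>B\<close>. Its length depends continuously on the
  turning point and passes from at most to at least \<open>v * \<delta>\<close>, so it takes this
  exact value.\<close>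

lemma detour_exists:
  fixes A B c :: "'a::euclidean_space"
  assumes "convex D" "A \<in> D" "B \<in> D" "c \<in> D" "v > 0"
    and "norm (B - A) \<le> v * \<delta>" "v * \<delta> \<le> norm (c - A)"
  obtains a where "speed_arc v \<delta> a" "a 0 = A" "a \<delta> = B" "\<And>t. t \<in> {0..\<delta>} \<Longrightarrow> a t \<in> D"
proof -
  define C where "C r = A + r *\<^sub>R (c - A)" for r
  define f where "f r = norm (C r - A) + norm (B - C r)" for r
  have "f 0 \<le> v * \<delta>" "v * \<delta> \<le> f 1" using assms by (auto simp: f_def C_def intro: add_increasing2)
  moreover have "continuous_on {0..1} f" unfolding f_def C_def by (intro continuous_intros)
  ultimately obtain r where r: "0 \<le> r" "r \<le> 1" "f r = v * \<delta>"
    using IVT'[of f 0 "v * \<delta>" 1] by auto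
  have Cr: "C r \<in> D"
    using mem_convex_alt[OF assms(1,2,4), of "1 - r" r] r by (simp add: C_def algebra_simps)
  define T where "T = norm (C r - A) / v"
  have T0: "0 \<le> T" using assms(5) by (simp add: T_def)
  have dT: "\<delta> - T = norm (B - C r) / v" using r(3) assms(5) by (simp add: T_def f_def field_simps)
  then have dT0: "0 \<le> \<delta> - T" using assms(5) by simp
  define a where "a = join T (line v A (C r)) (line v (C r) B)"
  have 1: "line v A (C r) T = C r" using assms(5) by (simp add: T_def)
  have "speed_arc v (T + (\<delta> - T)) a" unfolding a_def
    by (rule speed_arc_join) (use 1 T0 dT0 dT assms(5) speed_arc_segment in \<open>auto simp: T_def\<close>)
  moreover have "a 0 = A" using 1 T0 by (auto simp: a_def join_def)
  moreover have "a \<delta> = B"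
    using dT0 dT[symmetric] line_end[of v "C r" B] assms(5) by (simp add: a_def join_def)
  moreover have "a t \<in> D" if "t \<in> {0..\<delta>}" for t
  proof (cases "t < T")
    case True
    then show ?thesis using line_in_convex[OF assms(1,2) Cr, of t v] that assms(5) by (simp add: a_def join_def T_def)
  next
    case False
    then show ?thesis using line_in_convex[OF assms(1) Cr assms(3), of "t - T" v] that assms(5) dT
      by (simp add: a_def join_def)
  qed
  ultimately show ?thesis using that[of a] by simp
qed

text \<open>The choice depends on the end points alone; hence a pursuer's path depends on the evader
  only through the sampled targets.\<close>

definition detour :: "'a::euclidean_space set \<Rightarrow> real \<Rightarrow> real \<Rightarrow> 'a \<Rightarrow> 'a \<Rightarrow> real \<Rightarrow> 'a" where
  "detour D v \<delta> A B = (SOME a. speed_arc v \<delta> a \<and> a 0 = A \<and> a \<delta> = B \<and> (\<forall>t\<in>{0..\<delta>}. a t \<in> D))"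

definition follow :: "'a::euclidean_space set \<Rightarrow> real \<Rightarrow> real \<Rightarrow> (nat \<Rightarrow> 'a) \<Rightarrow> real \<Rightarrow> 'a" where
  "follow D v \<delta> A = glue (\<lambda>k. real k * \<delta>) (\<lambda>k. detour D v \<delta> (A k) (A (Suc k)))"

text \<open>Every point of \<open>D\<close> has a partner far enough away to waste a whole time
  step. Two points at distance \<open>2 * v * \<delta>\<close> provide this, as one of them is far
  from any given point.\<close>

locale room =
  fixes D :: "'a::euclidean_space set" and v \<delta> :: real
  assumes convex: "convex D" and v_pos: "v > 0" and step_pos: "\<delta> > 0"
    and room: "A \<in> D \<Longrightarrow> \<exists>c\<in>D. v * \<delta> \<le> norm (c - A)"
begin

lemma detour:
  assumes "A \<in> D" "B \<in> D" "norm (B - A) \<le> v * \<delta>"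
  shows "speed_arc v \<delta> (detour D v \<delta> A B)" "detour D v \<delta> A B 0 = A" "detour D v \<delta> A B \<delta> = B"
    "t \<in> {0..\<delta>} \<Longrightarrow> detour D v \<delta> A B t \<in> D"
proof -
  obtain c where "c \<in> D" "v * \<delta> \<le> norm (c - A)" using room assms(1) by blast
  from detour_exists[OF convex assms(1,2) this(1) v_pos assms(3) this(2)]
  have "\<exists>a. speed_arc v \<delta> a \<and> a 0 = A \<and> a \<delta> = B \<and> (\<forall>t\<in>{0..\<delta>}. a t \<in> D)" by metis
  from someI_ex[OF this]
  show "speed_arc v \<delta> (detour D v \<delta> A B)" "detour D v \<delta> A B 0 = A" "detour D v \<delta> A B \<delta> = B"
    "t \<in> {0..\<delta>} \<Longrightarrow> detour D v \<delta> A B t \<in> D" unfolding detour_def by auto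
qed

context
  fixes A :: "nat \<Rightarrow> 'a"
  assumes A: "A k \<in> D" and close: "norm (A (Suc k) - A k) \<le> v * \<delta>"
begin

interpretation pieces v "\<lambda>k. real k * \<delta>" "\<lambda>k. detour D v \<delta> (A k) (A (Suc k))"
  using detour[OF A A close] step_pos by unfold_locales (auto simp: algebra_simps)

lemma unbounded: "\<exists>k. t < real k * \<delta>"
  using step_pos reals_Archimedean3 by blast

lemma speed_path_follow: "speed_path v (follow D v \<delta> A)"
  unfolding follow_def using unbounded by (rule speed_path_glue)

lemma follow_in: "t \<ge> 0 \<Longrightarrow> follow D v \<delta> A t \<in> D"
proof -
  assume t: "t \<ge> 0"
  obtain k where k: "t < real k * \<delta>" using unbounded by blast
  show ?thesis unfolding follow_def
    by (rule glue_in[OF t k detour(4)[OF A A close]]) (simp add: algebra_simps)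
qed

lemma follow_piece:
  "real k * \<delta> \<le> t \<Longrightarrow> t < real (Suc k) * \<delta> \<Longrightarrow> follow D v \<delta> A t = detour D v \<delta> (A k) (A (Suc k)) (t - real k * \<delta>)"
  unfolding follow_def by (rule glue_piece)

lemma follow_at: "follow D v \<delta> A (real k * \<delta>) = A k"
  using follow_piece[of k "real k * \<delta>"] step_pos detour(2)[OF A A close] by (simp add: algebra_simps)

end

end

lemma room_exists:
  fixes D :: "'a::euclidean_space set"
  assumes "convex D" "c0 \<in> D" "c1 \<in> D" "v > 0" "\<delta> > 0" "2 * v * \<delta> \<le> norm (c0 - c1)"
  shows "room D v \<delta>"
proof
  fix A
  have "norm (c0 - c1) \<le> norm (c0 - A) + norm (c1 - A)"
    by (metis norm_triangle_sub norm_minus_commute norm_triangle_ineq4 diff_diff_eq2 diff_add_cancel)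
  then have "v * \<delta> \<le> norm (c0 - A) \<or> v * \<delta> \<le> norm (c1 - A)" using assms(6) by linarith
  then show "\<exists>c\<in>D. v * \<delta> \<le> norm (c - A)" using assms(2,3) by blast
qed (use assms in auto)

text \<open>As standing still is impossible, a player whose task is done keeps making loops through
  its position.\<close>

lemma stay_exists:
  fixes D :: "'a::euclidean_space set"
  assumes "convex D" "c0 \<in> D" "c1 \<in> D" "c0 \<noteq> c1" "v > 0" "A \<in> D"
  shows "\<exists>y. speed_path v y \<and> y 0 = A \<and> (\<forall>t\<ge>0. y t \<in> D)"
proof -
  define \<delta> where "\<delta> = norm (c0 - c1) / (2 * v)"
  interpret room D v \<delta>
    by (rule room_exists[of D c0 c1]) (use assms in \<open>auto simp: \<delta>_def\<close>)
  have "norm (A - A) \<le> v * \<delta>" using v_pos step_pos by simp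
  then show ?thesis
    using speed_path_follow[of "\<lambda>_. A"] follow_in[of "\<lambda>_. A"] follow_at[of "\<lambda>_. A" 0] assms(6) by auto
qed

lemma travel_exists:
  fixes D :: "'a::euclidean_space set"
  assumes "convex D" "A \<in> D" "B \<in> D" "A \<noteq> B" "v > 0"
  shows "\<exists>y. speed_path v y \<and> (\<forall>t\<in>{0..norm (B - A) / v}. y t = line v A B t) \<and> (\<forall>t\<ge>0. y t \<in> D)"
proof -
  obtain y where y: "speed_path v y" "y 0 = B" "\<forall>t\<ge>0. y t \<in> D"
    using stay_exists[OF assms(1-5) assms(3)] by blast
  define T where "T = norm (B - A) / v"
  have T: "0 \<le> T" "line v A B T = B" using assms(5) by (auto simp: T_def)
  have "speed_path v (join T (line v A B) y)"
    by (rule speed_path_join) (use y T assms speed_arc_line[of A B] in auto)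
  moreover have "join T (line v A B) y t = line v A B t" if "t \<in> {0..T}" for t
    using that y(2) T by (cases "t = T") (auto simp: join_def)
  moreover have "join T (line v A B) y t \<in> D" if "t \<ge> 0" for t
    using that y(3) line_in_convex[OF assms(1-3) that _ assms(5)] by (auto simp: join_def T_def)
  ultimately show ?thesis unfolding T_def by blast
qed


section \<open>Causal pursuit strategies\<close>

definition evader_path :: "'a::euclidean_space set \<Rightarrow> real \<Rightarrow> (real \<Rightarrow> 'a) \<Rightarrow> bool" where
  "evader_path D w e \<longleftrightarrow> (\<forall>t\<ge>0. e t \<in> D) \<and> (\<forall>s\<ge>0. \<forall>t\<ge>s. norm (e t - e s) \<le> w * (t - s))"

definition causal :: "((real \<Rightarrow> 'a) \<Rightarrow> real \<Rightarrow> 'b) \<Rightarrow> bool" where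
  "causal F \<longleftrightarrow> (\<forall>e e' t. t \<ge> 0 \<longrightarrow> (\<forall>s\<in>{0..t}. e s = e' s) \<longrightarrow> F e t = F e' t)"

lemma evader_pathD:
  assumes "evader_path D w e"
  shows "t \<ge> 0 \<Longrightarrow> e t \<in> D" "0 \<le> s \<Longrightarrow> s \<le> t \<Longrightarrow> norm (e t - e s) \<le> w * (t - s)"
  using assms by (auto simp: evader_path_def)

lemma evader_path_shift: "evader_path D w e \<Longrightarrow> c \<ge> 0 \<Longrightarrow> evader_path D w (\<lambda>t. e (c + t))"
  by (auto simp: evader_path_def) (metis add_diff_cancel_left add_increasing2 add_left_mono)

text \<open>The pair consists of the time of the \<open>k\<close>-th observation and the pursuer's
  position at that time; the next position is where the evader has just been seen.\<close>

primrec visit :: "real \<Rightarrow> 'a::euclidean_space \<Rightarrow> (real \<Rightarrow> 'a) \<Rightarrow> nat \<Rightarrow> real \<times> 'a" where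
  "visit v P e 0 = (0, P)"
| "visit v P e (Suc k) =
     (fst (visit v P e k) + norm (e (fst (visit v P e k)) - snd (visit v P e k)) / v, e (fst (visit v P e k)))"

text \<open>An arrival time is fixed at the observation before it. So the past up to
  \<open>t\<close> determines one visit more than those that have taken place by
  \<open>t\<close>.\<close>

lemma visit_causal:
  assumes "\<forall>s\<in>{0..t}. e s = e' s" "v > 0" "fst (visit v P e k) \<le> t"
  shows "visit v P e (Suc k) = visit v P e' (Suc k)"
proof -
  have mono: "fst (visit v P e j) \<le> fst (visit v P e (Suc j))" for j using assms(2) by simp
  have nn: "0 \<le> fst (visit v P e j)" for j
    using lift_Suc_mono_le[of "\<lambda>j. fst (visit v P e j)" 0 j] mono by simp
  show ?thesis using assms(3)
  proof (induction k)
    case 0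
    then show ?case using assms(1) by simp
  next
    case (Suc k)
    have "fst (visit v P e k) \<le> t" using mono[of k] Suc.prems by linarith
    from Suc.IH[OF this] have eq: "visit v P e (Suc k) = visit v P e' (Suc k)" .
    then have "e (fst (visit v P e (Suc k))) = e' (fst (visit v P e' (Suc k)))"
      using assms(1) Suc.prems nn[of "Suc k"] by (metis atLeastAtMost_iff)
    then show ?case using eq by (metis visit.simps(2))
  qed
qed

text \<open>The pursuer runs straight to the evader's last observed position, observes again, and so on:
  the gaps shrink geometrically, so the observation times accumulate at a moment of capture.\<close>

lemma chase_exists:
  fixes D :: "'a::euclidean_space set"
  assumes D: "convex D" "c0 \<in> D" "c1 \<in> D" "c0 \<noteq> c1" and P: "P \<in> D" and w: "0 \<le> w" "w < v"
  shows "\<exists>F. causal F \<and> (\<forall>e. evader_path D w e \<longrightarrow>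
    speed_path v (F e) \<and> F e 0 = P \<and> (\<forall>t\<ge>0. F e t \<in> D) \<and>
    (\<exists>t\<ge>0. t \<le> norm (e 0 - P) / (v - w) \<and> F e t = e t))"
proof -
  have v: "v > 0" using w by simp
  have "\<forall>q\<in>D. \<exists>y. speed_path v y \<and> y 0 = q \<and> (\<forall>t\<ge>0. y t \<in> D)"
    using stay_exists[OF D v] by blast
  then obtain st where st: "\<And>q. q \<in> D \<Longrightarrow> speed_path v (st q)" "\<And>q. q \<in> D \<Longrightarrow> st q 0 = q"
    "\<And>q t. q \<in> D \<Longrightarrow> t \<ge> 0 \<Longrightarrow> st q t \<in> D" by metis
  define \<tau> where "\<tau> e k = fst (visit v P e k)" for e k
  define V where "V e k = snd (visit v P e k)" for e k
  define a where "a e k = line v (V e k) (V e (Suc k))" for e k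
  define T where "T e = Sup (range (\<tau> e))" for e
  \<comment> \<open>After the accumulation time \<open>T e\<close> any continuation inside
    \<open>D\<close> will do.\<close>
  define F where "F e t = (if \<exists>k. t < \<tau> e k then glue (\<tau> e) (a e) t else st (e (T e)) (t - T e))" for e t
  have \<tau>0: "\<tau> e 0 = 0" and \<tau>S: "\<tau> e (Suc k) = \<tau> e k + norm (V e (Suc k) - V e k) / v"
    and V0: "V e 0 = P" and VS: "V e (Suc k) = e (\<tau> e k)" for e k
    by (auto simp: \<tau>_def V_def)
  have tmono: "\<tau> e k \<le> \<tau> e (Suc k)" for e k using \<tau>S v by simp
  have nn: "0 \<le> \<tau> e k" for e k using lift_Suc_mono_le[of "\<tau> e" 0 k] tmono \<tau>0 by simp
  have "causal F" unfolding causal_def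
  proof (intro allI impI)
    fix e e' :: "real \<Rightarrow> 'a" and t :: real
    assume t: "t \<ge> 0" and eq: "\<forall>s\<in>{0..t}. e s = e' s"
    have same: "\<tau> e j = \<tau> e' j \<and> V e j = V e' j" if "j \<le> Suc k" "\<tau> e k \<le> t" for j k
    proof (cases j)
      case (Suc i)
      have "\<tau> e i \<le> t" using lift_Suc_mono_le[of "\<tau> e" i k] tmono that Suc by fastforce
      then show ?thesis using visit_causal[OF eq v, of P i] Suc unfolding \<tau>_def V_def by metis
    qed (simp add: \<tau>0 V0)
    show "F e t = F e' t"
    proof (cases "\<exists>k. t < \<tau> e k")
      case True
      define m where "m = (LEAST k. t < \<tau> e k)"
      have m: "t < \<tau> e m" unfolding m_def using True by (rule LeastI_ex)
      then have "m \<noteq> 0" using \<tau>0[of e] t by (intro notI) simp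
      then obtain i where i: "m = Suc i" by (cases m) auto
      have "\<tau> e i \<le> t" using not_less_Least[of i "\<lambda>k. t < \<tau> e k"] i by (simp add: m_def)
      then have eqs: "\<tau> e j = \<tau> e' j" "V e j = V e' j" if "j \<le> m" for j using same that i by auto
      have "(LEAST k. t < \<tau> e' k) = m"
      proof (rule Least_equality)
        show "t < \<tau> e' m" using m eqs by simp
      next
        fix y assume "t < \<tau> e' y"
        then show "m \<le> y" using eqs[of y] Least_le[of "\<lambda>k. t < \<tau> e k" y] m_def by (metis nle_le)
      qed
      moreover have "chain (\<tau> e) (a e) k = chain (\<tau> e') (a e') k" if "k \<le> m" for k
        using that
      proof (induction k)
        case 0
        then show ?case using eqs[of 0] eqs[of 1] i by (simp add: a_def)
      next
        case (Suc k)
        then show ?case using eqs[of k] eqs[of "Suc k"] by (simp add: a_def)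
      qed
      ultimately have "glue (\<tau> e) (a e) t = glue (\<tau> e') (a e') t"
        unfolding glue_def m_def[symmetric] by simp
      then show ?thesis using True m eqs[of m] unfolding F_def by auto
    next
      case False
      then have le: "\<tau> e k \<le> t" for k by (meson not_less)
      have eqt: "\<tau> e = \<tau> e'" using same[OF _ le] by (intro ext) (meson le_SucI order_refl)
      have "T e \<le> t" unfolding T_def using le by (intro cSUP_least) auto
      moreover have "0 \<le> T e" unfolding T_def using cSUP_upper[of 0 UNIV "\<tau> e"] bdd_aboveI2[of UNIV "\<tau> e", OF le] \<tau>0[of e] by simp
      ultimately have "e (T e) = e' (T e')" using eq eqt by (simp add: T_def)
      then show ?thesis using False eqt unfolding F_def by (simp add: T_def)
    qed
  qed
  moreover have "speed_path v (F e) \<and> F e 0 = P \<and> (\<forall>t\<ge>0. F e t \<in> D) \<and>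
    (\<exists>t\<ge>0. t \<le> norm (e 0 - P) / (v - w) \<and> F e t = e t)" if e: "evader_path D w e" for e
  proof -
    have VD: "V e k \<in> D" for k using P e nn V0 VS by (cases k) (auto dest: evader_pathD)
    interpret pieces v "\<tau> e" "a e"
    proof
      show "speed_arc v (\<tau> e (Suc k) - \<tau> e k) (a e k)" for k
        unfolding a_def \<tau>S using speed_arc_segment[OF v] by simp
      show "a e k (\<tau> e (Suc k) - \<tau> e k) = a e (Suc k) 0" for k
        unfolding a_def \<tau>S using v by simp
    qed (use \<tau>0 tmono in auto)
    define d where "d k = norm (V e (Suc k) - V e k)" for k
    have dd: "d (Suc k) \<le> w * d k / v" for k
    proof -
      have "d (Suc k) \<le> w * (\<tau> e (Suc k) - \<tau> e k)"
        unfolding d_def VS using evader_pathD(2)[OF e nn tmono] .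
      then show ?thesis using \<tau>S by (simp add: d_def)
    qed
    \<comment> \<open>\<open>d k / (v - w)\<close> is the time for closing the gap
      \<open>d k\<close> at relative speed \<open>v - w\<close>. A leg takes \<open>d k / v\<close>
      and leaves a gap of at most \<open>w * d k / v\<close>, so elapsed time plus this estimate
      never increases.\<close>
    have bound: "\<tau> e k + d k / (v - w) \<le> d 0 / (v - w)" for k
    proof (induction k)
      case (Suc k)
      have "d (Suc k) / (v - w) \<le> (w * d k / v) / (v - w)" using dd w by (intro divide_right_mono) auto
      moreover have "d k / v + (w * d k / v) / (v - w) = d k / (v - w)" using v w by (simp add: divide_simps) algebra
      moreover have "\<tau> e (Suc k) = \<tau> e k + d k / v" using \<tau>S by (simp add: d_def)
      ultimately show ?case using Suc by linarith
    qed (simp add: \<tau>0)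
    have d0: "d k \<ge> 0" for k by (simp add: d_def)
    have ub: "\<tau> e k \<le> d 0 / (v - w)" for k using bound[of k] d0[of k] w by (smt (verit) divide_nonneg_pos)
    have bdd: "bdd_above (range (\<tau> e))" using ub by (auto intro!: bdd_aboveI)
    have leT: "\<tau> e k \<le> T e" for k unfolding T_def using bdd by (intro cSUP_upper) auto
    have T0: "0 \<le> T e" using leT[of 0] \<tau>0[of e] by simp
    have Tub: "T e \<le> d 0 / (v - w)" unfolding T_def using ub by (intro cSUP_least) auto
    have lt: "(\<exists>k. t < \<tau> e k) \<longleftrightarrow> t < T e" for t unfolding T_def using less_cSUP_iff[OF _ bdd] by auto
    have lim: "\<tau> e \<longlonglongrightarrow> T e" unfolding T_def
      by (rule LIMSEQ_incseq_SUP[OF bdd]) (simp add: incseq_SucI tmono)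
    define g where "g t = (if t < T e then glue (\<tau> e) (a e) t else e (T e))" for t
    have gch: "g t = chain (\<tau> e) (a e) k t" if "0 \<le> t" "t \<le> \<tau> e k" for t k
    proof (cases "t < T e")
      case True
      then obtain m where m: "t < \<tau> e m" using lt by blast
      have "chain (\<tau> e) (a e) m t = chain (\<tau> e) (a e) k t"
        using chain_stable[of k m t] chain_stable[of m k t] m that by (metis le_cases less_imp_le)
      then show ?thesis using True glue_eq[OF m] by (simp add: g_def)
    next
      \<comment> \<open>A visit falls on \<open>T e\<close> only if the next leg has zero length,
        that is, if the pursuer already stands on the evader.\<close>
      case False
      then have t: "t = \<tau> e k" "T e = \<tau> e k" using that leT[of k] by auto
      then have "\<tau> e (Suc k) = \<tau> e k" using leT[of "Suc k"] tmono[of e k] by simp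
      then have "V e k = e (\<tau> e k)" using \<tau>S[of e k] v VS[of e k] by simp
      then show ?thesis using False t chain_end[of k] by (simp add: g_def a_def)
    qed
    have gT: "g (T e) = e (T e)" by (simp add: g_def)
    have arcg: "speed_arc v (T e) g"
    proof (rule speed_arc_limit[OF \<tau>0 tmono _ lim])
      show "speed_arc v (\<tau> e k) g" for k
        using gch by (intro speed_arc_cong[OF speed_arc_chain]) auto
      have gV: "g (\<tau> e k) = V e k" for k using gch[of "\<tau> e k" k] nn chain_end[of k] by (simp add: a_def)
      have "(\<lambda>k. norm (e (\<tau> e k) - e (T e))) \<longlonglongrightarrow> 0"
      proof (rule tendsto_sandwich[of "\<lambda>_. 0" _ _ "\<lambda>k. w * (T e - \<tau> e k)"])
        have "(\<lambda>k. w * (T e - \<tau> e k)) \<longlonglongrightarrow> w * (T e - T e)" by (intro tendsto_intros lim)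
        then show "(\<lambda>k. w * (T e - \<tau> e k)) \<longlonglongrightarrow> 0" by simp
        show "\<forall>\<^sub>F k in sequentially. norm (e (\<tau> e k) - e (T e)) \<le> w * (T e - \<tau> e k)"
          using evader_pathD(2)[OF e nn leT] by (simp add: norm_minus_commute)
      qed auto
      then have "(\<lambda>k. e (\<tau> e k)) \<longlonglongrightarrow> e (T e)" using LIM_zero_cancel tendsto_norm_zero_iff by blast
      then have "(\<lambda>k. V e (Suc k)) \<longlonglongrightarrow> e (T e)" using VS by simp
      then show "(\<lambda>k. g (\<tau> e k)) \<longlonglongrightarrow> g (T e)" unfolding gV gT by (rule LIMSEQ_imp_Suc)
    qed (use v in simp)
    have eT: "e (T e) \<in> D" using evader_pathD(1)[OF e T0] .
    have FF: "F e = join (T e) g (st (e (T e)))"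
      by (intro ext) (simp add: F_def join_def g_def lt)
    have "speed_path v (F e)" unfolding FF
      by (rule speed_path_join[OF arcg st(1)[OF eT]]) (use gT st(2)[OF eT] T0 in auto)
    moreover have "F e 0 = P"
    proof (cases "T e = 0")
      case True
      then have "\<tau> e (Suc 0) = 0" using leT[of "Suc 0"] nn[of e "Suc 0"] by simp
      then have "V e 1 = V e 0" using \<tau>S[of e 0] \<tau>0[of e] v by simp
      then show ?thesis using True st(2)[OF eT] VS[of e 0] \<tau>0[of e] V0[of e] by (simp add: FF join_def)
    next
      case False
      then show ?thesis using gch[of 0 0] T0 \<tau>0[of e] V0 by (simp add: FF join_def a_def)
    qed
    moreover have "F e t \<in> D" if t: "t \<ge> 0" for t
    proof (cases "t < T e")
      case True
      then obtain k where k: "t < \<tau> e k" using lt by blast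
      have "glue (\<tau> e) (a e) t \<in> D"
      proof (rule glue_in[OF t k])
        fix j s assume "0 \<le> s" "s \<le> \<tau> e (Suc j) - \<tau> e j"
        then show "a e j s \<in> D" unfolding a_def \<tau>S using line_in_convex[OF D(1) VD VD _ _ v] by simp
      qed
      then show ?thesis using True by (simp add: FF join_def g_def)
    qed (simp add: FF join_def st eT)
    moreover have "F e (T e) = e (T e)" by (simp add: FF join_def st eT)
    moreover have "d 0 = norm (e 0 - P)" using VS[of e 0] V0[of e] \<tau>0[of e] by (simp add: d_def)
    ultimately show ?thesis using T0 Tub by metis
  qed
  ultimately show ?thesis by blast
qed


text \<open>During step \<open>n\<close> the pursuer is already heading for point
  \<open>Suc n\<close>, so this point belongs to the data. Samples therefore have to be used one
  step late.\<close>

lemma follow_cong: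
  assumes "t < real (Suc n) * \<delta>" "\<And>j. j \<le> Suc n \<Longrightarrow> A j = A' j"
  shows "follow D v \<delta> A t = follow D v \<delta> A' t"
proof -
  let ?\<tau> = "\<lambda>k. real k * \<delta>" and ?a = "\<lambda>A k. detour D v \<delta> (A k) (A (Suc k))"
  have "chain ?\<tau> (?a A) k = chain ?\<tau> (?a A') k" if "k \<le> Suc n" for k
    using that by (induction k) (use assms(2) in auto)
  from this[OF Least_le[of "\<lambda>k. t < ?\<tau> k", OF assms(1)]] show ?thesis
    unfolding follow_def glue_def by simp
qed

section \<open>The gauge of the Apollonius disc\<close>

text \<open>The gauge, centred at the evader's initial position, of the Apollonius disc of ratio \<open>a\<close>, where
  \<open>\<beta> = 1 / a\<^sup>2 - 1\<close> and \<open>k\<close> is the initial position of the pursuer relative to the evader.\<close>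

definition gauge_disc :: "real \<Rightarrow> 'a::euclidean_space \<Rightarrow> 'a \<Rightarrow> real" where
  "gauge_disc \<beta> k w = (w \<bullet> k + sqrt ((w \<bullet> k)\<^sup>2 + \<beta> * (norm k)\<^sup>2 * (norm w)\<^sup>2)) / (norm k)\<^sup>2"

lemma gauge_disc_nonneg: "\<beta> \<ge> 0 \<Longrightarrow> 0 \<le> gauge_disc \<beta> k w"
proof -
  assume "\<beta> \<ge> 0"
  then have "\<bar>w \<bullet> k\<bar> \<le> sqrt ((w \<bullet> k)\<^sup>2 + \<beta> * (norm k)\<^sup>2 * (norm w)\<^sup>2)"
    by (intro real_le_rsqrt) simp
  then show ?thesis by (auto simp: gauge_disc_def intro!: divide_nonneg_nonneg)
qed

lemma gauge_disc_zero [simp]: "gauge_disc \<beta> k 0 = 0"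
  by (simp add: gauge_disc_def)

text \<open>The square root is the norm of the linear image \<open>N w\<close> of \<open>w\<close>,
  and a linear form plus a seminorm is subadditive.\<close>

lemma gauge_disc_add:
  assumes "\<beta> \<ge> 0"
  shows "gauge_disc \<beta> k (w + w') \<le> gauge_disc \<beta> k w + gauge_disc \<beta> k w'"
proof -
  define N where "N w = (w \<bullet> k, (sqrt \<beta> * norm k) *\<^sub>R w)" for w
  have N: "sqrt ((w \<bullet> k)\<^sup>2 + \<beta> * (norm k)\<^sup>2 * (norm w)\<^sup>2) = norm (N w)" for w
    using assms by (simp add: N_def norm_Pair power_mult_distrib)
  have "N (w + w') = N w + N w'" by (simp add: N_def inner_add_left scaleR_add_right)
  then have "norm (N (w + w')) \<le> norm (N w) + norm (N w')" by (simp add: norm_triangle_ineq)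
  then show ?thesis unfolding gauge_disc_def N
    by (auto simp: inner_add_left add_divide_distrib[symmetric] intro!: divide_right_mono)
qed

lemma norm_diff_scaleR_sq: "(norm (w - c *\<^sub>R k))\<^sup>2 = (norm w)\<^sup>2 - 2 * c * (w \<bullet> k) + c\<^sup>2 * (norm k)\<^sup>2"
  unfolding power2_norm_eq_inner by (simp add: inner_diff inner_commute algebra_simps power2_eq_square)

text \<open>If the evader moves by \<open>w\<close> and the offset shrinks by
  \<open>c *\<^sub>R k\<close>, the pursuer moves by the difference. The bound on its length is a
  quadratic inequality in \<open>c\<close> with the roots
  \<open>- gauge_disc \<beta> k (- w)\<close> and \<open>gauge_disc \<beta> k w\<close>.\<close>

lemma gauge_disc_velocity:
  assumes "0 < a" "a < 1" "\<beta> = 1 / a\<^sup>2 - 1" "k \<noteq> 0"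
    and "- gauge_disc \<beta> k (- w) \<le> c" "c \<le> gauge_disc \<beta> k w"
  shows "norm (w - c *\<^sub>R k) \<le> norm w / a"
proof -
  have \<beta>: "\<beta> \<ge> 0" using assms(1-3) by (simp add: le_divide_eq power_le_one)
  define s where "s = sqrt ((w \<bullet> k)\<^sup>2 + \<beta> * (norm k)\<^sup>2 * (norm w)\<^sup>2)"
  have s: "s\<^sup>2 = (w \<bullet> k)\<^sup>2 + \<beta> * (norm k)\<^sup>2 * (norm w)\<^sup>2" using \<beta> by (simp add: s_def)
  have k: "(norm k)\<^sup>2 > 0" using assms(4) by simp
  have g: "gauge_disc \<beta> k w = (w \<bullet> k + s) / (norm k)\<^sup>2" "gauge_disc \<beta> k (- w) = (s - w \<bullet> k) / (norm k)\<^sup>2"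
    by (simp_all add: gauge_disc_def s_def)
  have "c * (norm k)\<^sup>2 - w \<bullet> k \<le> s" "- s \<le> c * (norm k)\<^sup>2 - w \<bullet> k"
    using assms(5,6) k unfolding g by (simp_all add: pos_le_divide_eq minus_divide_left pos_divide_le_eq)
  then have "\<bar>c * (norm k)\<^sup>2 - w \<bullet> k\<bar> \<le> s" by linarith
  then have "(c * (norm k)\<^sup>2 - w \<bullet> k)\<^sup>2 \<le> s\<^sup>2" by (metis abs_ge_zero power2_abs power_mono)
  then have "(norm k)\<^sup>2 * (c\<^sup>2 * (norm k)\<^sup>2 - 2 * c * (w \<bullet> k) - \<beta> * (norm w)\<^sup>2) \<le> 0"
    unfolding s by (simp add: power2_eq_square algebra_simps)
  then have "c\<^sup>2 * (norm k)\<^sup>2 - 2 * c * (w \<bullet> k) - \<beta> * (norm w)\<^sup>2 \<le> 0"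
    using k by (simp add: mult_le_0_iff)
  then have "(norm (w - c *\<^sub>R k))\<^sup>2 \<le> (norm w / a)\<^sup>2"
    unfolding norm_diff_scaleR_sq using assms(1,3) by (simp add: power_divide algebra_simps)
  then show ?thesis using assms(1) by (simp add: power2_le_iff_abs_le)
qed

text \<open>The quadratic of \<open>gauge_disc_velocity\<close> at \<open>c = 1\<close>: from its
  larger root on it is nonnegative, which says that \<open>w\<close> lies in the Apollonius disc of
  the evader at 0 and the pursuer at \<open>k\<close>.\<close>

lemma gauge_disc_le_1:
  assumes "0 < a" "a < 1" "\<beta> = 1 / a\<^sup>2 - 1" "k \<noteq> 0" "gauge_disc \<beta> k w \<le> 1"
  shows "norm w \<le> a * norm (w - k)"
proof -
  have \<beta>: "\<beta> \<ge> 0" using assms(1-3) by (simp add: le_divide_eq power_le_one)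
  define s where "s = sqrt ((w \<bullet> k)\<^sup>2 + \<beta> * (norm k)\<^sup>2 * (norm w)\<^sup>2)"
  have s: "s\<^sup>2 = (w \<bullet> k)\<^sup>2 + \<beta> * (norm k)\<^sup>2 * (norm w)\<^sup>2" "s \<ge> 0" using \<beta> by (simp_all add: s_def)
  have k: "(norm k)\<^sup>2 > 0" using assms(4) by simp
  have "gauge_disc \<beta> k w = (w \<bullet> k + s) / (norm k)\<^sup>2" by (simp add: gauge_disc_def s_def)
  then have "s \<le> (norm k)\<^sup>2 - w \<bullet> k" using assms(5) k by (simp add: pos_divide_le_eq)
  then have "s\<^sup>2 \<le> ((norm k)\<^sup>2 - w \<bullet> k)\<^sup>2" using s(2) by (rule power_mono)
  then have "0 \<le> (norm k)\<^sup>2 * ((norm k)\<^sup>2 - 2 * (w \<bullet> k) - \<beta> * (norm w)\<^sup>2)"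
    unfolding s by (simp add: power2_eq_square algebra_simps)
  then have "0 \<le> (norm k)\<^sup>2 - 2 * (w \<bullet> k) - \<beta> * (norm w)\<^sup>2"
    using k by (simp add: zero_le_mult_iff)
  then have "(norm w)\<^sup>2 / a\<^sup>2 \<le> (norm (w - k))\<^sup>2"
    using norm_diff_scaleR_sq[of w 1 k] assms(3) by (simp add: algebra_simps)
  then have "(norm w)\<^sup>2 \<le> (a * norm (w - k))\<^sup>2" using assms(1) by (simp add: field_simps power_mult_distrib)
  then show ?thesis using assms(1) by (simp add: power2_le_iff_abs_le)
qed

text \<open>Parallel pursuit: the pursuer stays at \<open>\<lambda> k\<close> relative to the evader. Retracting \<open>\<lambda>\<close> as fast as
  the gauge allows costs only the speed ratio \<open>1 / a\<close>.\<close>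

lemma parallel_step:
  fixes k w w' :: "'a::euclidean_space"
  assumes "0 < a" "a < 1" "\<beta> = 1 / a\<^sup>2 - 1" "k \<noteq> 0" "0 \<le> \<kappa>" "t \<le> t'"
    and l: "l = max 0 (1 - gauge_disc \<beta> k w - \<kappa> * t)" and l': "l' = max 0 (1 - gauge_disc \<beta> k w' - \<kappa> * t')"
  shows "norm ((w' + l' *\<^sub>R k) - (w + l *\<^sub>R k)) \<le> norm (w' - w) / a + \<kappa> * (t' - t) * norm k"
proof -
  have \<beta>: "\<beta> \<ge> 0" using assms(1-3) by (simp add: le_divide_eq power_le_one)
  define \<Delta> where "\<Delta> = w' - w"
  define c where "c = l - l'"
  \<comment> \<open>The part \<open>c - c'\<close> of the retraction exceeds what the gauge allows.
    It stems from the drift alone, so it is at most \<open>\<kappa> * (t' - t)\<close> and is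
    charged separately.\<close>
  define c' where "c' = min c (gauge_disc \<beta> k \<Delta>)"
  have g: "0 \<le> gauge_disc \<beta> k \<Delta>" "0 \<le> gauge_disc \<beta> k (- \<Delta>)" using gauge_disc_nonneg[OF \<beta>] by auto
  have kt: "\<kappa> * t \<le> \<kappa> * t'" using assms(5,6) by (simp add: mult_left_mono)
  have "gauge_disc \<beta> k w' \<le> gauge_disc \<beta> k w + gauge_disc \<beta> k \<Delta>"
    "gauge_disc \<beta> k w \<le> gauge_disc \<beta> k w' + gauge_disc \<beta> k (- \<Delta>)"
    using gauge_disc_add[OF \<beta>, of k w \<Delta>] gauge_disc_add[OF \<beta>, of k w' "- \<Delta>"] by (simp_all add: \<Delta>_def)
  then have c: "c \<le> gauge_disc \<beta> k \<Delta> + \<kappa> * (t' - t)" "- gauge_disc \<beta> k (- \<Delta>) \<le> c"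
    using g kt unfolding c_def l l' by (auto simp: max_def algebra_simps)
  have "norm (\<Delta> - c' *\<^sub>R k) \<le> norm \<Delta> / a"
    by (rule gauge_disc_velocity[OF assms(1-4)]) (use c g in \<open>auto simp: c'_def min_def\<close>)
  moreover have "norm ((c - c') *\<^sub>R k) \<le> \<kappa> * (t' - t) * norm k"
  proof -
    have "0 \<le> c - c'" "c - c' \<le> \<kappa> * (t' - t)"
      using c(1) kt by (auto simp: c'_def min_def algebra_simps)
    then show ?thesis by (simp add: mult_right_mono)
  qed
  moreover have eq: "(w' + l' *\<^sub>R k) - (w + l *\<^sub>R k) = (\<Delta> - c' *\<^sub>R k) - (c - c') *\<^sub>R k"
    by (simp add: \<Delta>_def c_def algebra_simps)
  ultimately have "norm (\<Delta> - c' *\<^sub>R k - (c - c') *\<^sub>R k) \<le> norm \<Delta> / a + \<kappa> * (t' - t) * norm k"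
    using norm_triangle_ineq4[of "\<Delta> - c' *\<^sub>R k" "(c - c') *\<^sub>R k"] by linarith
  then show ?thesis unfolding eq by (simp only: \<Delta>_def)
qed

text \<open>A nearest point in \<open>D\<close> may fail to exist, but a closed convex subset has
  one, and the projection to it is 1-Lipschitz, so it costs no speed. The prescribed point keeps a
  starting position fixed.\<close>

definition inner_approximable :: "'a::euclidean_space set \<Rightarrow> bool" where
  "inner_approximable D \<longleftrightarrow> (\<forall>h\<in>D. \<forall>\<epsilon>>0. \<exists>C. closed C \<and> convex C \<and> C \<subseteq> D \<and> h \<in> C \<and>
     (\<forall>q\<in>D. \<exists>c\<in>C. dist q c \<le> \<epsilon>))"

lemma inner_approximable_UNIV: "inner_approximable UNIV"
  unfolding inner_approximable_def
proof (intro ballI allI impI)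
  fix \<epsilon> :: real and h :: 'a assume "\<epsilon> > 0"
  then have "\<forall>q\<in>UNIV. \<exists>c\<in>UNIV. dist q c \<le> \<epsilon>" by (metis UNIV_I dist_self less_imp_le)
  then show "\<exists>C. closed C \<and> convex C \<and> C \<subseteq> UNIV \<and> h \<in> C \<and> (\<forall>q\<in>UNIV. \<exists>c\<in>C. dist q c \<le> \<epsilon>)"
    by (intro exI[of _ UNIV]) auto
qed

text \<open>By compactness of the closure, finitely many points of \<open>D\<close> come near all
  others; their convex hull is closed.\<close>

lemma inner_approximable_bounded:
  fixes D :: "'a::euclidean_space set"
  assumes "bounded D" "convex D"
  shows "inner_approximable D"
  unfolding inner_approximable_def
proof (intro ballI allI impI)
  fix h and \<epsilon> :: real
  assume h: "h \<in> D" and "\<epsilon> > 0"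
  have "closure D \<subseteq> (\<Union>x\<in>D. ball x \<epsilon>)"
  proof
    fix q assume "q \<in> closure D"
    then obtain x where "x \<in> D" "dist x q < \<epsilon>" using \<open>\<epsilon> > 0\<close> by (auto simp: closure_approachable)
    then show "q \<in> (\<Union>x\<in>D. ball x \<epsilon>)" by auto
  qed
  then obtain k where "finite k" "k \<subseteq> D" "closure D \<subseteq> (\<Union>x\<in>k. ball x \<epsilon>)"
    using compactE_image[of "closure D" D "\<lambda>x. ball x \<epsilon>"] assms(1) by (metis compact_closure open_ball)
  then have k: "finite k" "k \<subseteq> D" "D \<subseteq> (\<Union>x\<in>k. ball x \<epsilon>)" using closure_subset[of D] by auto
  show "\<exists>C. closed C \<and> convex C \<and> C \<subseteq> D \<and> h \<in> C \<and> (\<forall>q\<in>D. \<exists>c\<in>C. dist q c \<le> \<epsilon>)"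
  proof (intro exI[of _ "convex hull (insert h k)"] conjI ballI)
    show "closed (convex hull insert h k)"
      using k(1) by (intro compact_imp_closed compact_convex_hull finite_imp_compact) simp
    show "convex hull insert h k \<subseteq> D" using k(2) h assms(2) by (simp add: subset_hull)
    show "h \<in> convex hull insert h k" by (simp add: hull_inc)
  next
    fix q assume "q \<in> D"
    then obtain x where "x \<in> k" "dist x q < \<epsilon>" using k(3) by auto
    then show "\<exists>c\<in>convex hull insert h k. dist q c \<le> \<epsilon>"
      by (intro bexI[of _ x]) (auto simp: hull_inc dist_commute)
  qed auto
qed


section \<open>Pursuit from a strictly won position\<close>

lemma grid_cell:
  fixes t \<delta> :: real
  assumes "\<delta> > 0" "t \<ge> 0"
  obtains n where "real n * \<delta> \<le> t" "t < real (Suc n) * \<delta>"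
proof (rule that[of "nat \<lfloor>t / \<delta>\<rfloor>"])
  have n: "real (nat \<lfloor>t / \<delta>\<rfloor>) = of_int \<lfloor>t / \<delta>\<rfloor>" using assms by simp
  show "real (nat \<lfloor>t / \<delta>\<rfloor>) * \<delta> \<le> t"
    unfolding n using assms(1) by (metis of_int_floor_le pos_le_divide_eq)
  have "t / \<delta> < real (Suc (nat \<lfloor>t / \<delta>\<rfloor>))" unfolding of_nat_Suc n by linarith
  then show "t < real (Suc (nat \<lfloor>t / \<delta>\<rfloor>)) * \<delta>" using assms(1) by (metis pos_divide_less_eq)
qed

text \<open>Pursuers are indexed rather than identified with positions, because this is also applied
  in the middle of a game, when several of them may be at the same point.\<close>

theorem strict_pursuit:
  fixes D :: "'a::euclidean_space set" and Q :: "'i \<Rightarrow> 'a"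
  assumes D: "convex D" "c0 \<in> D" "c1 \<in> D" "c0 \<noteq> c1" "inner_approximable D"
    and T: "compact T" "T \<noteq> {}" and I: "finite I" "\<And>i. i \<in> I \<Longrightarrow> Q i \<in> D" and z: "z \<in> D"
    and w: "0 < w" "w < v"
    and guard: "\<And>p. p \<in> T \<Longrightarrow> \<exists>i\<in>I. (w / v) * norm (Q i - p) < norm (z - p)"
  shows "\<exists>S. (\<forall>i\<in>I. causal (\<lambda>e. S e i)) \<and> (\<forall>e. evader_path D w e \<and> e 0 = z \<longrightarrow>
    (\<forall>i\<in>I. speed_path v (S e i) \<and> S e i 0 = Q i \<and> (\<forall>t\<ge>0. S e i t \<in> D)) \<and>
    (\<exists>t\<ge>0. (\<exists>i\<in>I. S e i t = e t) \<and> (\<forall>s\<in>{0..t}. e s \<notin> T)))"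
proof (cases "\<exists>j\<in>I. Q j = z")
  \<comment> \<open>A pursuer on top of the evader captures at once. It has to be set aside, as the
    gauge divides by the initial distance.\<close>
  case True
  have v: "v > 0" using w by simp
  have "z \<notin> T" using guard[of z] w v by (metis diff_self less_le_not_le norm_ge_zero norm_zero zero_le_mult_iff divide_nonneg_pos less_imp_le)
  have "\<forall>i\<in>I. \<exists>y. speed_path v y \<and> y 0 = Q i \<and> (\<forall>t\<ge>0. y t \<in> D)"
    using stay_exists[OF D(1-4) v] I(2) by blast
  then obtain y where y: "\<And>i. i \<in> I \<Longrightarrow> speed_path v (y i) \<and> y i 0 = Q i \<and> (\<forall>t\<ge>0. y i t \<in> D)" by metis
  show ?thesis
  proof (intro exI[of _ "\<lambda>e. y"] conjI allI impI ballI)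
    fix e assume "evader_path D w e \<and> e 0 = z"
    then show "\<exists>t\<ge>0. (\<exists>i\<in>I. y i t = e t) \<and> (\<forall>s\<in>{0..t}. e s \<notin> T)"
      using True y \<open>z \<notin> T\<close> by (intro exI[of _ 0]) auto
  qed (use y in \<open>auto simp: causal_def\<close>)
next
  case False
  have v: "v > 0" using w by simp
  have I0: "I \<noteq> {}" using guard T(2) by blast
  obtain a \<mu> where a: "w / v < a" "a < 1" and \<mu>: "\<mu> > 0"
    and slack: "\<And>p. p \<in> T \<Longrightarrow> \<exists>i\<in>I. \<mu> \<le> norm (z - p) - a * norm (Q i - p)"
  proof -
    \<comment> \<open>The distance to the nearest pursuer is continuous in \<open>p\<close>, so
      compactness of \<open>T\<close> makes the strict guard uniform.\<close>
    define \<rho> where "\<rho> p = norm (z - p) - (w / v) * infdist p (Q ` I)" for p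
    have att: "\<exists>i\<in>I. infdist p (Q ` I) = norm (Q i - p)" for p
    proof -
      have "closed (Q ` I)" "Q ` I \<noteq> {}" using I(1) I0 by (simp_all add: finite_imp_closed)
      then obtain x where "x \<in> Q ` I" "infdist p (Q ` I) = dist p x" using infdist_attains_inf by metis
      then show ?thesis by (metis dist_norm dist_commute imageE)
    qed
    have \<rho>pos: "\<rho> p > 0" if p: "p \<in> T" for p
    proof -
      obtain i where i: "i \<in> I" "(w / v) * norm (Q i - p) < norm (z - p)" using guard[OF p] by blast
      have "infdist p (Q ` I) \<le> norm (Q i - p)"
        using infdist_le[of "Q i" "Q ` I" p] i(1) by (simp add: dist_norm norm_minus_commute)
      then have "(w / v) * infdist p (Q ` I) \<le> (w / v) * norm (Q i - p)"
        using w by (intro mult_left_mono) auto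
      then show ?thesis using i(2) by (simp add: \<rho>_def)
    qed
    have "continuous_on T \<rho>" unfolding \<rho>_def by (intro continuous_intros)
    then obtain p0 where p0: "p0 \<in> T" "\<And>p. p \<in> T \<Longrightarrow> \<rho> p0 \<le> \<rho> p"
      using continuous_attains_inf[OF T] by blast
    have "continuous_on T (\<lambda>p. infdist p (Q ` I))" by (intro continuous_intros)
    then obtain p1 where p1: "\<And>p. p \<in> T \<Longrightarrow> infdist p (Q ` I) \<le> infdist p1 (Q ` I)"
      using continuous_attains_sup[OF T] by blast
    define M where "M = infdist p1 (Q ` I) + 1"
    have M: "M > 0" "\<And>p. p \<in> T \<Longrightarrow> infdist p (Q ` I) \<le> M" using p1 by (fastforce simp: M_def add_nonneg_pos infdist_nonneg)+
    \<comment> \<open>Raising the ratio by \<open>b\<close> costs at most \<open>b * M\<close>,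
      hence at most half of the minimum of \<open>\<rho>\<close>; the other half is the slack. The
      second term keeps the ratio below 1.\<close>
    define b where "b = min (\<rho> p0 / (2 * M)) ((1 - w / v) / 2)"
    have wv: "w / v < 1" using w by simp
    have b: "b > 0" "b \<le> \<rho> p0 / (2 * M)" "w / v + b < 1"
    proof -
      show "b > 0" using \<rho>pos[OF p0(1)] M(1) wv by (simp add: b_def)
      show "b \<le> \<rho> p0 / (2 * M)" by (simp add: b_def)
      have "b \<le> (1 - w / v) / 2" by (simp only: b_def min.cobounded2)
      then show "w / v + b < 1" using wv by argo
    qed
    show ?thesis
    proof (rule that[of "w / v + b" "\<rho> p0 / 2"])
      fix p assume p: "p \<in> T"
      obtain i where i: "i \<in> I" "infdist p (Q ` I) = norm (Q i - p)" using att by blast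
      have "b * norm (Q i - p) \<le> \<rho> p0 / (2 * M) * M"
        using b M(2)[OF p] i(2) M(1) \<rho>pos[OF p0(1)] by (intro mult_mono) auto
      also have "\<dots> = \<rho> p0 / 2" using M(1) by simp
      finally have "b * norm (Q i - p) \<le> \<rho> p0 / 2" .
      moreover have "norm (z - p) - (w / v + b) * norm (Q i - p) = \<rho> p - b * norm (Q i - p)"
        using i(2) by (simp add: \<rho>_def algebra_simps)
      ultimately have "\<rho> p0 / 2 \<le> norm (z - p) - (w / v + b) * norm (Q i - p)"
        using p0(2)[OF p] by linarith
      then show "\<exists>i\<in>I. \<rho> p0 / 2 \<le> norm (z - p) - (w / v + b) * norm (Q i - p)" using i(1) by blast
    qed (use b \<rho>pos[OF p0(1)] in auto)
  qed
  have a0: "0 < a" using a w v by (meson divide_pos_pos less_trans)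
  define \<beta> where "\<beta> = 1 / a\<^sup>2 - 1"
  have \<beta>: "\<beta> \<ge> 0" using a a0 by (simp add: \<beta>_def le_divide_eq power_le_one)
  define k where "k i = Q i - z" for i
  have k: "k i \<noteq> 0" if "i \<in> I" for i using that False by (auto simp: k_def)
  have wa: "w / a < v" using a a0 v by (simp add: field_simps)
  \<comment> \<open>\<open>v - w / a\<close> is the speed that parallel pursuit leaves over; the
    drift takes a share that every pursuer can afford.\<close>
  define \<kappa> where "\<kappa> = (v - w / a) / (1 + (\<Sum>i\<in>I. norm (k i)))"
  have S0: "0 \<le> (\<Sum>i\<in>I. norm (k i))" by (simp add: sum_nonneg)
  have \<kappa>: "\<kappa> > 0" using wa S0 by (auto simp: \<kappa>_def intro!: divide_pos_pos)
  have \<kappa>k: "w / a + \<kappa> * norm (k i) \<le> v" if "i \<in> I" for i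
  proof -
    have "norm (k i) \<le> 1 + (\<Sum>i\<in>I. norm (k i))"
      using member_le_sum[of i I "\<lambda>i. norm (k i)"] that I(1) by simp
    then have "\<kappa> * norm (k i) \<le> \<kappa> * (1 + (\<Sum>i\<in>I. norm (k i)))" using \<kappa> by (simp add: mult_left_mono)
    also have "\<dots> = v - w / a" using S0 by (simp add: \<kappa>_def)
    finally show ?thesis by simp
  qed
  \<comment> \<open>\<open>G * \<delta>\<close> bounds how far the evader gets during one time step
    and a final chase, in which a gap of at most \<open>2 * v * \<delta>\<close> is closed within
    time \<open>2 * v * \<delta> / (v - w)\<close>.\<close>
  define G where "G = w + 2 * w * v / (v - w)"
  have G: "G > 0" using w v by (auto simp: G_def intro!: add_pos_nonneg divide_nonneg_pos)
  define \<delta> where "\<delta> = min (norm (c0 - c1) / (2 * v)) (\<mu> / (4 * G))"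
  have \<delta>: "\<delta> > 0" using D(4) v \<mu> G by (simp add: \<delta>_def)
  have \<delta>1: "2 * v * \<delta> \<le> norm (c0 - c1)"
    using v by (simp add: \<delta>_def min_def field_simps)
  have \<delta>2: "G * \<delta> \<le> \<mu> / 4" using G by (simp add: \<delta>_def min_def field_simps)
  interpret room D v \<delta> by (rule room_exists[OF D(1-3) v \<delta> \<delta>1])
  have "\<forall>i\<in>I. \<exists>C. closed C \<and> convex C \<and> C \<subseteq> D \<and> Q i \<in> C \<and> (\<forall>q\<in>D. \<exists>c\<in>C. dist q c \<le> v * \<delta>)"
    using D(5) I(2) v \<delta> unfolding inner_approximable_def by simp
  then obtain C where C: "\<And>i. i \<in> I \<Longrightarrow> closed (C i)" "\<And>i. i \<in> I \<Longrightarrow> convex (C i)"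
    "\<And>i. i \<in> I \<Longrightarrow> C i \<subseteq> D" "\<And>i. i \<in> I \<Longrightarrow> Q i \<in> C i"
    "\<And>i q. i \<in> I \<Longrightarrow> q \<in> D \<Longrightarrow> \<exists>c\<in>C i. dist q c \<le> v * \<delta>" by metis
  \<comment> \<open>Outside \<open>D\<close> a constant dummy keeps \<open>ch P\<close> causal for
    every \<open>P\<close>, so causality can be used without knowing where the pursuer is.\<close>
  have "\<forall>P. \<exists>F. causal F \<and> (P \<in> D \<longrightarrow> (\<forall>e. evader_path D w e \<longrightarrow>
    speed_path v (F e) \<and> F e 0 = P \<and> (\<forall>t\<ge>0. F e t \<in> D) \<and>
    (\<exists>t\<ge>0. t \<le> norm (e 0 - P) / (v - w) \<and> F e t = e t)))"
  proof
    fix P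
    show "\<exists>F. causal F \<and> (P \<in> D \<longrightarrow> (\<forall>e. evader_path D w e \<longrightarrow>
      speed_path v (F e) \<and> F e 0 = P \<and> (\<forall>t\<ge>0. F e t \<in> D) \<and>
      (\<exists>t\<ge>0. t \<le> norm (e 0 - P) / (v - w) \<and> F e t = e t)))"
    proof (cases "P \<in> D")
      case True
      then show ?thesis using chase_exists[OF D(1-4) True less_imp_le[OF w(1)] w(2)] by blast
    next
      case False
      then show ?thesis by (intro exI[of _ "\<lambda>e t. P"]) (simp add: causal_def)
    qed
  qed
  then obtain ch where chc: "\<And>P. causal (ch P)" and ch: "\<And>P e. P \<in> D \<Longrightarrow> evader_path D w e \<Longrightarrow>
    speed_path v (ch P e) \<and> ch P e 0 = P \<and> (\<forall>t\<ge>0. ch P e t \<in> D) \<and>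
    (\<exists>t\<ge>0. t \<le> norm (e 0 - P) / (v - w) \<and> ch P e t = e t)" by metis
  \<comment> \<open>The fraction of the initial offset that is left. The drift makes it nonpositive
    from time \<open>1 / \<kappa>\<close> on, whatever the evader does.\<close>
  define l where "l e i t = 1 - gauge_disc \<beta> (k i) (e t - z) - \<kappa> * t" for e i t
  define R where "R e i t = closest_point (C i) (e t + max 0 (l e i t) *\<^sub>R k i)" for e i t
  \<comment> \<open>A sample is used one step late, since the path is already heading for the next
    point. As \<open>0 - 1 = 0\<close>, the points number 0 and 1 both are the start if
    \<open>e 0 = z\<close>.\<close>
  define A where "A e i n = R e i (real (n - 1) * \<delta>)" for e i n
  define stop where "stop e K \<longleftrightarrow> (\<exists>i\<in>I. l e i (real K * \<delta>) \<le> 0)" for e K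
  define N where "N e = (LEAST K. stop e K)" for e
  define y where "y e i = follow D v \<delta> (A e i)" for e i
  define \<theta> where "\<theta> e = real (N e) * \<delta>" for e
  define S where "S e i = join (\<theta> e) (y e i) (ch (y e i (\<theta> e)) (\<lambda>t. e (\<theta> e + t)))" for e i
  have stopN: "stop e (N e)" for e
  proof -
    obtain i where i: "i \<in> I" using I0 by blast
    obtain K where K: "1 < real K * (\<kappa> * \<delta>)" using reals_Archimedean3[of "\<kappa> * \<delta>"] \<kappa> \<delta> by auto
    have "l e i (real K * \<delta>) \<le> 0"
      using gauge_disc_nonneg[OF \<beta>, of "k i" "e (real K * \<delta>) - z"] K by (simp add: l_def algebra_simps)
    then have "stop e K" using i by (auto simp: stop_def)
    then show ?thesis unfolding N_def by (rule LeastI)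
  qed
  have nstop: "\<not> stop e K" if "K < N e" for e K using that unfolding N_def by (rule not_less_Least)
  have ycausal: "causal (\<lambda>e. y e i)" for i unfolding causal_def
  proof (intro allI impI)
    fix e e' :: "real \<Rightarrow> 'a" and t :: real
    assume t: "t \<ge> 0" and eq: "\<forall>s\<in>{0..t}. e s = e' s"
    obtain n where n: "real n * \<delta> \<le> t" "t < real (Suc n) * \<delta>" using grid_cell[OF \<delta> t] .
    have "A e i j = A e' i j" if "j \<le> Suc n" for j
    proof -
      have "real (j - 1) \<le> real n" using that by simp
      then have "real (j - 1) * \<delta> \<le> t" using n(1) \<delta> by (meson mult_right_mono less_imp_le order_trans)
      then have "e (real (j - 1) * \<delta>) = e' (real (j - 1) * \<delta>)" using eq \<delta> by simp
      then show ?thesis by (simp add: A_def R_def l_def)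
    qed
    then show "y e i t = y e' i t" unfolding y_def by (rule follow_cong[OF n(2)])
  qed
  have "causal (\<lambda>e. S e i)" for i unfolding causal_def
  proof (intro allI impI)
    fix e e' :: "real \<Rightarrow> 'a" and t :: real
    assume t: "t \<ge> 0" and eq: "\<forall>s\<in>{0..t}. e s = e' s"
    have st: "stop e K \<longleftrightarrow> stop e' K" if "real K * \<delta> \<le> t" for K
    proof -
      have "e (real K * \<delta>) = e' (real K * \<delta>)" using eq \<delta> that by simp
      then show ?thesis by (simp add: stop_def l_def)
    qed
    have le: "real K * \<delta> \<le> t" if "real K' * \<delta> \<le> t" "K \<le> K'" for K K'
      using that \<delta> by (meson mult_right_mono less_imp_le of_nat_mono order_trans)
    show "S e i t = S e' i t"
    proof (cases "\<theta> e \<le> t")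
      case True
      then have "stop e' (N e)" using stopN[of e] st[of "N e"] by (simp add: \<theta>_def)
      moreover have "\<not> stop e' K" if "K < N e" for K
        using nstop[OF that] st[OF le[of "N e" K]] True that by (simp add: \<theta>_def)
      ultimately have N: "N e' = N e" unfolding N_def[of e'] by (intro Least_equality) (auto simp: not_less[symmetric])
      then have \<theta>: "\<theta> e' = \<theta> e" by (simp add: \<theta>_def)
      have \<theta>0: "0 \<le> \<theta> e" using \<delta> by (simp add: \<theta>_def)
      have "y e i (\<theta> e) = y e' i (\<theta> e)"
        using ycausal[of i, unfolded causal_def] \<theta>0 eq True by (meson atLeastAtMost_iff order_trans)
      moreover have "ch P (\<lambda>t. e (\<theta> e + t)) (t - \<theta> e) = ch P (\<lambda>t. e' (\<theta> e + t)) (t - \<theta> e)" for P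
        by (rule chc[of P, unfolded causal_def, rule_format]) (use True eq \<theta>0 in auto)
      ultimately show ?thesis using True by (simp add: S_def join_def \<theta>)
    next
      case False
      have "\<not> \<theta> e' \<le> t"
      proof
        assume le': "\<theta> e' \<le> t"
        then have "stop e (N e')" using stopN[of e'] st[of "N e'"] by (simp add: \<theta>_def)
        then have "N e \<le> N e'" unfolding N_def[of e] by (rule Least_le)
        then show False using le[of "N e'" "N e"] le' False by (simp add: \<theta>_def)
      qed
      then show ?thesis
        using False ycausal[of i, unfolded causal_def] t eq by (simp add: S_def join_def)
    qed
  qed
  moreover have "(\<forall>i\<in>I. speed_path v (S e i) \<and> S e i 0 = Q i \<and> (\<forall>t\<ge>0. S e i t \<in> D)) \<and>
    (\<exists>t\<ge>0. (\<exists>i\<in>I. S e i t = e t) \<and> (\<forall>s\<in>{0..t}. e s \<notin> T))"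
    if e: "evader_path D w e" and ez: "e 0 = z" for e
  proof -
    have RC: "R e i t \<in> C i" if "i \<in> I" for i t
      unfolding R_def using C(1,4)[OF that] by (intro closest_point_in_set) auto
    have AD: "A e i n \<in> D" if "i \<in> I" for i n using RC[OF that] C(3)[OF that] by (auto simp: A_def)
    have Rstep: "norm (R e i t' - R e i t) \<le> v * (t' - t)" if i: "i \<in> I" and t: "0 \<le> t" "t \<le> t'" for i t t'
    proof -
      have "norm (R e i t' - R e i t) \<le>
        norm ((e t' + max 0 (l e i t') *\<^sub>R k i) - (e t + max 0 (l e i t) *\<^sub>R k i))"
        using closest_point_lipschitz[OF C(2)[OF i] C(1)[OF i]] C(4)[OF i] unfolding R_def dist_norm by blast
      also have "\<dots> = norm (((e t' - z) + max 0 (l e i t') *\<^sub>R k i) - ((e t - z) + max 0 (l e i t) *\<^sub>R k i))"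
        by simp
      also have "\<dots> \<le> norm ((e t' - z) - (e t - z)) / a + \<kappa> * (t' - t) * norm (k i)"
        by (rule parallel_step[OF a0 a(2) \<beta>_def k[OF i] less_imp_le[OF \<kappa>] t(2)]) (simp_all add: l_def)
      also have "\<dots> \<le> w * (t' - t) / a + \<kappa> * (t' - t) * norm (k i)"
        using evader_pathD(2)[OF e t] a0 by (simp add: divide_right_mono)
      also have "\<dots> = (w / a + \<kappa> * norm (k i)) * (t' - t)" by (simp add: algebra_simps)
      also have "\<dots> \<le> v * (t' - t)" using \<kappa>k[OF i] t by (intro mult_right_mono) auto
      finally show ?thesis .
    qed
    have Astep: "norm (A e i (Suc n) - A e i n) \<le> v * \<delta>" if "i \<in> I" for i n
    proof (cases n)
      case 0
      then show ?thesis using v \<delta> by (simp add: A_def)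
    next
      case (Suc m)
      then show ?thesis using Rstep[OF that, of "real m * \<delta>" "real (Suc m) * \<delta>"] \<delta>
        by (simp add: A_def algebra_simps)
    qed
    have A0: "A e i 0 = Q i" if "i \<in> I" for i
      using ez C(4)[OF that] by (simp add: A_def R_def l_def k_def closest_point_self)
    have yp: "speed_path v (y e i)" "\<And>t. t \<ge> 0 \<Longrightarrow> y e i t \<in> D" "\<And>n. y e i (real n * \<delta>) = A e i n"
      if i: "i \<in> I" for i
      unfolding y_def
      using speed_path_follow[of "A e i"] follow_in[of "A e i"] follow_at[of "A e i"] AD[OF i] Astep[OF i] by auto
    have \<theta>0: "0 \<le> \<theta> e" using \<delta> by (simp add: \<theta>_def)
    have es: "evader_path D w (\<lambda>t. e (\<theta> e + t))" using evader_path_shift[OF e \<theta>0] .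
    have chp: "speed_path v (ch (y e i (\<theta> e)) (\<lambda>t. e (\<theta> e + t)))" 
      "ch (y e i (\<theta> e)) (\<lambda>t. e (\<theta> e + t)) 0 = y e i (\<theta> e)"
      "\<And>t. t \<ge> 0 \<Longrightarrow> ch (y e i (\<theta> e)) (\<lambda>t. e (\<theta> e + t)) t \<in> D"
      if i: "i \<in> I" for i using ch[OF yp(2)[OF i \<theta>0] es] by auto
    have "speed_path v (S e i) \<and> S e i 0 = Q i \<and> (\<forall>t\<ge>0. S e i t \<in> D)" if i: "i \<in> I" for i
    proof (intro conjI allI impI)
      show "speed_path v (S e i)" unfolding S_def
        by (rule speed_path_join) (use yp(1)[OF i] chp[OF i] \<theta>0 in \<open>auto simp: speed_path_def\<close>)
      have "y e i 0 = Q i" using yp(3)[OF i, of 0] A0[OF i] by simp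
      then show "S e i 0 = Q i" using chp(2)[OF i] \<theta>0 by (cases "\<theta> e = 0") (simp_all add: S_def join_def)
      show "S e i t \<in> D" if "t \<ge> 0" for t
        using yp(2)[OF i that] chp(3)[OF i, of "t - \<theta> e"] by (simp add: S_def join_def)
    qed
    moreover have "\<exists>t\<ge>0. (\<exists>i\<in>I. S e i t = e t) \<and> (\<forall>s\<in>{0..t}. e s \<notin> T)"
    proof -
      obtain i where i: "i \<in> I" and li: "l e i (\<theta> e) \<le> 0" using stopN[of e] by (auto simp: stop_def \<theta>_def)
      have N0: "N e \<noteq> 0" 
      proof
        assume "N e = 0"
        then have "l e i 0 \<le> 0" using li by (simp add: \<theta>_def)
        then show False by (simp add: l_def ez)
      qed
      \<comment> \<open>Once the offset is used up, the point to follow is the projection of the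
        evader itself, off by at most \<open>v * \<delta>\<close>; the pursuer lags behind by one
        more step.\<close>
      have gap: "norm (e (\<theta> e) - y e i (\<theta> e)) \<le> 2 * v * \<delta>"
      proof -
        have "R e i (\<theta> e) = closest_point (C i) (e (\<theta> e))" using li by (simp add: R_def)
        moreover obtain c where "c \<in> C i" "dist (e (\<theta> e)) c \<le> v * \<delta>"
          using C(5)[OF i evader_pathD(1)[OF e \<theta>0]] by blast
        ultimately have "norm (e (\<theta> e) - R e i (\<theta> e)) \<le> v * \<delta>"
          using closest_point_le[OF C(1)[OF i], of c "e (\<theta> e)"] by (simp add: dist_norm)
        moreover have "norm (R e i (\<theta> e) - y e i (\<theta> e)) \<le> v * \<delta>"
          using Astep[OF i, of "N e"] yp(3)[OF i, of "N e"] by (simp add: A_def \<theta>_def)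
        ultimately show ?thesis
          using norm_triangle_ineq[of "e (\<theta> e) - R e i (\<theta> e)" "R e i (\<theta> e) - y e i (\<theta> e)"] by simp
      qed
      obtain r where r: "r \<ge> 0" "r \<le> norm (e (\<theta> e) - y e i (\<theta> e)) / (v - w)"
        "ch (y e i (\<theta> e)) (\<lambda>t. e (\<theta> e + t)) r = e (\<theta> e + r)"
        using ch[OF yp(2)[OF i \<theta>0] es] by auto
      have r2: "r \<le> 2 * v * \<delta> / (v - w)" using r(2) divide_right_mono[OF gap, of "v - w"] w by simp
      have drift: "w * (\<delta> + r) \<le> \<mu> / 4"
      proof -
        have "w * (\<delta> + r) \<le> w * (\<delta> + 2 * v * \<delta> / (v - w))" using r2 w by simp
        also have "\<dots> = G * \<delta>" by (simp add: G_def algebra_simps)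
        finally show ?thesis using \<delta>2 by simp
      qed
      have "e s \<notin> T" if s: "s \<in> {0..\<theta> e + r}" for s
      proof
        assume sT: "e s \<in> T"
        \<comment> \<open>\<open>K\<close> is the last grid index before the stop whose time is at
          most \<open>s\<close>. There no offset is used up yet, so the evader is still in all
          discs.\<close>
        obtain K where K: "K < N e" "real K * \<delta> \<le> s" "s - real K * \<delta> \<le> \<delta> + r"
        proof (cases "s < \<theta> e")
          case True
          have "0 \<le> s" using s by simp
          from grid_cell[OF \<delta> this] obtain n where n: "real n * \<delta> \<le> s" "s < real (Suc n) * \<delta>" .
          have "real n * \<delta> < real (N e) * \<delta>" using n True by (simp add: \<theta>_def)
          then have "n < N e" using \<delta> by simp
          then show ?thesis using that[of n] n r(1) by (simp add: algebra_simps)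
        next
          case False
          then show ?thesis using that[of "N e - 1"] N0 s \<delta> by (simp add: \<theta>_def of_nat_diff algebra_simps)
        qed
        let ?q = "e (real K * \<delta>)"
        obtain j where j: "j \<in> I" "\<mu> \<le> norm (z - e s) - a * norm (Q j - e s)" using slack[OF sT] by blast
        have "l e j (real K * \<delta>) > 0" using nstop[OF K(1)] j(1) by (auto simp: stop_def not_le)
        moreover have "0 \<le> \<kappa> * (real K * \<delta>)" using \<kappa> \<delta> by simp
        ultimately have "gauge_disc \<beta> (k j) (?q - z) \<le> 1" unfolding l_def by linarith
        from gauge_disc_le_1[OF a0 a(2) \<beta>_def k[OF j(1)] this]
        have near: "norm (?q - z) \<le> a * norm (?q - Q j)" by (simp add: k_def)
        have mv: "norm (e s - ?q) \<le> \<mu> / 4"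
        proof -
          have "norm (e s - ?q) \<le> w * (s - real K * \<delta>)" using evader_pathD(2)[OF e _ K(2)] \<delta> by simp
          also have "\<dots> \<le> w * (\<delta> + r)" using K(3) w by simp
          finally show ?thesis using drift by simp
        qed
        have "norm (z - e s) \<le> norm (?q - z) + norm (e s - ?q)"
          using norm_triangle_ineq[of "?q - z" "e s - ?q"] by (simp add: norm_minus_commute)
        moreover have "norm (?q - Q j) \<le> norm (Q j - e s) + norm (e s - ?q)"
          using norm_triangle_ineq[of "Q j - e s" "e s - ?q"] by (simp add: norm_minus_commute)
        then have "a * norm (?q - Q j) \<le> a * norm (Q j - e s) + a * norm (e s - ?q)"
          using a0 by (metis distrib_left mult_left_mono less_imp_le)
        moreover have "a * norm (e s - ?q) \<le> norm (e s - ?q)" using a0 a(2) by (simp add: mult_left_le_one_le)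
        \<comment> \<open>The evader's move since grid time \<open>K\<close> enters twice, each time
          with at most \<open>\<mu> / 4\<close>: too little to use up the slack.\<close>
        ultimately have "\<mu> \<le> \<mu> / 2" using near mv j(2) by linarith
        then show False using \<mu> by simp
      qed
      moreover have "S e i (\<theta> e + r) = e (\<theta> e + r)" using r by (simp add: S_def join_def)
      ultimately show ?thesis using i \<theta>0 r(1) by (intro exI[of _ "\<theta> e + r"]) auto
    qed
    ultimately show ?thesis by blast
  qed
  ultimately show ?thesis by (intro exI[of _ S]) blast
qed


section \<open>The reach-avoid game\<close>

lemma trajectory_evader_path:
  assumes "trajectory D w z e" "0 \<le> w"
  shows "evader_path D w e"
  unfolding evader_path_def
proof (intro conjI allI impI)
  show "e t \<in> D" if "0 \<le> t" for t using assms(1) that by (simp add: trajectory_def)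
  show "norm (e t - e s) \<le> w * (t - s)" if "0 \<le> s" "s \<le> t" for s t
    using trajectory_lipschitz[OF assms that] .
qed

lemma evader_path_continuous:
  assumes "evader_path D w e"
  shows "continuous_on {0..t} e"
proof -
  have "norm (e s - e r) \<le> w * \<bar>s - r\<bar>" if "r \<in> {0..t}" "s \<in> {0..t}" for r s
    using evader_pathD(2)[OF assms, of r s] evader_pathD(2)[OF assms, of s r] that
    by (cases "r \<le> s") (auto simp: norm_minus_commute)
  moreover have "norm (e 1 - e 0) \<le> w" using evader_pathD(2)[OF assms, of 0 1] by simp
  then have "0 \<le> w" by (rule order_trans[OF norm_ge_zero])
  ultimately have "w-lipschitz_on {0..t} e" unfolding lipschitz_on_def dist_norm real_norm_def by blast
  then show ?thesis by (rule lipschitz_on_continuous_on)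
qed

lemma line_dist_end:
  assumes "0 \<le> t" "t \<le> norm (B - A) / v" "v > 0"
  shows "norm (B - line v A B t) = norm (B - A) - v * t"
proof (cases "A = B")
  case False
  have "B - line v A B t = (norm (B - A) - v * t) *\<^sub>R sgn (B - A)"
  proof -
    have "norm (B - A) *\<^sub>R sgn (B - A) = B - A" using False by (simp add: sgn_div_norm)
    then show ?thesis by (simp add: line_def scaleR_left_diff_distrib)
  qed
  then have "norm (B - line v A B t) = \<bar>norm (B - A) - v * t\<bar>" using False by (simp add: norm_sgn)
  then show ?thesis using assms by (simp add: pos_le_divide_eq mult.commute)
qed (use assms in \<open>auto simp: line_def\<close>)

text \<open>Covers both games: \<open>D\<close> is the domain or the plane, \<open>G\<close> the
  target region or the target line. \<open>crossing\<close> reduces reaching \<open>G\<close> to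
  reaching the line \<open>T\<close>, on which all estimates take place.\<close>

locale reach_game =
  fixes D G T :: "point set" and l vP vE \<alpha> :: real
  assumes convex: "convex D" and inner: "inner_approximable D"
    and l: "l > 0" and T: "T = target_line l" and TD: "T \<subseteq> D" and TG: "T \<subseteq> G" and closed: "closed G"
    and G_above: "\<And>p. p \<in> G \<Longrightarrow> snd p \<ge> 0"
    and crossing: "\<And>(e :: real \<Rightarrow> point) t. continuous_on {0..t} e \<Longrightarrow> (\<And>s. s \<in> {0..t} \<Longrightarrow> e s \<in> D) \<Longrightarrow> 0 \<le> t \<Longrightarrow>
      snd (e 0) < 0 \<Longrightarrow> e t \<in> G \<Longrightarrow> \<exists>s\<in>{0..t}. e s \<in> T"
    and speeds: "0 < vE" "vE < vP" and \<alpha>: "\<alpha> = vE / vP"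
begin

lemma alpha_bounds: "0 < \<alpha>" "\<alpha> < 1" "\<alpha> * vP = vE"
  using speeds \<alpha> by auto

lemma T_iff: "p \<in> T \<longleftrightarrow> snd p = 0 \<and> 0 \<le> fst p \<and> fst p \<le> l"
proof -
  have "p \<in> T \<longleftrightarrow> (\<exists>u. 0 \<le> u \<and> u \<le> 1 \<and> p = (u * l, 0))"
    by (auto simp: T target_line_def closed_segment_def)
  also have "\<dots> \<longleftrightarrow> snd p = 0 \<and> 0 \<le> fst p \<and> fst p \<le> l"
  proof
    assume "snd p = 0 \<and> 0 \<le> fst p \<and> fst p \<le> l"
    then show "\<exists>u. 0 \<le> u \<and> u \<le> 1 \<and> p = (u * l, 0)"
      using l by (intro exI[of _ "fst p / l"]) (auto simp: prod_eq_iff)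
  qed (use l in \<open>auto simp: mult_left_le_one_le\<close>)
  finally show ?thesis .
qed

lemma two: "(0, 0) \<in> D" "(l, 0) \<in> D" "(0, 0) \<noteq> (l, 0 :: real)"
  using TD l by (auto simp: T_iff subset_iff)

lemma T_compact: "compact T" "T \<noteq> {}"
  by (auto simp: T target_line_def)

lemma not_T_not_G:
  assumes e: "evader_path D vE e" and "snd (e 0) < 0" and "\<And>s. s \<in> {0..t} \<Longrightarrow> e s \<notin> T" and s: "s \<in> {0..t}"
  shows "e s \<notin> G"
proof
  assume "e s \<in> G"
  then have "\<exists>r\<in>{0..s}. e r \<in> T"
    by (intro crossing evader_path_continuous[OF e] evader_pathD(1)[OF e] assms(2)) (use s in simp_all)
  then show False using assms(3) s by auto
qed

text \<open>A pursuer that meets the evader on its straight way to \<open>p\<close> can run on to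
  \<open>p\<close>. Being faster, it is there no later than the evader, and strictly earlier if part
  of the way is left.\<close>

lemma intercept_bound:
  assumes "trajectory D vP h x" "x t = q" "0 \<le> t" "vE * t \<le> norm (p - z)" "norm (p - q) = norm (p - z) - vE * t"
  shows "\<alpha> * norm (h - p) \<le> norm (z - p)" "vE * t < norm (p - z) \<Longrightarrow> \<alpha> * norm (h - p) < norm (z - p)"
proof -
  have "norm (x t - h) \<le> vP * t"
    using trajectory_lipschitz[OF assms(1), of 0 t] assms(1,3) speeds by (auto simp: trajectory_def)
  moreover have "norm (h - p) \<le> norm (x t - h) + norm (p - q)"
    using norm_triangle_ineq[of "h - q" "q - p"] assms(2) by (simp add: norm_minus_commute)
  ultimately have "norm (h - p) \<le> vP * t + (norm (p - z) - vE * t)" using assms(5) by simp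
  then have "\<alpha> * norm (h - p) \<le> \<alpha> * (vP * t + (norm (p - z) - vE * t))"
    using alpha_bounds by (simp add: mult_left_mono)
  also have "\<dots> = vE * t + \<alpha> * (norm (p - z) - vE * t)"
    using alpha_bounds(3) by (simp add: distrib_left flip: mult.assoc)
  finally have *: "\<alpha> * norm (h - p) \<le> vE * t + \<alpha> * (norm (p - z) - vE * t)" .
  have "\<alpha> * (norm (p - z) - vE * t) \<le> norm (p - z) - vE * t"
    using alpha_bounds assms(4) by (simp add: mult_left_le_one_le)
  with * show "\<alpha> * norm (h - p) \<le> norm (z - p)" by (simp add: norm_minus_commute)
  assume "vE * t < norm (p - z)"
  then have "\<alpha> * (norm (p - z) - vE * t) < norm (p - z) - vE * t" using alpha_bounds by simp
  with * show "\<alpha> * norm (h - p) < norm (z - p)" by (simp add: norm_minus_commute)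
qed

context
  fixes X :: "point set" and z :: point
  assumes X: "finite X" "X \<noteq> {}" "X \<subseteq> D" and z: "z \<in> D" "snd z < 0"
begin

lemma z_not_G: "z \<notin> G"
  using G_above[of z] z(2) by auto

lemma z_neq: "p \<in> T \<Longrightarrow> z \<noteq> p"
  using z(2) by (auto simp: T_iff)

lemma evasion_sufficient:
  assumes p: "p \<in> T" and free: "\<And>h. h \<in> X \<Longrightarrow> norm (z - p) < \<alpha> * norm (h - p)"
  shows "z \<in> evasion_winning_region D G vP vE X"
proof -
  define d where "d = sgn (p - z)"
  define \<tau> where "\<tau> = norm (p - z) / vE"
  have \<tau>: "0 \<le> \<tau>" "vE * \<tau> = norm (p - z)" using speeds by (auto simp: \<tau>_def)
  have pD: "p \<in> D" using p TD by blast
  have const: "((\<lambda>s. vE *\<^sub>R d) has_integral (line vE z p t - z)) {0..t}" if "t \<ge> 0" for t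
    using has_integral_const_real[of "vE *\<^sub>R d" 0 t] that by (simp add: line_def d_def mult.commute)
  have d1: "norm d = 1" using z_neq[OF p] by (simp add: d_def norm_sgn)
  have "(\<exists>e. trajectory D vE z e \<and> follows_feedback G vE X (\<lambda>_ _. d) (S e) e) \<and>
      (\<forall>e. trajectory D vE z e \<and> follows_feedback G vE X (\<lambda>_ _. d) (S e) e \<longrightarrow> evader_wins G X (S e) e)"
    if S: "pursuit_strategy D vP vE X z S" for S
  proof (intro conjI allI impI)
    obtain y where y: "speed_path vE y" "\<And>t. t \<in> {0..\<tau>} \<Longrightarrow> y t = line vE z p t" "\<And>t. t \<ge> 0 \<Longrightarrow> y t \<in> D"
      using travel_exists[OF convex z(1) pD z_neq[OF p] speeds(1)] unfolding \<tau>_def by blast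
    have y0: "y 0 = z" using y(2)[of 0] \<tau>(1) by simp
    have "follows_feedback G vE X (\<lambda>_ _. d) (S y) y"
      unfolding follows_feedback_def
    proof (intro allI impI)
      fix t :: real assume t: "t \<ge> 0" "\<forall>s\<in>{0..<t}. y s \<notin> G \<and> (\<forall>h\<in>X. S y h s \<noteq> y s)"
      have "y \<tau> \<in> G" using y(2)[of \<tau>] \<tau>(1) p TG speeds by (auto simp: \<tau>_def)
      then have "t \<le> \<tau>" using t \<tau>(1) by force
      then show "((\<lambda>s. vE *\<^sub>R d) has_integral y t - y 0) {0..t}" using const[OF t(1)] y(2)[of t] y0 t(1) by simp
    qed
    then show "\<exists>e. trajectory D vE z e \<and> follows_feedback G vE X (\<lambda>_ _. d) (S e) e"
      using speed_path_trajectory[OF y(1) speeds(1) y0 y(3)] by blast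
  next
    fix e assume "trajectory D vE z e \<and> follows_feedback G vE X (\<lambda>_ _. d) (S e) e"
    then have e: "trajectory D vE z e" and fb: "follows_feedback G vE X (\<lambda>_ _. d) (S e) e" by auto
    have ep: "evader_path D vE e" using trajectory_evader_path[OF e] speeds by simp
    have e0: "e 0 = z" using e by (simp add: trajectory_def)
    have Sh: "trajectory D vP h (S e h)" if "h \<in> X" for h using S e that by (simp add: pursuit_strategy_def)
    have straight: "e t = line vE z p t" if "t \<ge> 0" "\<And>s. s \<in> {0..<t} \<Longrightarrow> e s \<notin> G \<and> (\<forall>h\<in>X. S e h s \<noteq> e s)" for t
    proof -
      have "((\<lambda>s. vE *\<^sub>R d) has_integral (e t - z)) {0..t}"
        using fb that e0 unfolding follows_feedback_def by blast
      then have "e t - z = line vE z p t - z" using const[OF that(1)] has_integral_unique by blast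
      then show ?thesis by simp
    qed
    \<comment> \<open>All moments that end the game. The feedback law binds the evader only up to
      the first of them, which exists because \<open>B\<close> is closed.\<close>
    define B where "B = {s \<in> {0..\<tau>}. e s \<in> G} \<union> (\<Union>h\<in>X. {s \<in> {0..\<tau>}. S e h s = e s})"
    have "closed {s \<in> {0..\<tau>}. S e h s = e s}" if "h \<in> X" for h
    proof -
      have "evader_path D vP (S e h)" using trajectory_evader_path[OF Sh[OF that]] speeds by simp
      then have "continuous_on {0..\<tau>} (\<lambda>s. S e h s - e s)"
        using evader_path_continuous ep by (intro continuous_intros) auto
      from continuous_closed_preimage_constant[OF this, of 0] show ?thesis by simp
    qed
    moreover have "closed {s \<in> {0..\<tau>}. e s \<in> G}"
      using continuous_closed_preimage[OF evader_path_continuous[OF ep] _ closed, of \<tau>]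
      by (simp add: vimage_def Int_def)
    ultimately have "closed B" unfolding B_def using X(1) by (intro closed_Un closed_UN) auto
    moreover have "B \<subseteq> {0..\<tau>}" by (auto simp: B_def)
    ultimately have cB: "compact B" using compact_Int_closed[of "{0..\<tau>}" B] by (simp add: Int_absorb1)
    have "B \<noteq> {}"
    proof
      assume B: "B = {}"
      have "e s \<notin> G \<and> (\<forall>h\<in>X. S e h s \<noteq> e s)" if "s \<in> {0..\<tau>}" for s
        using B that unfolding B_def by blast
      moreover from this have "e \<tau> = p" using straight[OF \<tau>(1)] speeds by (simp add: \<tau>_def)
      ultimately show False using \<tau>(1) p TG by auto
    qed
    then obtain r where r: "r \<in> B" "\<And>s. s \<in> B \<Longrightarrow> r \<le> s" using compact_attains_inf[OF cB] by blast
    then have r0: "0 \<le> r" "r \<le> \<tau>" by (auto simp: B_def)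
    have before: "e s \<notin> G \<and> (\<forall>h\<in>X. S e h s \<noteq> e s)" if "s \<in> {0..<r}" for s
      using r(2)[of s] that r0 unfolding B_def by fastforce
    have es: "e s = line vE z p s" if "s \<in> {0..r}" for s
      by (rule straight) (use that before in auto)
    have free_r: "S e h s \<noteq> e s" if s: "s \<in> {0..r}" and h: "h \<in> X" for s h
    proof
      assume meet: "S e h s = e s"
      have "vE * s \<le> vE * \<tau>" using s r0 speeds by (intro mult_left_mono) auto
      moreover have "norm (p - e s) = norm (p - z) - vE * s"
        using line_dist_end[of s p z vE] s r0 speeds es by (simp add: \<tau>_def)
      ultimately have "\<alpha> * norm (h - p) \<le> norm (z - p)"
        using intercept_bound(1)[OF Sh[OF h] meet] s \<tau>(2) by simp
      then show False using free[OF h] by simp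
    qed
    have "e r \<in> G" using r(1) free_r[of r] r0 by (auto simp: B_def)
    then show "evader_wins G X (S e) e" unfolding evader_wins_def using free_r r0 by blast
  qed
  then show ?thesis unfolding evasion_winning_region_def using z(1) z_not_G d1
    by (intro CollectI conjI exI[of _ "\<lambda>_ _. d"]) auto
qed

text \<open>Against the straight run to \<open>p\<close> no pursuer can meet the evader strictly
  before \<open>p\<close>, and a meeting at \<open>p\<close> comes too late, since \<open>p\<close>
  lies in \<open>G\<close>.\<close>

lemma pursuit_necessary:
  assumes p: "p \<in> T" and free: "\<And>h. h \<in> X \<Longrightarrow> norm (z - p) \<le> \<alpha> * norm (h - p)"
  shows "z \<notin> pursuit_winning_region D G vP vE X"
proof
  assume "z \<in> pursuit_winning_region D G vP vE X"
  then obtain S where S: "pursuit_strategy D vP vE X z S" "\<And>e. trajectory D vE z e \<Longrightarrow> pursuers_win G X (S e) e"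
    by (auto simp: pursuit_winning_region_def)
  define \<tau> where "\<tau> = norm (p - z) / vE"
  have \<tau>: "0 \<le> \<tau>" "vE * \<tau> = norm (p - z)" using speeds by (auto simp: \<tau>_def)
  have pD: "p \<in> D" using p TD by blast
  obtain y where y: "speed_path vE y" "\<And>t. t \<in> {0..\<tau>} \<Longrightarrow> y t = line vE z p t" "\<And>t. t \<ge> 0 \<Longrightarrow> y t \<in> D"
    using travel_exists[OF convex z(1) pD z_neq[OF p] speeds(1)] unfolding \<tau>_def by blast
  have y0: "y 0 = z" using y(2)[of 0] \<tau>(1) by simp
  have ty: "trajectory D vE z y" using speed_path_trajectory[OF y(1) speeds(1) y0 y(3)] .
  obtain t h where t: "t \<ge> 0" and h: "h \<in> X" and meet: "S y h t = y t" and out: "\<And>s. s \<in> {0..t} \<Longrightarrow> y s \<notin> G"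
    using S(2)[OF ty] by (auto simp: pursuers_win_def)
  have "y \<tau> \<in> G" using y(2)[of \<tau>] \<tau>(1) p TG speeds by (auto simp: \<tau>_def)
  then have lt: "t < \<tau>" using out[of \<tau>] \<tau>(1) by force
  then have vt: "vE * t < norm (p - z)" using \<tau>(2) speeds by (metis mult_strict_left_mono)
  have Sh: "trajectory D vP h (S y h)" using S(1) ty h by (simp add: pursuit_strategy_def)
  have "norm (p - y t) = norm (p - z) - vE * t"
    using line_dist_end[of t p z vE] t lt speeds y(2)[of t] by (simp add: \<tau>_def)
  then have "\<alpha> * norm (h - p) < norm (z - p)"
    using intercept_bound(2)[OF Sh meet t] vt by simp
  then show False using free[OF h] by simp
qed

lemma pursuit_strategyI:
  assumes "\<And>e h. trajectory D vE z e \<Longrightarrow> h \<in> X \<Longrightarrow> speed_path vP (S e h) \<and> S e h 0 = h \<and> (\<forall>t\<ge>0. S e h t \<in> D)"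
    and "\<And>e e' h t. trajectory D vE z e \<Longrightarrow> trajectory D vE z e' \<Longrightarrow> h \<in> X \<Longrightarrow> t \<ge> 0 \<Longrightarrow>
      \<forall>s\<in>{0..t}. e s = e' s \<Longrightarrow> S e h t = S e' h t"
  shows "pursuit_strategy D vP vE X z S"
proof -
  have "trajectory D vP h (S e h)" if "trajectory D vE z e" "h \<in> X" for e h
    using assms(1)[OF that] speeds by (intro speed_path_trajectory) auto
  moreover have "S e h s = S e' h s"
    if "trajectory D vE z e \<and> trajectory D vE z e' \<and> (\<forall>s\<in>{0..t}. e s = e' s)" "h \<in> X" "s \<in> {0..t}" for e e' h t s
    using assms(2)[of e e' h s] that by auto
  ultimately show ?thesis unfolding pursuit_strategy_def by blast
qed

lemma pursuit_sufficient:
  assumes "\<And>p. p \<in> T \<Longrightarrow> \<exists>h\<in>X. \<alpha> * norm (h - p) < norm (z - p)"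
  shows "\<exists>S. pursuit_strategy D vP vE X z S \<and> (\<forall>e. trajectory D vE z e \<longrightarrow> pursuers_win G X (S e) e)"
proof -
  have XD: "\<And>i. i \<in> X \<Longrightarrow> i \<in> D" using X by auto
  obtain S where S: "\<And>h. h \<in> X \<Longrightarrow> causal (\<lambda>e. S e h)"
    "\<And>e. evader_path D vE e \<Longrightarrow> e 0 = z \<Longrightarrow>
      (\<forall>h\<in>X. speed_path vP (S e h) \<and> S e h 0 = h \<and> (\<forall>t\<ge>0. S e h t \<in> D)) \<and>
      (\<exists>t\<ge>0. (\<exists>h\<in>X. S e h t = e t) \<and> (\<forall>s\<in>{0..t}. e s \<notin> T))"
    using strict_pursuit[OF convex two inner T_compact X(1) XD z(1) speeds assms[unfolded \<alpha>]] by blast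
  have ep: "evader_path D vE e" "e 0 = z" if "trajectory D vE z e" for e
    using trajectory_evader_path[OF that] speeds that by (auto simp: trajectory_def)
  have "pursuit_strategy D vP vE X z S"
  proof (rule pursuit_strategyI)
    show "S e h t = S e' h t" if "h \<in> X" "t \<ge> 0" "\<forall>s\<in>{0..t}. e s = e' s" for e e' h t
      using S(1)[OF that(1)] that(2,3) unfolding causal_def by blast
  qed (use S(2) ep in blast)
  moreover have "pursuers_win G X (S e) e" if "trajectory D vE z e" for e
  proof -
    note e = ep[OF that]
    obtain t h where "t \<ge> 0" "h \<in> X" "S e h t = e t" "\<And>s. s \<in> {0..t} \<Longrightarrow> e s \<notin> T"
      using S(2)[OF e] by blast
    then show ?thesis using not_T_not_G[OF e(1), of t] e(2) z(2) unfolding pursuers_win_def by blast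
  qed
  ultimately show ?thesis by blast
qed

end

end


section \<open>Critical positions\<close>

lemma equality_on_segment:
  fixes q z A :: "'a::real_inner"
  assumes "norm (q - z) \<le> r * norm A" "norm (z + A - q) \<le> (1 - r) * norm A"
  shows "q = z + r *\<^sub>R A"
proof (cases "A = 0")
  case True
  then show ?thesis using assms(1) by simp
next
  case False
  have A: "A = (q - z) + (z + A - q)" by simp
  have tri: "norm A \<le> norm (q - z) + norm (z + A - q)" by (metis A norm_triangle_ineq)
  have sum: "r * norm A + (1 - r) * norm A = norm A" by (simp add: algebra_simps)
  have e: "norm (q - z) = r * norm A" "norm (z + A - q) = (1 - r) * norm A"
    using assms tri sum by linarith+
  then have "norm ((q - z) + (z + A - q)) = norm (q - z) + norm (z + A - q)"
    using A sum by simp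
  \<comment> \<open>Equality in the triangle inequality makes the two parts parallel.\<close>
  then have "(r * norm A) *\<^sub>R (z + A - q) = ((1 - r) * norm A) *\<^sub>R (q - z)"
    using norm_triangle_eq[of "q - z" "z + A - q"] unfolding e by (simp only:)
  then have "norm A *\<^sub>R (r *\<^sub>R (z + A - q) - (1 - r) *\<^sub>R (q - z)) = 0"
    by (simp add: scaleR_diff_right mult.commute)
  then have "r *\<^sub>R (z + A - q) = (1 - r) *\<^sub>R (q - z)" using False by simp
  then show ?thesis by (simp add: algebra_simps)
qed

lemma norm_pair_sq: "(norm (a :: point))\<^sup>2 = (fst a)\<^sup>2 + (snd a)\<^sup>2"
  by (cases a) (simp add: norm_Pair)

text \<open>The critical situation: evader and pursuer reach \<open>z + A = h + B\<close> simultaneously. If the pursuer runs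
  straight to this point while the evader deviates, the points of the axis on the side to which
  \<open>fst A - \<alpha>\<^sup>2 * fst B\<close> points become strictly dominated. To the right of the critical point the
  difference of the squared distances is at least \<open>(1 - \<alpha>\<^sup>2) \<xi>\<^sup>2\<close>, while the pursuer's choice of
  the wrong destination costs \<open>r \<xi>\<^sup>2\<close> only.\<close>

lemma deviation_gap:
  fixes A B z q :: point
  assumes \<alpha>: "0 < \<alpha>" "\<alpha> < 1" and AB: "norm A = \<alpha> * norm B" and r: "0 < r" "r < 1 - \<alpha>\<^sup>2" "r * norm A < snd A"
    and side: "\<xi> * (fst A - \<alpha>\<^sup>2 * fst B) \<ge> 0"
    and q: "norm (q - z) \<le> r * norm A" "q \<noteq> z + r *\<^sub>R A"
  shows "\<alpha> * norm ((1 - r) *\<^sub>R B + (\<xi>, 0)) < norm (q - (z + A + (\<xi>, 0)))"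
proof (cases "\<xi> = 0")
  \<comment> \<open>At the critical point itself the advantage comes from the deviation alone: off
    the segment the evader is too far away.\<close>
  case True
  have "\<alpha>\<^sup>2 > 0" using \<alpha> by simp
  then have r1: "r < 1" using r(2) by linarith
  have "\<alpha> * norm ((1 - r) *\<^sub>R B) = (1 - r) * norm A" using r1 AB by simp
  moreover have "\<not> norm (z + A - q) \<le> (1 - r) * norm A" using equality_on_segment q by blast
  ultimately show ?thesis using True by (simp add: norm_minus_commute flip: zero_prod_def)
next
  case False
  define a where "a = norm A"
  \<comment> \<open>\<open>N\<close> is the distance from \<open>z\<close> to the axis point. From
    \<open>q\<close> it is at least \<open>N - r * a\<close>, which is compared in squares;
    \<open>2 * a * N \<le> a\<^sup>2 + N\<^sup>2\<close> controls the mixed term.\<close>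
  define N where "N = norm (A + (\<xi>, 0))"
  have \<alpha>2: "\<alpha>\<^sup>2 > 0" using \<alpha> by simp
  have r1: "r < 1" using r(2) \<alpha>2 by linarith
  have a: "a > 0" using r(1,3) norm_ge_zero[of A] by (cases "A = 0") (auto simp: a_def)
  have a2: "a\<^sup>2 = (fst A)\<^sup>2 + (snd A)\<^sup>2" by (simp add: a_def norm_pair_sq)
  have N2: "N\<^sup>2 = a\<^sup>2 + 2 * fst A * \<xi> + \<xi>\<^sup>2"
    unfolding N_def a2 norm_pair_sq by (simp add: power2_sum algebra_simps)
  have N0: "N \<ge> 0" by (simp add: N_def)
  have "(snd A)\<^sup>2 \<le> N\<^sup>2" unfolding N_def norm_pair_sq by simp
  then have N1: "snd A \<le> N" using N0 by (rule power2_le_imp_le)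
  have Nra: "r * a < N" using N1 r(3) by (simp add: a_def)
  have "0 \<le> (N - a)\<^sup>2" by simp
  then have "2 * a * N \<le> 2 * a\<^sup>2 + (2 * fst A * \<xi> + \<xi>\<^sup>2)" unfolding power2_diff using N2 by (simp add: ac_simps)
  then have "r * (2 * a * N) \<le> r * (2 * a\<^sup>2 + (2 * fst A * \<xi> + \<xi>\<^sup>2))" using r by simp
  then have *: "2 * r * a * N \<le> 2 * r * a\<^sup>2 + r * (2 * fst A * \<xi> + \<xi>\<^sup>2)" by (simp add: algebra_simps)
  have B2: "\<alpha>\<^sup>2 * ((fst B)\<^sup>2 + (snd B)\<^sup>2) = a\<^sup>2"
    using AB by (simp add: a_def norm_pair_sq[symmetric] power_mult_distrib)
  have n2: "(norm ((1 - r) *\<^sub>R B + (\<xi>, 0)))\<^sup>2 = (1 - r)\<^sup>2 * ((fst B)\<^sup>2 + (snd B)\<^sup>2) + 2 * (1 - r) * fst B * \<xi> + \<xi>\<^sup>2"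
    unfolding norm_pair_sq by (simp add: power2_eq_square algebra_simps)
  have "\<alpha>\<^sup>2 * (norm ((1 - r) *\<^sub>R B + (\<xi>, 0)))\<^sup>2 =
      (1 - r)\<^sup>2 * (\<alpha>\<^sup>2 * ((fst B)\<^sup>2 + (snd B)\<^sup>2)) + \<alpha>\<^sup>2 * (2 * (1 - r) * fst B * \<xi>) + \<alpha>\<^sup>2 * \<xi>\<^sup>2"
    unfolding n2 by (simp add: algebra_simps)
  then have R: "(\<alpha> * norm ((1 - r) *\<^sub>R B + (\<xi>, 0)))\<^sup>2 = (1 - r)\<^sup>2 * a\<^sup>2 + \<alpha>\<^sup>2 * (2 * (1 - r) * fst B * \<xi>) + \<alpha>\<^sup>2 * \<xi>\<^sup>2"
    unfolding B2 by (simp add: power_mult_distrib)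
  have pos: "0 < (1 - \<alpha>\<^sup>2 - r) * \<xi>\<^sup>2" using r(2) False by simp
  have pos2: "0 \<le> 2 * (1 - r) * (\<xi> * (fst A - \<alpha>\<^sup>2 * fst B))" using r1 side by simp
  have "(N - r * a)\<^sup>2 = a\<^sup>2 + 2 * fst A * \<xi> + \<xi>\<^sup>2 - 2 * r * a * N + r\<^sup>2 * a\<^sup>2"
    unfolding power2_diff N2 by (simp add: algebra_simps power_mult_distrib)
  moreover have "2 * (1 - r) * (\<xi> * (fst A - \<alpha>\<^sup>2 * fst B)) + (1 - \<alpha>\<^sup>2 - r) * \<xi>\<^sup>2 =
     a\<^sup>2 + 2 * fst A * \<xi> + \<xi>\<^sup>2 - (2 * r * a\<^sup>2 + r * (2 * fst A * \<xi> + \<xi>\<^sup>2)) + r\<^sup>2 * a\<^sup>2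
     - ((1 - r)\<^sup>2 * a\<^sup>2 + \<alpha>\<^sup>2 * (2 * (1 - r) * fst B * \<xi>) + \<alpha>\<^sup>2 * \<xi>\<^sup>2)"
    by (simp add: power2_diff algebra_simps)
  ultimately have "(\<alpha> * norm ((1 - r) *\<^sub>R B + (\<xi>, 0)))\<^sup>2 < (N - r * a)\<^sup>2"
    using R * pos pos2 by linarith
  then have "\<alpha> * norm ((1 - r) *\<^sub>R B + (\<xi>, 0)) < N - r * a" by (rule power2_less_imp_less) (use Nra in simp)
  moreover have "N \<le> norm (q - (z + A + (\<xi>, 0))) + norm (q - z)"
    using norm_triangle_ineq4[of "q - z" "q - (z + A + (\<xi>, 0))"] by (simp add: N_def algebra_simps)
  ultimately show ?thesis using q(1) by (simp add: a_def)
qed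

text \<open>Near \<open>c\<close>, functions negative at \<open>c\<close> stay negative, and those
  that vanish at \<open>c\<close> with a slope against direction \<open>s\<close> turn negative at
  once. Some other function must therefore carry the nonnegative maximum on side
  \<open>s\<close>.\<close>

lemma quadratic_side:
  fixes f :: "'i \<Rightarrow> real \<Rightarrow> real"
  assumes X: "finite X" and f: "\<And>h x. h \<in> X \<Longrightarrow> f h x = f h c + m * (x - c)\<^sup>2 + b h * (x - c)"
    and le: "\<And>h. h \<in> X \<Longrightarrow> f h c \<le> 0" and s: "s = 1 \<or> s = -1" and "\<epsilon> > 0"
    and ge: "\<And>x. 0 < s * (x - c) \<Longrightarrow> s * (x - c) \<le> \<epsilon> \<Longrightarrow> \<exists>h\<in>X. 0 \<le> f h x"
  shows "\<exists>h\<in>X. f h c = 0 \<and> 0 \<le> s * b h"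
proof (rule ccontr)
  assume neg: "\<not> (\<exists>h\<in>X. f h c = 0 \<and> 0 \<le> s * b h)"
  have "\<forall>\<^sub>F \<eta> in at_right 0. f h (c + s * \<eta>) < 0" if h: "h \<in> X" for h
  proof (cases "f h c = 0")
    case True
    then have sb: "s * b h < 0" using neg h by auto
    have "((\<lambda>\<eta>. m * \<eta> + s * b h) \<longlongrightarrow> m * 0 + s * b h) (at_right 0)" by (intro tendsto_intros)
    then have "\<forall>\<^sub>F \<eta> in at_right 0. m * \<eta> + s * b h < 0" using sb by (intro order_tendstoD(2)) auto
    moreover have "\<forall>\<^sub>F \<eta> in at_right (0::real). \<eta> > 0" by (simp add: eventually_at_right_less)
    ultimately show ?thesis
    proof eventually_elim
      case (elim \<eta>)
      have "f h (c + s * \<eta>) = \<eta> * (m * \<eta> + s * b h)"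
        using f[OF h, of "c + s * \<eta>"] True s by (auto simp: power2_eq_square algebra_simps)
      then show ?case using elim by (simp add: mult_pos_neg)
    qed
  next
    case False
    then have "f h c < 0" using le[OF h] by simp
    moreover have "((\<lambda>\<eta>. f h c + m * (s * \<eta>)\<^sup>2 + b h * (s * \<eta>)) \<longlongrightarrow> f h c + m * (s * 0)\<^sup>2 + b h * (s * 0)) (at_right 0)"
      by (intro tendsto_intros)
    ultimately have "\<forall>\<^sub>F \<eta> in at_right 0. f h c + m * (s * \<eta>)\<^sup>2 + b h * (s * \<eta>) < 0"
      by (intro order_tendstoD(2)) auto
    then show ?thesis
      by eventually_elim (subst f[OF h], simp)
  qed
  then have "\<forall>\<^sub>F \<eta> in at_right 0. \<forall>h\<in>X. f h (c + s * \<eta>) < 0" by (rule eventually_ball_finite[OF X, rule_format])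
  moreover have "\<forall>\<^sub>F \<eta> in at_right 0. \<eta> \<in> {0<..<\<epsilon>}" using \<open>\<epsilon> > 0\<close> by (rule eventually_at_right_real)
  ultimately have "\<forall>\<^sub>F \<eta> in at_right 0. (\<forall>h\<in>X. f h (c + s * \<eta>) < 0) \<and> \<eta> \<in> {0<..<\<epsilon>}"
    by (rule eventually_conj)
  from eventually_happens[OF this]
  obtain \<eta> where \<eta>: "\<forall>h\<in>X. f h (c + s * \<eta>) < 0" "\<eta> \<in> {0<..<\<epsilon>}" by auto
  have s\<eta>: "s * (c + s * \<eta> - c) = \<eta>" using s by auto
  have "\<exists>h\<in>X. 0 \<le> f h (c + s * \<eta>)" by (rule ge) (unfold s\<eta>, use \<eta>(2) in auto)
  then show False using \<eta>(1) by force
qed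


context reach_game
begin

context
  fixes X :: "point set" and z :: point
  assumes X: "finite X" "X \<noteq> {}" "X \<subseteq> D" and z: "z \<in> D" "snd z < 0"
begin

text \<open>Left and right of \<open>c\<close> different pursuers may be responsible. On the side of
  \<open>p\<close> one of them has a difference of squared distances that vanishes at
  \<open>c\<close> and has nonnegative slope towards \<open>p\<close>.\<close>

lemma critical_pursuers:
  assumes guard: "\<And>p. p \<in> T \<Longrightarrow> \<exists>h\<in>X. \<alpha> * norm (h - p) \<le> norm (z - p)"
    and c: "c \<in> T" "\<And>h. h \<in> X \<Longrightarrow> norm (z - c) \<le> \<alpha> * norm (h - c)" and p: "p \<in> T"
  shows "\<exists>h\<in>X. norm (c - z) = \<alpha> * norm (c - h) \<and> 0 \<le> (fst p - fst c) * (fst (c - z) - \<alpha>\<^sup>2 * fst (c - h))"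
proof -
  define f where "f h x = (norm (z - (x, 0)))\<^sup>2 - (\<alpha> * norm (h - (x, 0)))\<^sup>2" for h :: point and x
  define b where "b h = 2 * (fst (c - z) - \<alpha>\<^sup>2 * fst (c - h))" for h
  have c0: "c = (fst c, 0)" using c(1) by (simp add: T_iff prod_eq_iff)
  have f: "f h x = f h (fst c) + (1 - \<alpha>\<^sup>2) * (x - fst c)\<^sup>2 + b h * (x - fst c)" for h x
    unfolding f_def b_def power_mult_distrib norm_pair_sq by (simp add: power2_eq_square algebra_simps)
  have fle: "f h (fst c) \<le> 0" if "h \<in> X" for h
  proof -
    have "(norm (z - c))\<^sup>2 \<le> (\<alpha> * norm (h - c))\<^sup>2" using c(2)[OF that] by (intro power_mono) auto
    then show ?thesis using c0 by (simp add: f_def)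
  qed
  have fge: "\<exists>h\<in>X. 0 \<le> f h x" if xT: "(x, 0) \<in> T" for x
  proof -
    obtain h where h: "h \<in> X" "\<alpha> * norm (h - (x, 0)) \<le> norm (z - (x, 0))" using guard[OF xT] by blast
    then have "(\<alpha> * norm (h - (x, 0)))\<^sup>2 \<le> (norm (z - (x, 0)))\<^sup>2" using alpha_bounds by (intro power_mono) auto
    then show ?thesis using h(1) by (auto simp: f_def)
  qed
  have crit: "norm (c - z) = \<alpha> * norm (c - h)" if "h \<in> X" "f h (fst c) = 0" for h
  proof -
    have "(norm (z - c))\<^sup>2 = (\<alpha> * norm (h - c))\<^sup>2" using that c0 by (simp add: f_def)
    then have "norm (z - c) = \<alpha> * norm (h - c)" by (rule power2_eq_imp_eq) (use alpha_bounds in auto)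
    then show ?thesis by (simp add: norm_minus_commute)
  qed
  show ?thesis
  proof (cases "fst p = fst c")
    case True
    obtain h where "h \<in> X" "0 \<le> f h (fst c)" using fge[of "fst c"] c(1) c0 by auto
    then have "f h (fst c) = 0" using fle[of h] by linarith
    then show ?thesis using crit \<open>h \<in> X\<close> True by auto
  next
    case False
    define s where "s = sgn (fst p - fst c)"
    have s: "s = 1 \<or> s = -1" using False by (auto simp: s_def sgn_if)
    define \<epsilon> where "\<epsilon> = \<bar>fst p - fst c\<bar>"
    have sp: "fst p - fst c = s * \<epsilon>" by (simp add: s_def \<epsilon>_def sgn_mult_abs)
    have \<epsilon>: "\<epsilon> > 0" using False by (simp add: \<epsilon>_def)
    have "\<exists>h\<in>X. f h (fst c) = 0 \<and> 0 \<le> s * b h"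
    proof (rule quadratic_side[OF X(1) f fle s \<epsilon>])
      fix x assume x: "0 < s * (x - fst c)" "s * (x - fst c) \<le> \<epsilon>"
      have "(x, 0) \<in> T" using x s sp p c(1) by (auto simp: T_iff)
      then show "\<exists>h\<in>X. 0 \<le> f h x" by (rule fge)
    qed
    then obtain h where h: "h \<in> X" "f h (fst c) = 0" "0 \<le> s * b h" by blast
    have "0 \<le> \<epsilon> * (s * b h) / 2" using h(3) \<epsilon> by simp
    also have "\<dots> = (fst p - fst c) * (fst (c - z) - \<alpha>\<^sup>2 * fst (c - h))"
      unfolding sp b_def by (simp add: field_simps)
    finally show ?thesis using crit h by blast
  qed
qed

text \<open>Against a critical position the coalition runs straight to the unique point \<open>c\<close> that both sides can
  reach simultaneously. Only if the evader has deviated from the segment to \<open>c\<close>, for the first time at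
  \<open>s\<^sub>0\<close>, does it switch, a fraction \<open>\<mu>\<close> of the remaining time later, to the strategy for the then strictly
  won position.\<close>

lemma evasion_necessary:
  assumes guard: "\<And>p. p \<in> T \<Longrightarrow> \<exists>h\<in>X. \<alpha> * norm (h - p) \<le> norm (z - p)"
  shows "\<exists>S. pursuit_strategy D vP vE X z S \<and> (\<forall>e. trajectory D vE z e \<longrightarrow> \<not> evader_wins G X (S e) e)"
proof (cases "\<forall>p\<in>T. \<exists>h\<in>X. \<alpha> * norm (h - p) < norm (z - p)")
  case True
  then obtain S where S: "pursuit_strategy D vP vE X z S" "\<And>e. trajectory D vE z e \<Longrightarrow> pursuers_win G X (S e) e"
    using pursuit_sufficient[OF X z] by blast
  have "\<not> evader_wins G X P e" if win: "pursuers_win G X P e" for P e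
  proof
    assume "evader_wins G X P e"
    then obtain t where t: "t \<ge> 0" "e t \<in> G" "\<And>s h. s \<in> {0..t} \<Longrightarrow> h \<in> X \<Longrightarrow> P h s \<noteq> e s"
      by (auto simp: evader_wins_def)
    obtain r h where r: "r \<ge> 0" "h \<in> X" "P h r = e r" "\<And>s. s \<in> {0..r} \<Longrightarrow> e s \<notin> G"
      using win by (auto simp: pursuers_win_def)
    show False using t(3)[of r h] r(4)[of t] t(1,2) r(1-3) by (cases "r \<le> t") auto
  qed
  then show ?thesis using S by blast
next
  case False
  then obtain c where c: "c \<in> T" "\<And>h. h \<in> X \<Longrightarrow> norm (z - c) \<le> \<alpha> * norm (h - c)"
    by (auto simp: not_less)
  have cD: "c \<in> D" using c(1) TD by blast
  define A where "A = c - z"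
  define a where "a = norm A"
  have sA: "snd A > 0" using c(1) z(2) by (simp add: A_def T_iff)
  have zA: "snd z = - snd A" using c(1) by (simp add: A_def T_iff)
  have zc: "z \<noteq> c" using c(1) z(2) by (auto simp: T_iff)
  have a: "a > 0" using zc by (simp add: a_def A_def)
  define \<tau> where "\<tau> = a / vE"
  have \<tau>: "\<tau> > 0" "vE * \<tau> = a" using a speeds by (simp_all add: \<tau>_def)
  \<comment> \<open>Half of the smaller of the two bounds on the fraction in
    \<open>deviation_gap\<close>. The second bound also keeps the evader off the axis until the
    switch.\<close>
  define \<mu> where "\<mu> = min (1 - \<alpha>\<^sup>2) (snd A / a) / 2"
  have \<alpha>2: "0 < \<alpha>\<^sup>2" "\<alpha>\<^sup>2 < 1" using alpha_bounds by (simp_all add: power_less_one_iff)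
  have \<mu>: "0 < \<mu>" "\<mu> < 1 - \<alpha>\<^sup>2" "\<mu> < 1" "\<mu> < snd A / a"
  proof -
    have m: "0 < min (1 - \<alpha>\<^sup>2) (snd A / a)" using \<alpha>2 sA a by simp
    have "min (1 - \<alpha>\<^sup>2) (snd A / a) = 2 * \<mu>" by (simp add: \<mu>_def)
    then have "2 * \<mu> \<le> 1 - \<alpha>\<^sup>2" "2 * \<mu> \<le> snd A / a" "0 < 2 * \<mu>"
      using m by (metis min.cobounded1, metis min.cobounded2, simp)
    then show "0 < \<mu>" "\<mu> < 1 - \<alpha>\<^sup>2" "\<mu> < 1" "\<mu> < snd A / a" using \<alpha>2 by linarith+
  qed
  then have \<mu>a: "\<mu> * a < snd A" using a by (simp add: pos_less_divide_eq)
  define g where "g = line vE z c"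
  have g: "g t = z + (t / \<tau>) *\<^sub>R A" for t
    using zc speeds a unfolding g_def line_def sgn_div_norm A_def[symmetric] a_def[symmetric] \<tau>_def by (simp add: field_simps)
  have g\<tau>: "g \<tau> = c" using \<tau> by (simp add: g A_def)
  \<comment> \<open>No pursuer can be at \<open>c\<close> before time \<open>\<tau>\<close>, so
    until then all of them are on their straight lines.\<close>
  have hc: "h \<noteq> c" "\<tau> \<le> norm (c - h) / vP" if h: "h \<in> X" for h
  proof -
    have 1: "a \<le> \<alpha> * norm (c - h)" using c(2)[OF h] by (simp add: a_def A_def norm_minus_commute)
    then show "h \<noteq> c" using a by auto
    show "\<tau> \<le> norm (c - h) / vP" using 1 speeds unfolding \<tau>_def \<alpha> by (simp add: field_simps)
  qed
  have "\<forall>h\<in>X. \<exists>y. speed_path vP y \<and> (\<forall>t\<in>{0..norm (c - h) / vP}. y t = line vP h c t) \<and> (\<forall>t\<ge>0. y t \<in> D)"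
    using travel_exists[OF convex _ cD] hc(1) X(3) speeds by (metis less_trans subsetD)
  then obtain y where y: "\<And>h. h \<in> X \<Longrightarrow> speed_path vP (y h)"
    "\<And>h t. h \<in> X \<Longrightarrow> t \<in> {0..norm (c - h) / vP} \<Longrightarrow> y h t = line vP h c t"
    "\<And>h t. h \<in> X \<Longrightarrow> t \<ge> 0 \<Longrightarrow> y h t \<in> D" by metis
  have y0: "y h 0 = h" if "h \<in> X" for h using y(2)[OF that, of 0] hc(2)[OF that] \<tau>(1) by simp
  have ycrit: "y h t = h + (t / \<tau>) *\<^sub>R (c - h)"
    if h: "h \<in> X" and crit: "a = \<alpha> * norm (c - h)" and t: "0 \<le> t" "t \<le> \<tau>" for h t
  proof -
    have n: "norm (c - h) = vP * \<tau>" using crit speeds unfolding \<tau>_def \<alpha> by (simp add: field_simps)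
    have "y h t = line vP h c t" using y(2)[OF h] hc(2)[OF h] t by auto
    also have "\<dots> = h + (t / \<tau>) *\<^sub>R (c - h)"
      using n speeds \<tau>(1) by (simp add: line_def sgn_div_norm field_simps)
    finally show ?thesis .
  qed
  have strict: "\<exists>h\<in>X. \<alpha> * norm (y h \<theta> - p) < norm (q - p)"
    if s: "0 \<le> s" "s < \<tau>" and \<theta>: "\<theta> = s + \<mu> * (\<tau> - s)"
      and q: "norm (q - g s) \<le> vE * (\<theta> - s)" "q \<noteq> g \<theta>" and p: "p \<in> T" for s \<theta> q p
  proof -
    obtain h where h: "h \<in> X" and crit: "norm (c - z) = \<alpha> * norm (c - h)"
      and side: "0 \<le> (fst p - fst c) * (fst (c - z) - \<alpha>\<^sup>2 * fst (c - h))"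
      using critical_pursuers[OF guard c p] by blast
    \<comment> \<open>The fraction of the way still ahead at time \<open>s\<close>. Evader and
      critical pursuer have shortened their ways to \<open>c\<close> in the same proportion, so the
      position is a scaled critical one and \<open>deviation_gap\<close> applies.\<close>
    define r where "r = 1 - s / \<tau>"
    have r: "0 < r" "r \<le> 1" using s \<tau> by (auto simp: r_def)
    have \<theta>1: "s \<le> \<theta>" "\<theta> \<le> \<tau>"
    proof -
      show "s \<le> \<theta>" using \<mu> s by (simp add: \<theta>)
      have "\<mu> * (\<tau> - s) \<le> 1 * (\<tau> - s)" using \<mu> s by (intro mult_right_mono) auto
      then show "\<theta> \<le> \<tau>" by (simp add: \<theta>)
    qed
    have \<theta>r: "1 - \<theta> / \<tau> = (1 - \<mu>) * r" "\<theta> / \<tau> = s / \<tau> + \<mu> * r"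
      using \<tau>(1) by (simp_all add: \<theta> r_def field_simps)
    have "\<alpha> * norm ((1 - \<mu>) *\<^sub>R (r *\<^sub>R (c - h)) + (fst p - fst c, 0)) <
      norm (q - (g s + r *\<^sub>R A + (fst p - fst c, 0)))"
    proof (rule deviation_gap[OF alpha_bounds(1,2) _ \<mu>(1,2)])
      show "norm (r *\<^sub>R A) = \<alpha> * norm (r *\<^sub>R (c - h))" using crit r by (simp add: A_def)
      show "\<mu> * norm (r *\<^sub>R A) < snd (r *\<^sub>R A)" using \<mu>a r by (simp add: a_def)
      have "0 \<le> r * ((fst p - fst c) * (fst (c - z) - \<alpha>\<^sup>2 * fst (c - h)))" using side r by simp
      then show "0 \<le> (fst p - fst c) * (fst (r *\<^sub>R A) - \<alpha>\<^sup>2 * fst (r *\<^sub>R (c - h)))"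
        by (simp add: A_def algebra_simps)
      have "vE * (\<theta> - s) = \<mu> * norm (r *\<^sub>R A)"
        using r \<tau> speeds unfolding norm_scaleR a_def[symmetric] \<theta> r_def by (simp add: \<tau>_def field_simps)
      then show "norm (q - g s) \<le> \<mu> * norm (r *\<^sub>R A)" using q(1) by simp
      have "g \<theta> = g s + \<mu> *\<^sub>R r *\<^sub>R A" unfolding g \<theta>r(2) by (simp add: scaleR_left_distrib)
      then show "q \<noteq> g s + \<mu> *\<^sub>R r *\<^sub>R A" using q(2) by simp
    qed
    moreover have "g s + r *\<^sub>R A + (fst p - fst c, 0) = p"
    proof -
      have "g s + r *\<^sub>R A = c" by (simp add: g r_def A_def scaleR_left_diff_distrib)
      then show ?thesis using c(1) p by (auto simp: T_iff prod_eq_iff)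
    qed
    moreover have "y h \<theta> - p = - ((1 - \<mu>) *\<^sub>R (r *\<^sub>R (c - h)) + (fst p - fst c, 0))"
    proof -
      have "y h \<theta> = h + (\<theta> / \<tau>) *\<^sub>R (c - h)"
        by (rule ycrit[OF h]) (use crit \<theta>1 s in \<open>auto simp: a_def A_def\<close>)
      then have "y h \<theta> = c - (1 - \<theta> / \<tau>) *\<^sub>R (c - h)" by (simp add: scaleR_left_diff_distrib)
      then have "y h \<theta> = c - (1 - \<mu>) *\<^sub>R (r *\<^sub>R (c - h))" unfolding \<theta>r(1) by simp
      moreover have "p = c + (fst p - fst c, 0)" using c(1) p by (auto simp: T_iff prod_eq_iff)
      ultimately show ?thesis by (metis (no_types, opaque_lifting) add_diff_cancel_left' diff_diff_eq2 diff_minus_eq_add minus_add_distrib minus_diff_eq uminus_add_conv_diff add.commute)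
    qed
    ultimately show ?thesis using h by (metis norm_minus_cancel)
  qed
  \<comment> \<open>Chosen for position and time alone, so that evaders with the same past face the
    same strategy.\<close>
  define SS where "SS q \<theta> = (SOME S. (\<forall>h\<in>X. causal (\<lambda>e. S e h)) \<and> (\<forall>e. evader_path D vE e \<and> e 0 = q \<longrightarrow>
      (\<forall>h\<in>X. speed_path vP (S e h) \<and> S e h 0 = y h \<theta> \<and> (\<forall>t\<ge>0. S e h t \<in> D)) \<and>
      (\<exists>t\<ge>0. (\<exists>h\<in>X. S e h t = e t) \<and> (\<forall>s\<in>{0..t}. e s \<notin> T))))" for q \<theta>
  have SS: "(\<forall>h\<in>X. causal (\<lambda>e. SS q \<theta> e h)) \<and> (\<forall>e. evader_path D vE e \<and> e 0 = q \<longrightarrow>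
      (\<forall>h\<in>X. speed_path vP (SS q \<theta> e h) \<and> SS q \<theta> e h 0 = y h \<theta> \<and> (\<forall>t\<ge>0. SS q \<theta> e h t \<in> D)) \<and>
      (\<exists>t\<ge>0. (\<exists>h\<in>X. SS q \<theta> e h t = e t) \<and> (\<forall>s\<in>{0..t}. e s \<notin> T)))"
    if "q \<in> D" "0 \<le> \<theta>" and lead: "\<forall>p\<in>T. \<exists>h\<in>X. \<alpha> * norm (y h \<theta> - p) < norm (q - p)" for q \<theta>
  proof -
    have yD: "y h \<theta> \<in> D" if "h \<in> X" for h using y(3)[OF that \<open>0 \<le> \<theta>\<close>] .
    have ahead: "\<exists>h\<in>X. vE / vP * norm (y h \<theta> - p) < norm (q - p)" if "p \<in> T" for p
      using lead that by (simp add: \<alpha>)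
    have "\<exists>S. (\<forall>h\<in>X. causal (\<lambda>e. S e h)) \<and> (\<forall>e. evader_path D vE e \<and> e 0 = q \<longrightarrow>
        (\<forall>h\<in>X. speed_path vP (S e h) \<and> S e h 0 = y h \<theta> \<and> (\<forall>t\<ge>0. S e h t \<in> D)) \<and>
        (\<exists>t\<ge>0. (\<exists>h\<in>X. S e h t = e t) \<and> (\<forall>s\<in>{0..t}. e s \<notin> T)))"
      by (rule strict_pursuit[OF convex two inner T_compact X(1) yD \<open>q \<in> D\<close> speeds ahead])
    from someI_ex[OF this] show ?thesis unfolding SS_def .
  qed
  \<comment> \<open>The last moment on schedule, equal to \<open>\<tau>\<close> if the evader never
    deviates. It is defined from the whole path; \<open>same\<close> shows that it is known at time
    \<open>\<theta> e\<close>.\<close>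
  define s0 where "s0 e = Sup {t \<in> {0..\<tau>}. e t = g t}" for e
  define \<theta> where "\<theta> e = s0 e + \<mu> * (\<tau> - s0 e)" for e
  define S where "S e h = (if s0 e < \<tau> then join (\<theta> e) (y h) (SS (e (\<theta> e)) (\<theta> e) (\<lambda>t. e (\<theta> e + t)) h) else y h)" for e h
  have ep: "evader_path D vE e" "e 0 = z" if "trajectory D vE z e" for e
    using trajectory_evader_path[OF that] speeds that by (auto simp: trajectory_def)
  have s0: "0 \<le> s0 e" "s0 e \<le> \<tau>" "t \<in> {0..\<tau>} \<Longrightarrow> e t = g t \<longleftrightarrow> t \<le> s0 e" if e: "trajectory D vE z e" for e t
  proof -
    have e': "evader_path D vE e" "e 0 = z" using ep[OF e] by auto
    let ?B = "{t \<in> {0..\<tau>}. e t = g t}"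
    have "continuous_on {0..\<tau>} (\<lambda>t. e t - g t)" unfolding g
      using \<tau>(1) by (intro continuous_intros evader_path_continuous[OF e'(1)]) auto
    from continuous_closed_preimage_constant[OF this, of 0] have cl: "closed ?B" by simp
    have 0: "0 \<in> ?B" using e'(2) \<tau> by (simp add: g)
    have bdd: "bdd_above ?B" by (auto intro!: bdd_aboveI[of _ \<tau>])
    have "s0 e \<in> ?B" unfolding s0_def using closed_contains_Sup[OF _ bdd cl] 0 by blast
    then show s0': "0 \<le> s0 e" "s0 e \<le> \<tau>" by auto
    have up: "t \<le> s0 e" if "t \<in> ?B" for t unfolding s0_def using that bdd by (rule cSup_upper)
    \<comment> \<open>The scheduled point can be reached in time only along the segment at full
      speed, so being on schedule once implies having been so ever before.\<close>
    have down: "e t = g t" if t: "0 \<le> t" "t \<le> s0 e" for t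
    proof (cases "s0 e = 0")
      case True
      then show ?thesis using t 0 by auto
    next
      case False
      then have sp: "s0 e > 0" using s0' by simp
      let ?A = "(s0 e / \<tau>) *\<^sub>R A"
      have nA: "norm ?A = vE * s0 e" using sp speeds a unfolding norm_scaleR a_def[symmetric] by (simp add: \<tau>_def field_simps)
      have es: "e (s0 e) = z + ?A" using \<open>s0 e \<in> ?B\<close> by (simp add: g)
      have "e t = z + (t / s0 e) *\<^sub>R ?A"
      proof (rule equality_on_segment)
        show "norm (e t - z) \<le> t / s0 e * norm ?A"
          unfolding nA using evader_pathD(2)[OF e'(1), of 0 t] e'(2) t sp by (simp add: mult.commute)
        have "norm (z + ?A - e t) \<le> vE * (s0 e - t)"
          using evader_pathD(2)[OF e'(1) t] es by simp
        moreover have "(1 - t / s0 e) * (vE * s0 e) = vE * (s0 e - t)" using sp by (simp add: field_simps)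
        ultimately show "norm (z + ?A - e t) \<le> (1 - t / s0 e) * norm ?A" unfolding nA by linarith
      qed
      then show ?thesis using sp by (simp add: g)
    qed
    show "e t = g t \<longleftrightarrow> t \<le> s0 e" if "t \<in> {0..\<tau>}" using up[of t] down[of t] that by auto
  qed
  have \<theta>b: "s0 e < \<theta> e" "\<theta> e < \<tau>" "0 \<le> \<theta> e" if e: "trajectory D vE z e" and lt: "s0 e < \<tau>" for e
  proof -
    show 1: "s0 e < \<theta> e" using \<mu> lt by (simp add: \<theta>_def)
    have "\<mu> * (\<tau> - s0 e) < 1 * (\<tau> - s0 e)" using \<mu> lt by (intro mult_strict_right_mono) auto
    then show "\<theta> e < \<tau>" by (simp add: \<theta>_def)
    show "0 \<le> \<theta> e" using 1 s0(1)[OF e] by simp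
  qed
  have won: "\<forall>p\<in>T. \<exists>h\<in>X. \<alpha> * norm (y h (\<theta> e) - p) < norm (e (\<theta> e) - p)"
    if e: "trajectory D vE z e" and lt: "s0 e < \<tau>" for e
  proof
    fix p assume p: "p \<in> T"
    note b = \<theta>b[OF e lt] and s = s0[OF e]
    have gs: "g (s0 e) = e (s0 e)" using s(3)[of "s0 e"] s(1,2) by auto
    show "\<exists>h\<in>X. \<alpha> * norm (y h (\<theta> e) - p) < norm (e (\<theta> e) - p)"
    proof (rule strict[OF s(1) lt \<theta>_def _ _ p])
      show "norm (e (\<theta> e) - g (s0 e)) \<le> vE * (\<theta> e - s0 e)"
        unfolding gs using evader_pathD(2)[OF ep(1)[OF e] s(1)] b by simp
      show "e (\<theta> e) \<noteq> g (\<theta> e)" using s(3)[of "\<theta> e"] b by simp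
    qed
  qed
  have SSe: "speed_path vP (SS (e (\<theta> e)) (\<theta> e) (\<lambda>t. e (\<theta> e + t)) h) \<and>
      SS (e (\<theta> e)) (\<theta> e) (\<lambda>t. e (\<theta> e + t)) h 0 = y h (\<theta> e) \<and>
      (\<forall>t\<ge>0. SS (e (\<theta> e)) (\<theta> e) (\<lambda>t. e (\<theta> e + t)) h t \<in> D)"
    "\<exists>t\<ge>0. (\<exists>h\<in>X. SS (e (\<theta> e)) (\<theta> e) (\<lambda>t. e (\<theta> e + t)) h t = e (\<theta> e + t)) \<and> (\<forall>s\<in>{0..t}. e (\<theta> e + s) \<notin> T)"
    "causal (\<lambda>e'. SS (e (\<theta> e)) (\<theta> e) e' h)"
    if e: "trajectory D vE z e" and lt: "s0 e < \<tau>" and h: "h \<in> X" for e h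
  proof -
    note b = \<theta>b[OF e lt]
    have sh: "evader_path D vE (\<lambda>t. e (\<theta> e + t)) \<and> e (\<theta> e + 0) = e (\<theta> e)"
      using evader_path_shift[OF ep(1)[OF e] b(3)] by simp
    have eD: "e (\<theta> e) \<in> D" using evader_pathD(1)[OF ep(1)[OF e] b(3)] .
    note * = SS[OF eD b(3) won[OF e lt]]
    show "causal (\<lambda>e'. SS (e (\<theta> e)) (\<theta> e) e' h)" using * h by blast
    note ** = conjunct2[OF *, rule_format, OF sh]
    show "speed_path vP (SS (e (\<theta> e)) (\<theta> e) (\<lambda>t. e (\<theta> e + t)) h) \<and>
      SS (e (\<theta> e)) (\<theta> e) (\<lambda>t. e (\<theta> e + t)) h 0 = y h (\<theta> e) \<and>
      (\<forall>t\<ge>0. SS (e (\<theta> e)) (\<theta> e) (\<lambda>t. e (\<theta> e + t)) h t \<in> D)"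
      using conjunct1[OF **] h by blast
    show "\<exists>t\<ge>0. (\<exists>h\<in>X. SS (e (\<theta> e)) (\<theta> e) (\<lambda>t. e (\<theta> e + t)) h t = e (\<theta> e + t)) \<and> (\<forall>s\<in>{0..t}. e (\<theta> e + s) \<notin> T)"
      using conjunct2[OF **] .
  qed
  have same: "S e h t = S e' h t"
    if e: "trajectory D vE z e" and e': "trajectory D vE z e'" and h: "h \<in> X" and t: "0 \<le> t"
      and eq: "\<forall>s\<in>{0..t}. e s = e' s" and lt: "s0 e < \<tau>" and le: "\<theta> e \<le> t" for e e' h t
  proof -
    note b = \<theta>b[OF e lt]
    have A1: "e' (s0 e) = g (s0 e)" "e' (\<theta> e) \<noteq> g (\<theta> e)"
      using s0(3)[OF e, of "s0 e"] s0(3)[OF e, of "\<theta> e"] s0(1,2)[OF e] eq b le by auto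
    \<comment> \<open>Off schedule at \<open>\<theta> e\<close>, the second evader stays off,
      whatever it does after \<open>t\<close>.\<close>
    have dev: "e' r \<noteq> g r" if "r \<in> {0..\<tau>}" "s0 e < r" for r
    proof (cases "r \<le> t")
      case True
      then show ?thesis using s0(3)[OF e that(1)] eq that by auto
    next
      case False
      have "\<not> \<theta> e \<le> s0 e'" using s0(3)[OF e', of "\<theta> e"] A1(2) b by simp
      then show ?thesis using s0(3)[OF e' that(1)] False le by simp
    qed
    have "s0 e \<le> s0 e'" using s0(3)[OF e', of "s0 e"] A1(1) s0(1,2)[OF e] by simp
    moreover have "s0 e' \<le> s0 e"
      using dev[of "s0 e'"] s0(3)[OF e', of "s0 e'"] s0(1,2)[OF e'] by fastforce
    ultimately have s: "s0 e' = s0 e" by simp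
    then have \<theta>': "\<theta> e' = \<theta> e" by (simp add: \<theta>_def)
    have e\<theta>: "e' (\<theta> e) = e (\<theta> e)" using eq b le by simp
    have "SS (e (\<theta> e)) (\<theta> e) (\<lambda>t. e (\<theta> e + t)) h (t - \<theta> e) = SS (e (\<theta> e)) (\<theta> e) (\<lambda>t. e' (\<theta> e + t)) h (t - \<theta> e)"
      by (rule SSe(3)[OF e lt h, unfolded causal_def, rule_format]) (use le eq b in auto)
    then show ?thesis using lt le by (simp add: S_def s \<theta>' e\<theta> join_def)
  qed
  have "pursuit_strategy D vP vE X z S"
  proof (rule pursuit_strategyI[OF X z])
    fix e h assume e: "trajectory D vE z e" and h: "h \<in> X"
    show "speed_path vP (S e h) \<and> S e h 0 = h \<and> (\<forall>t\<ge>0. S e h t \<in> D)"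
    proof (cases "s0 e < \<tau>")
      case False
      then show ?thesis using y(1,3)[OF h] y0[OF h] by (simp add: S_def)
    next
      case True
      note b = \<theta>b[OF e True] and ss = SSe(1)[OF e True h]
      have "speed_path vP (S e h)"
        unfolding S_def using True y(1)[OF h] ss b by (auto intro!: speed_path_join simp: speed_path_def[of _ "y h"])
      moreover have "S e h 0 = h" using True b s0(1)[OF e] y0[OF h] by (simp add: S_def join_def)
      moreover have "S e h t \<in> D" if "t \<ge> 0" for t
        using True y(3)[OF h that] ss by (simp add: S_def join_def)
      ultimately show ?thesis by blast
    qed
  next
    fix e e' h t
    assume e: "trajectory D vE z e" "trajectory D vE z e'" and h: "h \<in> X" and t: "0 \<le> (t::real)"
      and eq: "\<forall>s\<in>{0..t}. e s = e' s"
    have stay: "S e h t = y h t" if "\<not> (s0 e < \<tau> \<and> \<theta> e \<le> t)" for e using that by (auto simp: S_def join_def)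
    show "S e h t = S e' h t"
      using same[OF e h t eq] same[OF e(2,1) h t] stay[of e] stay[of e'] eq by fastforce
  qed
  moreover have "\<not> evader_wins G X (S e) e" if e: "trajectory D vE z e" for e
  proof
    assume "evader_wins G X (S e) e"
    then obtain t where t: "t \<ge> 0" "e t \<in> G" "\<And>s h. s \<in> {0..t} \<Longrightarrow> h \<in> X \<Longrightarrow> S e h s \<noteq> e s"
      by (auto simp: evader_wins_def)
    have e0: "snd (e 0) < 0" using ep(2)[OF e] z(2) by simp
    obtain t1 where t1: "t1 \<in> {0..t}" "e t1 \<in> T"
      using not_T_not_G[OF ep(1)[OF e] e0, of t t] t(1,2) by auto
    have below: "snd (e s) < 0" if "0 \<le> s" "s \<le> s0 e" "s < \<tau>" for s
    proof -
      have "e s = z + (s / \<tau>) *\<^sub>R A" using s0(3)[OF e, of s] that by (simp add: g)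
      then have "snd (e s) = (1 - s / \<tau>) * snd z" by (simp add: zA left_diff_distrib)
      moreover have "0 < 1 - s / \<tau>" using that(3) \<tau>(1) by simp
      ultimately show ?thesis using z(2) by (simp add: mult_pos_neg)
    qed
    show False
    proof (cases "s0 e < \<tau>")
      \<comment> \<open>An evader that never deviates is met at \<open>c\<close> by a critical
        pursuer just as it arrives, which is no win for it.\<close>
      case False
      then have s: "s0 e = \<tau>" using s0(2)[OF e] by simp
      have "\<tau> \<le> t1" using below[of t1] t1 s by (force simp: T_iff)
      then have \<tau>t: "\<tau> \<in> {0..t}" using t1 \<tau> by auto
      obtain h where h: "h \<in> X" "norm (c - z) = \<alpha> * norm (c - h)"
        using critical_pursuers[OF guard c c(1)] by blast
      have "y h \<tau> = c" using ycrit[OF h(1), of \<tau>] h(2) \<tau> by (simp add: a_def A_def)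
      moreover have "e \<tau> = c" using s0(3)[OF e, of \<tau>] s \<tau> g\<tau> by simp
      ultimately show False using t(3)[OF \<tau>t h(1)] s by (simp add: S_def)
    next
      case True
      note b = \<theta>b[OF e True]
      obtain h0 where h0: "h0 \<in> X" using X(2) by blast
      obtain r h where r: "r \<ge> 0" and h: "h \<in> X" and meet: "SS (e (\<theta> e)) (\<theta> e) (\<lambda>t. e (\<theta> e + t)) h r = e (\<theta> e + r)"
        and out: "\<And>s. s \<in> {0..r} \<Longrightarrow> e (\<theta> e + s) \<notin> T"
        using SSe(2)[OF e True h0] by blast
      have "e s \<notin> T" if s: "s \<in> {0..\<theta> e + r}" for s
      proof (cases "s < \<theta> e")
        case False
        then show ?thesis using out[of "s - \<theta> e"] s by simp
      next
        case 1: True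
        show ?thesis
        proof (cases "s \<le> s0 e")
          case True
          then show ?thesis using below[of s] s 1 b by (force simp: T_iff)
        next
          case False
          \<comment> \<open>Between \<open>s0 e\<close> and the switch the evader covers less than
            its depth below the axis.\<close>
          have "norm (e s - e (s0 e)) \<le> vE * (s - s0 e)"
            using evader_pathD(2)[OF ep(1)[OF e] s0(1)[OF e]] False by simp
          also have "\<dots> \<le> vE * (\<mu> * (\<tau> - s0 e))" using 1 speeds by (intro mult_left_mono) (auto simp: \<theta>_def)
          also have "\<dots> = (\<mu> * a) * (1 - s0 e / \<tau>)" using \<tau> speeds a by (simp add: \<tau>_def field_simps)
          also have "\<dots> < snd A * (1 - s0 e / \<tau>)" using \<mu>a \<open>s0 e < \<tau>\<close> \<tau>(1) by (intro mult_strict_right_mono) auto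
          finally have "norm (e s - e (s0 e)) < snd A * (1 - s0 e / \<tau>)" .
          moreover have "\<bar>snd (e s - e (s0 e))\<bar> \<le> norm (e s - e (s0 e))"
            using norm_snd_le[of "snd (e s - e (s0 e))" "fst (e s - e (s0 e))"]
            unfolding prod.collapse real_norm_def .
          moreover have "e (s0 e) = z + (s0 e / \<tau>) *\<^sub>R A"
            using s0(3)[OF e, of "s0 e"] s0(1,2)[OF e] by (simp add: g)
          then have "snd (e (s0 e)) = - (snd A * (1 - s0 e / \<tau>))" by (simp add: zA right_diff_distrib)
          ultimately show ?thesis by (auto simp: T_iff)
        qed
      qed
      then have "\<theta> e + r < t1" using t1 by force
      then have "S e h (\<theta> e + r) \<noteq> e (\<theta> e + r)" using t(3)[OF _ h] t1 b r by auto
      then show False using meet r True by (simp add: S_def join_def)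
    qed
  qed
  ultimately show ?thesis by blast
qed

lemma barrier_iff:
  "z \<notin> pursuit_winning_region D G vP vE X \<and> z \<notin> evasion_winning_region D G vP vE X \<longleftrightarrow>
    (\<exists>p\<in>T. \<forall>h\<in>X. norm (z - p) \<le> \<alpha> * norm (h - p)) \<and>
    (\<forall>p\<in>T. \<exists>h\<in>X. \<alpha> * norm (h - p) \<le> norm (z - p))"
  (is "?L \<longleftrightarrow> ?R1 \<and> ?R2")
proof (intro iffI conjI)
  assume L: ?L
  show ?R1
  proof (rule ccontr)
    assume "\<not> ?R1"
    then have "\<And>p. p \<in> T \<Longrightarrow> \<exists>h\<in>X. \<alpha> * norm (h - p) < norm (z - p)" by (meson not_le)
    from pursuit_sufficient[OF X z this] show False
      using L z(1) z_not_G[OF X z] by (auto simp: pursuit_winning_region_def)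
  qed
  show ?R2
  proof (rule ccontr)
    assume "\<not> ?R2"
    then obtain p where "p \<in> T" "\<And>h. h \<in> X \<Longrightarrow> norm (z - p) < \<alpha> * norm (h - p)" by (meson not_le)
    from evasion_sufficient[OF X z this] show False using L by blast
  qed
next
  assume R: "?R1 \<and> ?R2"
  show "z \<notin> pursuit_winning_region D G vP vE X" using R pursuit_necessary[OF X z] by blast
  obtain S where "pursuit_strategy D vP vE X z S" "\<And>e. trajectory D vE z e \<Longrightarrow> \<not> evader_wins G X (S e) e"
    using evasion_necessary R by blast
  then show "z \<notin> evasion_winning_region D G vP vE X" unfolding evasion_winning_region_def by blast
qed

end

end


section \<open>The explicit curves\<close>

definition axis_dist :: "point \<Rightarrow> real \<Rightarrow> real" where
  "axis_dist h x = (x - fst h)\<^sup>2 + (snd h)\<^sup>2"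

text \<open>Positive iff pursuer \<open>h\<close> can be at \<open>(x, 0)\<close> before the evader.
  The squares make it a quadratic in \<open>x\<close> with the same leading coefficient for all
  pursuers.\<close>

definition margin :: "real \<Rightarrow> point \<Rightarrow> point \<Rightarrow> real \<Rightarrow> real" where
  "margin \<alpha> z h x = axis_dist z x - \<alpha>\<^sup>2 * axis_dist h x"

definition critical_set :: "real \<Rightarrow> real \<Rightarrow> point set \<Rightarrow> point set" where
  "critical_set \<alpha> l X = {z. (\<exists>p\<in>target_line l. \<forall>h\<in>X. norm (z - p) \<le> \<alpha> * norm (h - p)) \<and>
    (\<forall>p\<in>target_line l. \<exists>h\<in>X. \<alpha> * norm (h - p) \<le> norm (z - p))}"

lemma norm_axis: "norm (h - (x, 0)) = sqrt (axis_dist h x)" "norm ((x, 0) - h) = sqrt (axis_dist h x)"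
  by (cases h; simp add: axis_dist_def norm_Pair power2_commute)+

lemma target_line_eq: "l > 0 \<Longrightarrow> target_line l = (\<lambda>x. (x, 0)) ` {0..l}"
proof (intro set_eqI iffI)
  fix p :: point assume l: "l > 0" and "p \<in> (\<lambda>x. (x, 0)) ` {0..l}"
  then obtain x where "p = (x, 0)" "0 \<le> x" "x \<le> l" by auto
  then show "p \<in> target_line l"
    using l unfolding target_line_def closed_segment_def by (auto intro!: exI[of _ "x / l"])
qed (auto simp: target_line_def closed_segment_def mult_left_le_one_le)

lemma critical_set_iff:
  assumes "l > 0" "0 < \<alpha>"
  shows "z \<in> critical_set \<alpha> l X \<longleftrightarrow> (\<exists>x\<in>{0..l}. \<forall>h\<in>X. margin \<alpha> z h x \<le> 0) \<and> (\<forall>x\<in>{0..l}. \<exists>h\<in>X. 0 \<le> margin \<alpha> z h x)"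
proof -
  have a: "\<alpha> * sqrt d = sqrt (\<alpha>\<^sup>2 * d)" for d using assms(2) by (simp add: real_sqrt_mult)
  show ?thesis
    unfolding critical_set_def target_line_eq[OF assms(1)] by (simp add: norm_axis a margin_def)
qed

lemma axis_dist_diff:
  "axis_dist h x - axis_dist h' x = (axis_dist h c - axis_dist h' c) - 2 * (x - c) * (fst h - fst h')"
  by (simp add: axis_dist_def power2_eq_square algebra_simps)

lemma axis_dist_inj:
  assumes "axis_dist h x = axis_dist h' x" "fst h = fst h'" "snd h \<le> 0" "snd h' \<le> 0"
  shows "h = h'"
proof -
  have "(snd h)\<^sup>2 = (snd h')\<^sup>2" using assms(1,2) by (simp add: axis_dist_def)
  then have "snd h = snd h'" using assms(3,4) unfolding power2_eq_iff by linarith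
  then show ?thesis using assms(2) by (simp add: prod_eq_iff)
qed

lemma finite_argmin:
  fixes f :: "'a \<Rightarrow> real"
  assumes "finite X" "X \<noteq> {}"
  shows "\<exists>a\<in>X. \<forall>h\<in>X. f a \<le> f h"
proof -
  have "Min (f ` X) \<in> f ` X" using assms by (intro Min_in) auto
  then obtain a where "a \<in> X" "f a = Min (f ` X)" by auto
  then show ?thesis using assms(1) by (intro bexI[of _ a]) auto
qed

lemma active_iff:
  assumes "l > 0"
  shows "h \<in> active l X \<longleftrightarrow> h \<in> X \<and> (\<exists>x\<in>{0..l}. \<forall>h'\<in>X - {h}. axis_dist h x < axis_dist h' x)"
  unfolding active_def target_line_eq[OF assms] by (simp add: dist_norm norm_axis)

text \<open>At \<open>c\<close> itself several pursuers may be nearest. Squared distances differ by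
  affine functions of the position, so among these the one extreme in direction \<open>s\<close> is
  strictly nearest just beside \<open>c\<close>, on a side where the target line continues.\<close>

lemma nearest_active:
  assumes l: "l > 0" and X: "finite X" "X \<noteq> {}" "\<And>h. h \<in> X \<Longrightarrow> snd h \<le> 0" and c: "c \<in> {0..l}"
  shows "\<exists>a\<in>active l X. \<forall>h\<in>X. axis_dist a c \<le> axis_dist h c"
proof -
  obtain s \<epsilon> :: real where s: "s = 1 \<or> s = -1" and \<epsilon>: "\<epsilon> > 0" and in_l: "\<And>\<eta>. 0 < \<eta> \<Longrightarrow> \<eta> < \<epsilon> \<Longrightarrow> c + s * \<eta> \<in> {0..l}"
  proof (cases "c < l")
    case True
    then show ?thesis using c by (intro that[of 1 "l - c"]) auto
  next
    case False
    then show ?thesis using c l by (intro that[of "-1" l]) auto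
  qed
  define M where "M = {h \<in> X. \<forall>h'\<in>X. axis_dist h c \<le> axis_dist h' c}"
  have "finite M" using X(1) by (simp add: M_def)
  moreover have "M \<noteq> {}"
    using finite_argmin[OF X(1,2), of "\<lambda>h. axis_dist h c"] by (auto simp: M_def)
  ultimately have "\<exists>a\<in>M. \<forall>h\<in>M. - (s * fst a) \<le> - (s * fst h)" by (rule finite_argmin)
  then obtain a where a: "a \<in> M" "\<And>h. h \<in> M \<Longrightarrow> - (s * fst a) \<le> - (s * fst h)" by auto
  then have aX: "a \<in> X" "\<And>h. h \<in> X \<Longrightarrow> axis_dist a c \<le> axis_dist h c" by (auto simp: M_def)
  have diff: "axis_dist a (c + s * \<eta>) - axis_dist h (c + s * \<eta>) =
      (axis_dist a c - axis_dist h c) + \<eta> * (2 * (s * fst h - s * fst a))" for h \<eta>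
    by (subst axis_dist_diff[of _ _ _ c]) (simp add: algebra_simps)
  have "\<forall>\<^sub>F \<eta> in at_right 0. axis_dist a (c + s * \<eta>) - axis_dist h (c + s * \<eta>) < 0" if h: "h \<in> X - {a}" for h
  proof (cases "h \<in> M")
    case True
    then have eq: "axis_dist a c = axis_dist h c" using aX h by (intro antisym) (auto simp: M_def)
    then have "fst h \<noteq> fst a" using axis_dist_inj[OF eq] X(3)[OF aX(1)] X(3)[of h] h by auto
    then have "s * fst h \<noteq> s * fst a" using s by auto
    then have "s * fst h - s * fst a < 0" using a(2)[OF True] by linarith
    then show ?thesis
      unfolding diff using eventually_at_right_less[of "0::real"]
      by (auto elim!: eventually_mono simp: eq mult_pos_neg)
  next
    case False
    then obtain h' where "h' \<in> X" "axis_dist h' c < axis_dist h c" using h by (auto simp: M_def not_le)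
    then have neg: "axis_dist a c - axis_dist h c < 0" using aX(2)[of h'] by linarith
    have "((\<lambda>\<eta>. (axis_dist a c - axis_dist h c) + \<eta> * (2 * (s * fst h - s * fst a))) \<longlongrightarrow>
        (axis_dist a c - axis_dist h c) + 0 * (2 * (s * fst h - s * fst a))) (at_right 0)"
      by (intro tendsto_intros)
    then show ?thesis unfolding diff using neg by (intro order_tendstoD(2)) auto
  qed
  then have "\<forall>\<^sub>F \<eta> in at_right 0. \<forall>h\<in>X - {a}. axis_dist a (c + s * \<eta>) - axis_dist h (c + s * \<eta>) < 0"
    using X(1) by (intro eventually_ball_finite) auto
  moreover have "\<forall>\<^sub>F \<eta> in at_right 0. \<eta> \<in> {0<..<\<epsilon>}" using \<epsilon> by (rule eventually_at_right_real)
  ultimately have "\<forall>\<^sub>F \<eta> in at_right 0. (\<forall>h\<in>X - {a}. axis_dist a (c + s * \<eta>) - axis_dist h (c + s * \<eta>) < 0) \<and> \<eta> \<in> {0<..<\<epsilon>}"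
    by (rule eventually_conj)
  from eventually_happens[OF this]
  obtain \<eta> where "\<forall>h\<in>X - {a}. axis_dist a (c + s * \<eta>) - axis_dist h (c + s * \<eta>) < 0" "\<eta> \<in> {0<..<\<epsilon>}" by auto
  then have "a \<in> active l X"
    unfolding active_iff[OF l] using aX(1) in_l by (intro conjI bexI[of _ "c + s * \<eta>"]) auto
  then show ?thesis using aX(2) by blast
qed

text \<open>At each point of the target line the largest margin belongs to a nearest pursuer, and
  some active pursuer is nearest there.\<close>

lemma critical_set_active:
  assumes "l > 0" "0 < \<alpha>" "finite X" "X \<noteq> {}" "\<And>h. h \<in> X \<Longrightarrow> snd h \<le> 0"
  shows "critical_set \<alpha> l X = critical_set \<alpha> l (active l X)"
proof -
  have sub: "active l X \<subseteq> X" by (auto simp: active_def)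
  have near: "\<exists>a\<in>active l X. \<forall>h\<in>X. margin \<alpha> z h x \<le> margin \<alpha> z a x" if x: "x \<in> {0..l}" for x z
  proof -
    obtain a where a: "a \<in> active l X" "\<forall>h\<in>X. axis_dist a x \<le> axis_dist h x"
      using nearest_active[OF assms(1,3-5) x] by blast
    have "margin \<alpha> z h x \<le> margin \<alpha> z a x" if "h \<in> X" for h
      using a(2) that unfolding margin_def by (simp add: mult_left_mono)
    then show ?thesis using a(1) by blast
  qed
  have 1: "(\<forall>h\<in>X. margin \<alpha> z h x \<le> 0) \<longleftrightarrow> (\<forall>h\<in>active l X. margin \<alpha> z h x \<le> 0)"
    "(\<exists>h\<in>X. 0 \<le> margin \<alpha> z h x) \<longleftrightarrow> (\<exists>h\<in>active l X. 0 \<le> margin \<alpha> z h x)" if "x \<in> {0..l}" for x z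
    using near[OF that, of z] sub by (meson order_trans subsetD)+
  then show ?thesis
    unfolding set_eq_iff critical_set_iff[OF assms(1,2)] by simp
qed

section \<open>Active pursuers in order and their cells on the target line\<close>

lemma active_abscissae:
  assumes "l > 0" "h \<in> active l X" "h' \<in> active l X" "h \<noteq> h'"
  shows "fst h \<noteq> fst h'"
proof
  assume eq: "fst h = fst h'"
  obtain x where "axis_dist h x < axis_dist h' x" using assms by (auto simp: active_iff)
  moreover obtain x' where "axis_dist h' x' < axis_dist h x'" using assms by (auto simp: active_iff)
  ultimately show False using eq by (simp add: axis_dist_def)
qed

lemma active_list_exists:
  assumes "l > 0" "finite X"
  shows "\<exists>hs. lists_increasing hs (active l X)"
proof -
  have fin: "finite (active l X)" using assms(2) by (auto simp: active_def)
  have inj: "inj_on fst (active l X)" using active_abscissae[OF assms(1)] by (intro inj_onI) blast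
  define hs where "hs = map (inv_into (active l X) fst) (sorted_list_of_set (fst ` active l X))"
  have "set hs = active l X" using fin inj by (simp add: hs_def inv_into_image_cancel image_image)
  moreover have "map fst hs = sorted_list_of_set (fst ` active l X)"
    using fin by (auto simp: hs_def comp_def f_inv_into_f intro!: map_idI)
  then have "sorted_wrt (<) (map fst hs)" by simp
  then have "sorted_wrt (\<lambda>a b. fst a < fst b) hs" by (simp add: sorted_wrt_map)
  ultimately show ?thesis by (auto simp: lists_increasing_def)
qed

text \<open>The difference of the squared distances is affine in \<open>x\<close> with positive
  slope, and \<open>c\<close> is its zero.\<close>

lemma equidist_x:
  assumes "fst h < fst h'"
  shows "axis_dist h x \<le> axis_dist h' x \<longleftrightarrow> x \<le> equidist_x h h'"
    "axis_dist h' x \<le> axis_dist h x \<longleftrightarrow> equidist_x h h' \<le> x"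
proof -
  define c where "c = ((fst h')\<^sup>2 + (snd h')\<^sup>2 - (fst h)\<^sup>2 - (snd h)\<^sup>2) / (2 * (fst h' - fst h))"
  have "2 * (fst h' - fst h) * c = (fst h')\<^sup>2 + (snd h')\<^sup>2 - (fst h)\<^sup>2 - (snd h)\<^sup>2"
    using assms by (simp add: c_def)
  then have d: "axis_dist h x - axis_dist h' x = 2 * (fst h' - fst h) * (x - c)" for x
    by (simp add: axis_dist_def power2_eq_square algebra_simps)
  have "equidist_x h h' = c"
    unfolding equidist_x_def norm_axis
  proof (rule the_equality)
    show "sqrt (axis_dist h c) = sqrt (axis_dist h' c)" using d[of c] by simp
    fix x assume "sqrt (axis_dist h x) = sqrt (axis_dist h' x)"
    then show "x = c" using d[of x] assms by simp
  qed
  then show "axis_dist h x \<le> axis_dist h' x \<longleftrightarrow> x \<le> equidist_x h h'"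
    "axis_dist h' x \<le> axis_dist h x \<longleftrightarrow> equidist_x h h' \<le> x"
    using d[of x] assms by (smt (verit) mult_pos_pos mult_nonneg_nonpos zero_le_mult_iff)+
qed

text \<open>Lower end of the part of the target line where \<open>hs ! i\<close> is nearest, counted
  from 0. Only neighbours enter; \<open>cell_nearest\<close> shows that this suffices for active
  pursuers.\<close>

definition cell_lo :: "point list \<Rightarrow> nat \<Rightarrow> real" where
  "cell_lo hs i = (if i = 0 then 0 else equidist_x (hs ! (i - 1)) (hs ! i))"

definition cell_hi :: "real \<Rightarrow> point list \<Rightarrow> nat \<Rightarrow> real" where
  "cell_hi l hs i = (if Suc i = length hs then l else equidist_x (hs ! i) (hs ! Suc i))"

definition cell_arc :: "real \<Rightarrow> real \<Rightarrow> point list \<Rightarrow> nat \<Rightarrow> point set" where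
  "cell_arc \<alpha> l hs i = hyp_arc \<alpha> (hs ! i)
     ((1 - \<alpha>\<^sup>2) * cell_lo hs i + \<alpha>\<^sup>2 * fst (hs ! i)) ((1 - \<alpha>\<^sup>2) * cell_hi l hs i + \<alpha>\<^sup>2 * fst (hs ! i))"

text \<open>Brings the cases of \<open>Phi\<close> into one form, so that nothing later depends on
  the number of pursuers.\<close>

lemma Phi_eq:
  assumes "hs \<noteq> []"
  shows "Phi \<alpha> l hs = F1_1 \<alpha> (hs ! 0) \<union> (\<Union>i<length hs. cell_arc \<alpha> l hs i) \<union>
    (\<Union>i<length hs - 1. F2_3 \<alpha> (hs ! i) (hs ! Suc i)) \<union> F1_3 \<alpha> l (hs ! (length hs - 1))"
proof -
  consider "length hs = 1" | "length hs = 2" | "length hs \<ge> 3" using assms by (cases "length hs") force+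
  then show ?thesis
  proof cases
    case 1
    then show ?thesis by (simp add: Phi_def F1_2_def cell_arc_def cell_lo_def cell_hi_def lessThan_Suc)
  next
    case 2
    then have "{..<length hs} = {0, 1}" "{..<length hs - 1} = {0}" by auto
    then show ?thesis using 2
      by (simp add: Phi_def F2_2_def F2_4_def cell_arc_def cell_lo_def cell_hi_def) blast
  next
    case 3
    define n where "n = length hs"
    have n: "n \<ge> 3" using 3 by (simp add: n_def)
    have A: "(\<Union>i\<in>{1..n - 1}. F2_3 \<alpha> (hs ! (i - 1)) (hs ! (i + 1 - 1))) = (\<Union>i<n - 1. F2_3 \<alpha> (hs ! i) (hs ! Suc i))"
    proof -
      have "{1..n - 1} = Suc ` {..<n - 1}" by (simp add: image_Suc_lessThan)
      then show ?thesis by simp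
    qed
    have B: "(\<Union>i\<in>{2..n - 1}. F3 \<alpha> (hs ! (i - 1 - 1)) (hs ! (i - 1)) (hs ! (i + 1 - 1))) = (\<Union>i\<in>{1..<n - 1}. cell_arc \<alpha> l hs i)"
    proof -
      have I: "{2..n - 1} = Suc ` {1..<n - 1}" using n by (auto simp: image_Suc_atLeastLessThan)
      have F: "F3 \<alpha> (hs ! (Suc i - 1 - 1)) (hs ! (Suc i - 1)) (hs ! (Suc i + 1 - 1)) = cell_arc \<alpha> l hs i"
        if "i \<in> {1..<n - 1}" for i
        using that by (auto simp: F3_def cell_arc_def cell_lo_def cell_hi_def n_def)
      show ?thesis unfolding I image_image using F by (intro SUP_cong) auto
    qed
    have C: "(\<Union>i<n. cell_arc \<alpha> l hs i) = cell_arc \<alpha> l hs 0 \<union> (\<Union>i\<in>{1..<n - 1}. cell_arc \<alpha> l hs i) \<union> cell_arc \<alpha> l hs (n - 1)"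
    proof -
      have "{..<n} = insert 0 (insert (n - 1) {1..<n - 1})" using n by auto
      then show ?thesis by auto
    qed
    have D: "cell_arc \<alpha> l hs 0 = F2_2 \<alpha> (hs ! 0) (hs ! 1)" "cell_arc \<alpha> l hs (n - 1) = F2_4 \<alpha> l (hs ! (n - 2)) (hs ! (n - 1))"
      using n by (auto simp: F2_2_def F2_4_def cell_arc_def cell_lo_def cell_hi_def n_def numeral_2_eq_2)
    have P: "Phi \<alpha> l hs = F1_1 \<alpha> (hs ! 0) \<union> F2_2 \<alpha> (hs ! 0) (hs ! 1)
          \<union> (\<Union>i\<in>{1..n - 1}. F2_3 \<alpha> (hs ! (i - 1)) (hs ! (i + 1 - 1)))
          \<union> (\<Union>i\<in>{2..n - 1}. F3 \<alpha> (hs ! (i - 1 - 1)) (hs ! (i - 1)) (hs ! (i + 1 - 1)))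
          \<union> F2_4 \<alpha> l (hs ! (n - 2)) (hs ! (n - 1)) \<union> F1_3 \<alpha> l (hs ! (n - 1))"
      using n unfolding Phi_def Let_def n_def[symmetric] by (simp add: numeral_2_eq_2)
    show ?thesis unfolding P A B n_def[symmetric] C D by blast
  qed
qed


text \<open>Taylor expansion at \<open>c\<close>. Half the slope there is
  \<open>(1 - \<alpha>\<^sup>2) * c + \<alpha>\<^sup>2 * fst h\<close> minus the abscissa of
  \<open>z\<close>; this is the origin of the interval bounds of the curves.\<close>

lemma margin_shift:
  "margin \<alpha> z h x = margin \<alpha> z h c + (1 - \<alpha>\<^sup>2) * (x - c)\<^sup>2 + 2 * (x - c) * ((1 - \<alpha>\<^sup>2) * c + \<alpha>\<^sup>2 * fst h - fst z)"
  by (simp add: margin_def axis_dist_def power2_eq_square algebra_simps)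

text \<open>A nonnegative function that vanishes at \<open>c\<close> cannot increase into
  \<open>c\<close> from the left.\<close>

lemma margin_left_slope:
  assumes "\<And>x. x \<in> {a..b} \<Longrightarrow> 0 \<le> margin \<alpha> z h x" "margin \<alpha> z h c = 0" "a < c" "c \<le> b"
  shows "(1 - \<alpha>\<^sup>2) * c + \<alpha>\<^sup>2 * fst h \<le> fst z"
proof (rule ccontr)
  define d where "d = (1 - \<alpha>\<^sup>2) * c + \<alpha>\<^sup>2 * fst h - fst z"
  assume "\<not> ?thesis"
  then have d: "d > 0" by (simp add: d_def)
  have "((\<lambda>\<eta>. (1 - \<alpha>\<^sup>2) * \<eta> - 2 * d) \<longlongrightarrow> (1 - \<alpha>\<^sup>2) * 0 - 2 * d) (at_right 0)" by (intro tendsto_intros)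
  then have "\<forall>\<^sub>F \<eta> in at_right 0. (1 - \<alpha>\<^sup>2) * \<eta> - 2 * d < 0" using d by (intro order_tendstoD(2)) auto
  moreover have "\<forall>\<^sub>F \<eta> in at_right 0. \<eta> \<in> {0<..<c - a}" using assms(3) by (intro eventually_at_right_real) simp
  ultimately have "\<forall>\<^sub>F \<eta> in at_right 0. (1 - \<alpha>\<^sup>2) * \<eta> - 2 * d < 0 \<and> \<eta> \<in> {0<..<c - a}" by (rule eventually_conj)
  from eventually_happens[OF this]
  obtain \<eta> where \<eta>: "(1 - \<alpha>\<^sup>2) * \<eta> - 2 * d < 0" "0 < \<eta>" "\<eta> < c - a" by auto
  have "margin \<alpha> z h (c - \<eta>) = \<eta> * ((1 - \<alpha>\<^sup>2) * \<eta> - 2 * d)"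
    using margin_shift[of \<alpha> z h "c - \<eta>" c] assms(2) by (simp add: d_def power2_eq_square algebra_simps)
  then have "margin \<alpha> z h (c - \<eta>) < 0" using \<eta> by (simp add: mult_pos_neg)
  then show False using assms(1)[of "c - \<eta>"] \<eta> assms(4) by simp
qed

text \<open>Reflection in the y-axis turns the slope condition from the left into the one from the
  right.\<close>

lemma margin_reflect: "margin \<alpha> z h x = margin \<alpha> (- fst z, snd z) (- fst h, snd h) (- x)"
  by (simp add: margin_def axis_dist_def power2_eq_square algebra_simps)

lemma margin_right_slope:
  assumes "\<And>x. x \<in> {a..b} \<Longrightarrow> 0 \<le> margin \<alpha> z h x" "margin \<alpha> z h c = 0" "a \<le> c" "c < b"
  shows "fst z \<le> (1 - \<alpha>\<^sup>2) * c + \<alpha>\<^sup>2 * fst h"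
proof -
  have "(1 - \<alpha>\<^sup>2) * (- c) + \<alpha>\<^sup>2 * fst (- fst h, snd h) \<le> fst (- fst z, snd z)"
  proof (rule margin_left_slope)
    show "0 \<le> margin \<alpha> (- fst z, snd z) (- fst h, snd h) x" if "x \<in> {-b..-a}" for x
      using assms(1)[of "- x"] margin_reflect[of \<alpha> z h "- x"] that by simp
  qed (use assms margin_reflect[of \<alpha> z h c] in auto)
  then show ?thesis by simp
qed

lemma margin_nonneg_side:
  assumes "0 < \<alpha>" "\<alpha> < 1" "margin \<alpha> z h c = 0" "0 \<le> (x - c) * ((1 - \<alpha>\<^sup>2) * c + \<alpha>\<^sup>2 * fst h - fst z)"
  shows "0 \<le> margin \<alpha> z h x"
proof -
  have "0 \<le> (1 - \<alpha>\<^sup>2) * (x - c)\<^sup>2" using assms(1,2) by (simp add: power_le_one)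
  then show ?thesis
    unfolding margin_shift[of \<alpha> z h x c] assms(3) mult.assoc using assms(4) by linarith
qed

text \<open>The hyperbola results from eliminating \<open>c\<close> between a vanishing slope and a
  vanishing margin at \<open>c\<close>: the left side of its equation is that margin times
  \<open>- (1 - \<alpha>\<^sup>2) / \<alpha>\<^sup>2\<close>.\<close>

lemma hyp_arc_iff:
  assumes "0 < \<alpha>" "\<alpha> < 1"
  shows "z \<in> hyp_arc \<alpha> h ((1 - \<alpha>\<^sup>2) * a + \<alpha>\<^sup>2 * fst h) ((1 - \<alpha>\<^sup>2) * b + \<alpha>\<^sup>2 * fst h) \<longleftrightarrow>
    snd z < 0 \<and> (\<exists>c. a < c \<and> c < b \<and> margin \<alpha> z h c = 0 \<and> (1 - \<alpha>\<^sup>2) * c + \<alpha>\<^sup>2 * fst h = fst z)"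
proof -
  define \<beta> where "\<beta> = 1 - \<alpha>\<^sup>2"
  have \<beta>: "\<beta> > 0" using assms by (simp add: \<beta>_def power_less_one_iff)
  define c where "c = (fst z - \<alpha>\<^sup>2 * fst h) / \<beta>"
  have c: "\<beta> * c + \<alpha>\<^sup>2 * fst h = fst z" using \<beta> by (simp add: c_def)
  have uniq: "\<beta> * c' + \<alpha>\<^sup>2 * fst h = fst z \<longleftrightarrow> c' = c" for c' using \<beta> by (auto simp: c_def field_simps)
  have zx: "fst z = \<beta> * c + \<alpha>\<^sup>2 * fst h" using c by simp
  have "margin \<alpha> z h c = (\<beta> * c + \<alpha>\<^sup>2 * fst h - c)\<^sup>2 + (snd z)\<^sup>2 - \<alpha>\<^sup>2 * ((c - fst h)\<^sup>2 + (snd h)\<^sup>2)"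
    unfolding margin_def axis_dist_def zx by (simp add: power2_commute)
  also have "\<dots> = (snd z)\<^sup>2 - \<alpha>\<^sup>2 * \<beta> * (c - fst h)\<^sup>2 - \<alpha>\<^sup>2 * (snd h)\<^sup>2"
    unfolding \<beta>_def by (simp add: power2_eq_square algebra_simps)
  finally have m: "margin \<alpha> z h c = (snd z)\<^sup>2 - \<alpha>\<^sup>2 * \<beta> * (c - fst h)\<^sup>2 - \<alpha>\<^sup>2 * (snd h)\<^sup>2" .
  have f: "fst z - fst h = \<beta> * (c - fst h)" unfolding zx \<beta>_def by (simp add: algebra_simps)
  have b: "1 - 1 / \<alpha>\<^sup>2 = - (\<beta> / \<alpha>\<^sup>2)" using assms by (simp add: \<beta>_def field_simps)
  have "(fst z - fst h)\<^sup>2 + (1 - 1 / \<alpha>\<^sup>2) * (snd z)\<^sup>2 + (1 - \<alpha>\<^sup>2) * (snd h)\<^sup>2 =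
      \<beta>\<^sup>2 * (c - fst h)\<^sup>2 - \<beta> / \<alpha>\<^sup>2 * (snd z)\<^sup>2 + \<beta> * (snd h)\<^sup>2"
    unfolding f b power_mult_distrib \<beta>_def[symmetric] by simp
  also have "\<dots> = - (\<beta> / \<alpha>\<^sup>2) * margin \<alpha> z h c"
    unfolding m using assms by (simp add: field_simps power2_eq_square)
  finally have e: "(fst z - fst h)\<^sup>2 + (1 - 1 / \<alpha>\<^sup>2) * (snd z)\<^sup>2 + (1 - \<alpha>\<^sup>2) * (snd h)\<^sup>2 = 0 \<longleftrightarrow> margin \<alpha> z h c = 0"
    using assms \<beta> by simp
  have "\<beta> * a + \<alpha>\<^sup>2 * fst h < fst z \<longleftrightarrow> a < c" "fst z < \<beta> * b + \<alpha>\<^sup>2 * fst h \<longleftrightarrow> c < b"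
    unfolding zx using \<beta> by auto
  then show ?thesis
    unfolding hyp_arc_def \<beta>_def[symmetric] uniq using e by (cases z) (auto simp: \<beta>_def[symmetric])
qed

lemma norm_eq_margin:
  assumes "0 < \<alpha>"
  shows "norm (z - (x, 0)) = \<alpha> * norm (h - (x, 0)) \<longleftrightarrow> margin \<alpha> z h x = 0"
proof -
  have "\<alpha> * sqrt d = sqrt (\<alpha>\<^sup>2 * d)" for d using assms by (simp add: real_sqrt_mult)
  then show ?thesis by (simp add: norm_axis margin_def)
qed

section \<open>Matching the critical positions with the curves\<close>

locale ordered_coalition =
  fixes l \<alpha> :: real and hs :: "point list"
  assumes l: "l > 0" and \<alpha>: "0 < \<alpha>" "\<alpha> < 1" and nonempty: "hs \<noteq> []"
    and increasing: "\<And>i j. i < j \<Longrightarrow> j < length hs \<Longrightarrow> fst (hs ! i) < fst (hs ! j)"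
    and all_active: "\<And>i. i < length hs \<Longrightarrow> \<exists>x\<in>{0..l}. \<forall>j<length hs. j \<noteq> i \<longrightarrow> axis_dist (hs ! i) x < axis_dist (hs ! j) x"
begin

abbreviation "n \<equiv> length hs"
abbreviation "h i \<equiv> hs ! i"
abbreviation "lo i \<equiv> cell_lo hs i"
abbreviation "hi i \<equiv> cell_hi l hs i"

lemma witnesses:
  obtains a where "\<And>i. i < n \<Longrightarrow> a i \<in> {0..l}" "\<And>i j. i < n \<Longrightarrow> j < n \<Longrightarrow> j \<noteq> i \<Longrightarrow> axis_dist (h i) (a i) < axis_dist (h j) (a i)"
proof -
  have "\<forall>i\<in>{..<n}. \<exists>x. x \<in> {0..l} \<and> (\<forall>j<n. j \<noteq> i \<longrightarrow> axis_dist (h i) x < axis_dist (h j) x)"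
    using all_active by blast
  then obtain a where "\<forall>i\<in>{..<n}. a i \<in> {0..l} \<and> (\<forall>j<n. j \<noteq> i \<longrightarrow> axis_dist (h i) (a i) < axis_dist (h j) (a i))"
    by (rule bchoice[elim_format]) blast
  then show ?thesis using that[of a] by auto
qed

lemma hi_eq_lo: "Suc i < n \<Longrightarrow> hi i = lo (Suc i)"
  by (simp add: cell_hi_def cell_lo_def)

lemma next_closer:
  assumes "Suc i < n"
  shows "axis_dist (h i) x \<le> axis_dist (h (Suc i)) x \<longleftrightarrow> x \<le> hi i"
    "axis_dist (h (Suc i)) x \<le> axis_dist (h i) x \<longleftrightarrow> hi i \<le> x"
  using equidist_x[OF increasing[of i "Suc i"], of x] assms by (auto simp: cell_hi_def)

text \<open>The points where consecutive pursuers are strictly nearest interlace with the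
  equidistant points, which puts the latter in order and inside the target line.\<close>

lemma cell_bounds: 
  assumes "i < n"
  shows "0 \<le> lo i" "lo i < hi i" "hi i \<le> l"
proof -
  obtain a where a: "\<And>i. i < n \<Longrightarrow> a i \<in> {0..l}" "\<And>i j. i < n \<Longrightarrow> j < n \<Longrightarrow> j \<noteq> i \<Longrightarrow> axis_dist (h i) (a i) < axis_dist (h j) (a i)"
    using witnesses by blast
  have b: "a j < hi j \<and> hi j < a (Suc j)" if "Suc j < n" for j
    using next_closer[OF that, of "a j"] next_closer[OF that, of "a (Suc j)"] a(2)[of j "Suc j"] a(2)[of "Suc j" j] that
    by fastforce
  have c: "i \<noteq> 0 \<Longrightarrow> lo i < a i \<and> 0 < lo i"
    using b[of "i - 1"] a(1)[of "i - 1"] hi_eq_lo[of "i - 1"] assms by fastforce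
  have d: "Suc i \<noteq> n \<Longrightarrow> a i < hi i \<and> hi i < l"
    using b[of i] a(1)[of "Suc i"] assms by fastforce
  have e: "i = 0 \<Longrightarrow> lo i = 0" "Suc i = n \<Longrightarrow> hi i = l" by (simp_all add: cell_lo_def cell_hi_def)
  show "0 \<le> lo i" using c e by fastforce
  show "hi i \<le> l" using d e by fastforce
  show "lo i < hi i" using c d e a(1)[OF assms] l by (cases "i = 0"; cases "Suc i = n") auto
qed

lemma hi_mono: "i \<le> j \<Longrightarrow> j < n \<Longrightarrow> hi i \<le> hi j"
proof (induction j rule: dec_induct)
  case (step j)
  then show ?case using cell_bounds(2)[of "Suc j"] hi_eq_lo[of j] by simp
qed simp

lemma lo_mono: "i \<le> j \<Longrightarrow> j < n \<Longrightarrow> lo i \<le> lo j"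
proof (induction j rule: dec_induct)
  case (step j)
  then show ?case using cell_bounds(2)[of j] hi_eq_lo[of j] by simp
qed simp

text \<open>Going from neighbour to neighbour, \<open>x\<close> is always on the near side of the
  equidistant point, because these points are ordered.\<close>

lemma cell_nearest:
  assumes i: "i < n" and j: "j < n" and x: "lo i \<le> x" "x \<le> hi i"
  shows "axis_dist (h i) x \<le> axis_dist (h j) x"
proof (cases "i \<le> j")
  case True
  then show ?thesis using j
  proof (induction j rule: dec_induct)
    case (step k)
    have "x \<le> hi k" using hi_mono[of i k] step x by simp
    then show ?case using next_closer(1)[of k x] step by simp
  qed simp
next
  case False
  then have "j \<le> i" by simp
  then show ?thesis
  proof (induction j rule: inc_induct)
    case (step k)
    have "hi k \<le> x" using lo_mono[of "Suc k" i] hi_eq_lo[of k] step x i by simp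
    then show ?case using next_closer(2)[of k x] step i by simp
  qed simp
qed

lemma cell_cover:
  assumes "x \<in> {0..l}"
  obtains i where "i < n" "lo i \<le> x" "x \<le> hi i"
proof -
  have last: "x \<le> hi (n - 1)" using assms nonempty by (simp add: cell_hi_def)
  define i where "i = (LEAST i. x \<le> hi i)"
  have i: "x \<le> hi i" "i \<le> n - 1" unfolding i_def using last by (auto intro: LeastI Least_le)
  then have "i < n" using nonempty by (simp add: Suc_le_eq less_Suc_eq_le le_less_trans)
  moreover have "lo i \<le> x"
  proof (cases i)
    case 0
    then show ?thesis using assms by (simp add: cell_lo_def)
  next
    case (Suc k)
    then have "\<not> x \<le> hi k" using not_less_Least[of k "\<lambda>i. x \<le> hi i"] by (simp add: i_def)
    then show ?thesis using hi_eq_lo[of k] Suc \<open>i < n\<close> by simp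
  qed
  ultimately show ?thesis using that i(1) by blast
qed

lemma cell_margin:
  assumes "i < n" "j < n" "lo i \<le> x" "x \<le> hi i"
  shows "margin \<alpha> z (h j) x \<le> margin \<alpha> z (h i) x"
  using cell_nearest[OF assms] by (simp add: margin_def mult_left_mono)

lemma in_set_iff: "(\<forall>a\<in>set hs. P a) \<longleftrightarrow> (\<forall>i<n. P (h i))" "(\<exists>a\<in>set hs. P a) \<longleftrightarrow> (\<exists>i<n. P (h i))"
  by (metis in_set_conv_nth)+

text \<open>The pursuers for the two sides of \<open>c\<close> may differ, as at a border of two
  cells. By convexity a zero at \<open>c\<close> with the right slope keeps a margin nonnegative on
  the whole side; at an end of the line one side is void.\<close>

lemma critical_setI:
  assumes "i < n" "lo i \<le> c" "c \<le> hi i" "margin \<alpha> z (h i) c = 0"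
    and "c = 0 \<or> (\<exists>j<n. margin \<alpha> z (h j) c = 0 \<and> (1 - \<alpha>\<^sup>2) * c + \<alpha>\<^sup>2 * fst (h j) \<le> fst z)"
    and "c = l \<or> (\<exists>j<n. margin \<alpha> z (h j) c = 0 \<and> fst z \<le> (1 - \<alpha>\<^sup>2) * c + \<alpha>\<^sup>2 * fst (h j))"
  shows "z \<in> critical_set \<alpha> l (set hs)"
  unfolding critical_set_iff[OF l \<alpha>(1)] in_set_iff
proof (intro conjI ballI)
  have "c \<in> {0..l}" using assms(1-3) cell_bounds[OF assms(1)] by auto
  moreover have "\<forall>j<n. margin \<alpha> z (h j) c \<le> 0"
    using cell_margin[OF assms(1) _ assms(2,3), of _ z] unfolding assms(4) by blast
  ultimately show "\<exists>x\<in>{0..l}. \<forall>j<n. margin \<alpha> z (h j) x \<le> 0" by blast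
next
  fix x assume x: "x \<in> {0..l}"
  consider "x = c" | "x < c" | "c < x" by linarith
  then show "\<exists>j<n. 0 \<le> margin \<alpha> z (h j) x"
  proof cases
    case 1
    then show ?thesis using assms(1,4) by auto
  next
    case 2
    then obtain j where j: "j < n" "margin \<alpha> z (h j) c = 0" "(1 - \<alpha>\<^sup>2) * c + \<alpha>\<^sup>2 * fst (h j) \<le> fst z"
      using assms(5) x by auto
    have "0 \<le> margin \<alpha> z (h j) x"
      by (rule margin_nonneg_side[OF \<alpha> j(2)]) (use 2 j(3) in \<open>auto intro: mult_nonpos_nonpos\<close>)
    then show ?thesis using j(1) by blast
  next
    case 3
    then obtain j where j: "j < n" "margin \<alpha> z (h j) c = 0" "fst z \<le> (1 - \<alpha>\<^sup>2) * c + \<alpha>\<^sup>2 * fst (h j)"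
      using assms(6) x by auto
    have "0 \<le> margin \<alpha> z (h j) x"
      by (rule margin_nonneg_side[OF \<alpha> j(2)]) (use 3 j(3) in auto)
    then show ?thesis using j(1) by blast
  qed
qed

lemma F1_1_iff: "z \<in> F1_1 \<alpha> (h 0) \<longleftrightarrow> snd z < 0 \<and> margin \<alpha> z (h 0) 0 = 0 \<and> fst z \<le> \<alpha>\<^sup>2 * fst (h 0)"
  unfolding F1_1_def mem_Collect_eq norm_eq_margin[OF \<alpha>(1)] by auto

lemma F1_3_iff: "z \<in> F1_3 \<alpha> l (h (n - 1)) \<longleftrightarrow>
    snd z < 0 \<and> margin \<alpha> z (h (n - 1)) l = 0 \<and> (1 - \<alpha>\<^sup>2) * l + \<alpha>\<^sup>2 * fst (h (n - 1)) \<le> fst z"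
  unfolding F1_3_def mem_Collect_eq norm_eq_margin[OF \<alpha>(1)] by auto

lemma F2_3_iff:
  assumes "Suc i < n"
  shows "z \<in> F2_3 \<alpha> (h i) (h (Suc i)) \<longleftrightarrow> snd z < 0 \<and> margin \<alpha> z (h i) (hi i) = 0 \<and>
    (1 - \<alpha>\<^sup>2) * hi i + \<alpha>\<^sup>2 * fst (h i) \<le> fst z \<and> fst z \<le> (1 - \<alpha>\<^sup>2) * hi i + \<alpha>\<^sup>2 * fst (h (Suc i))"
proof -
  have "equidist_x (h i) (h (Suc i)) = hi i" using assms by (simp add: cell_hi_def)
  then show ?thesis unfolding F2_3_def Let_def mem_Collect_eq norm_eq_margin[OF \<alpha>(1)] by auto
qed

lemma margin_at_hi:
  assumes "Suc i < n"
  shows "margin \<alpha> z (h (Suc i)) (hi i) = margin \<alpha> z (h i) (hi i)"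
  using next_closer[OF assms, of "hi i"] by (simp add: margin_def)

lemma Phi_iff:
  "z \<in> Phi \<alpha> l hs \<longleftrightarrow> z \<in> F1_1 \<alpha> (h 0) \<or> (\<exists>i<n. z \<in> cell_arc \<alpha> l hs i) \<or>
    (\<exists>i. Suc i < n \<and> z \<in> F2_3 \<alpha> (h i) (h (Suc i))) \<or> z \<in> F1_3 \<alpha> l (h (n - 1))"
proof -
  have "i < n - 1 \<longleftrightarrow> Suc i < n" for i by auto
  then show ?thesis unfolding Phi_eq[OF nonempty] by auto
qed

lemma cell_arc_iff: "z \<in> cell_arc \<alpha> l hs i \<longleftrightarrow> snd z < 0 \<and>
    (\<exists>c. lo i < c \<and> c < hi i \<and> margin \<alpha> z (h i) c = 0 \<and> (1 - \<alpha>\<^sup>2) * c + \<alpha>\<^sup>2 * fst (h i) = fst z)"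
  unfolding cell_arc_def by (rule hyp_arc_iff[OF \<alpha>])

lemma Phi_critical:
  assumes "z \<in> Phi \<alpha> l hs"
  shows "z \<in> critical_set \<alpha> l (set hs)"
proof -
  have n0: "0 < n" "n - 1 < n" "Suc (n - 1) = n" using nonempty by auto
  have lo0: "lo 0 = 0" "hi (n - 1) = l" using n0 by (simp_all add: cell_lo_def cell_hi_def)
  consider "z \<in> F1_1 \<alpha> (h 0)" | i where "i < n" "z \<in> cell_arc \<alpha> l hs i"
    | i where "Suc i < n" "z \<in> F2_3 \<alpha> (h i) (h (Suc i))" | "z \<in> F1_3 \<alpha> l (h (n - 1))"
    using assms unfolding Phi_iff by blast
  then show ?thesis
  proof cases
    case 1
    then show ?thesis using cell_bounds[OF n0(1)] lo0 n0(1)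
      by (intro critical_setI[of 0 0]) (auto simp: F1_1_iff)
  next
    case (2 i)
    then obtain c where "lo i < c" "c < hi i" "margin \<alpha> z (h i) c = 0" "(1 - \<alpha>\<^sup>2) * c + \<alpha>\<^sup>2 * fst (h i) = fst z"
      unfolding cell_arc_iff by blast
    then show ?thesis using 2(1) by (intro critical_setI[of i c] disjI2 exI[of _ i]) auto
  next
    case (3 i)
    then have i: "i < n" by simp
    have m: "margin \<alpha> z (h i) (hi i) = 0" "margin \<alpha> z (h (Suc i)) (hi i) = 0"
      "(1 - \<alpha>\<^sup>2) * hi i + \<alpha>\<^sup>2 * fst (h i) \<le> fst z" "fst z \<le> (1 - \<alpha>\<^sup>2) * hi i + \<alpha>\<^sup>2 * fst (h (Suc i))"
      using 3(2) margin_at_hi[OF 3(1), of z] unfolding F2_3_iff[OF 3(1)] by simp_all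
    show ?thesis
      using m i 3(1) cell_bounds(2)[OF i]
      by (intro critical_setI[of i "hi i"] disjI2 exI[of _ i] exI[of _ "Suc i"]) auto
  next
    case 4
    then have "margin \<alpha> z (h (n - 1)) l = 0" "(1 - \<alpha>\<^sup>2) * l + \<alpha>\<^sup>2 * fst (h (n - 1)) \<le> fst z"
      unfolding F1_3_iff by simp_all
    then show ?thesis using cell_bounds[OF n0(2)] lo0 n0(2)
      by (intro critical_setI[of "n - 1" l]) auto
  qed
qed

lemma critical_Phi:
  assumes "z \<in> critical_set \<alpha> l (set hs)" and z: "snd z < 0"
  shows "z \<in> Phi \<alpha> l hs"
proof -
  obtain c where c: "c \<in> {0..l}" "\<And>j. j < n \<Longrightarrow> margin \<alpha> z (h j) c \<le> 0"
    and ge: "\<And>x. x \<in> {0..l} \<Longrightarrow> \<exists>j<n. 0 \<le> margin \<alpha> z (h j) x"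
    using assms(1) unfolding critical_set_iff[OF l \<alpha>(1)] in_set_iff by blast
  \<comment> \<open>On its own cell a pursuer has the largest margin, so there the guard condition
    concerns it alone.\<close>
  have nn: "0 \<le> margin \<alpha> z (h i) x" if "i < n" "x \<in> {lo i..hi i}" for i x
  proof -
    have "x \<in> {0..l}" using that cell_bounds[OF that(1)] by auto
    then obtain j where "j < n" "0 \<le> margin \<alpha> z (h j) x" using ge by blast
    then show ?thesis using cell_margin[of i j x z] that by auto
  qed
  obtain i where i: "i < n" "lo i \<le> c" "c \<le> hi i" using cell_cover[OF c(1)] .
  have m0: "margin \<alpha> z (h i) c = 0" using nn[of i c] c(2)[OF i(1)] i by auto
  \<comment> \<open>Each of the two adjacent cells yields the slope condition from its own
    side.\<close>
  have at_border: "z \<in> F2_3 \<alpha> (h k) (h (Suc k))" if k: "Suc k < n" and ck: "c = hi k"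
    and mk: "margin \<alpha> z (h k) c = 0" for k
  proof -
    have mk': "margin \<alpha> z (h (Suc k)) c = 0" using margin_at_hi[OF k] mk ck by simp
    have "(1 - \<alpha>\<^sup>2) * c + \<alpha>\<^sup>2 * fst (h k) \<le> fst z"
      by (rule margin_left_slope[OF nn[of k] mk]) (use k ck cell_bounds(2)[of k] in auto)
    moreover have "fst z \<le> (1 - \<alpha>\<^sup>2) * c + \<alpha>\<^sup>2 * fst (h (Suc k))"
      by (rule margin_right_slope[OF nn[of "Suc k"] mk']) (use k ck hi_eq_lo[OF k] cell_bounds(2)[of "Suc k"] in auto)
    ultimately show ?thesis unfolding F2_3_iff[OF k] using z mk ck by simp
  qed
  consider "c = lo i" | "c = hi i" | "lo i < c" "c < hi i" using i by linarith
  then show ?thesis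
  proof cases
    case 1
    show ?thesis
    proof (cases i)
      case 0
      have "fst z \<le> (1 - \<alpha>\<^sup>2) * c + \<alpha>\<^sup>2 * fst (h i)"
        by (rule margin_right_slope[OF nn[OF i(1)] m0]) (use 1 cell_bounds(2)[OF i(1)] in auto)
      then show ?thesis unfolding Phi_iff F1_1_iff using 0 1 z m0 by (simp add: cell_lo_def)
    next
      case (Suc k)
      have "Suc k < n" "c = hi k" using Suc i(1) 1 hi_eq_lo[of k] by auto
      moreover have "margin \<alpha> z (h k) c = 0" using margin_at_hi[of k z] m0 calculation Suc by simp
      ultimately show ?thesis unfolding Phi_iff using at_border by blast
    qed
  next
    case 2
    show ?thesis
    proof (cases "Suc i = n")
      case True
      have "(1 - \<alpha>\<^sup>2) * c + \<alpha>\<^sup>2 * fst (h i) \<le> fst z"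
        by (rule margin_left_slope[OF nn[OF i(1)] m0]) (use 2 cell_bounds(2)[OF i(1)] in auto)
      moreover have "c = l" "n - 1 = i" using True 2 by (auto simp: cell_hi_def)
      ultimately show ?thesis unfolding Phi_iff F1_3_iff using z m0 by simp
    next
      case False
      then show ?thesis unfolding Phi_iff using at_border[of i] i(1) 2 m0 by auto
    qed
  next
    case 3
    have "(1 - \<alpha>\<^sup>2) * c + \<alpha>\<^sup>2 * fst (h i) \<le> fst z"
      by (rule margin_left_slope[OF nn[OF i(1)] m0]) (use 3 in auto)
    moreover have "fst z \<le> (1 - \<alpha>\<^sup>2) * c + \<alpha>\<^sup>2 * fst (h i)"
      by (rule margin_right_slope[OF nn[OF i(1)] m0]) (use 3 in auto)
    ultimately have "z \<in> cell_arc \<alpha> l hs i" unfolding cell_arc_iff using z 3 m0 by auto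
    then show ?thesis unfolding Phi_iff using i(1) by blast
  qed
qed

end

lemma critical_set_Phi:
  assumes l: "l > 0" and \<alpha>: "0 < \<alpha>" "\<alpha> < 1" and X: "finite X" "X \<noteq> {}" "\<And>h. h \<in> X \<Longrightarrow> snd h \<le> 0"
    and hs: "lists_increasing hs (active l X)" and z: "snd z < 0"
  shows "z \<in> critical_set \<alpha> l X \<longleftrightarrow> z \<in> Phi \<alpha> l hs"
proof -
  have set: "set hs = active l X" and sorted: "sorted_wrt (\<lambda>a b. fst a < fst b) hs"
    using hs by (auto simp: lists_increasing_def)
  have inc: "fst (hs ! i) < fst (hs ! j)" if "i < j" "j < length hs" for i j
    using sorted_wrt_nth_less[OF sorted that] .
  have "ordered_coalition l \<alpha> hs"
  proof
    show "hs \<noteq> []" using nearest_active[OF l X, of 0] l set by auto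
    fix i assume i: "i < length hs"
    then have "hs ! i \<in> active l X" using set nth_mem by blast
    then obtain x where x: "x \<in> {0..l}" "\<And>h'. h' \<in> X - {hs ! i} \<Longrightarrow> axis_dist (hs ! i) x < axis_dist h' x"
      unfolding active_iff[OF l] by blast
    have "axis_dist (hs ! i) x < axis_dist (hs ! j) x" if j: "j < length hs" "j \<noteq> i" for j
    proof (rule x(2))
      have "hs ! j \<in> X" using set nth_mem[OF j(1)] by (auto simp: active_def)
      moreover have "hs ! j \<noteq> hs ! i" using inc[of i j] inc[of j i] i j by (cases "i < j") auto
      ultimately show "hs ! j \<in> X - {hs ! i}" by simp
    qed
    then show "\<exists>x\<in>{0..l}. \<forall>j<length hs. j \<noteq> i \<longrightarrow> axis_dist (hs ! i) x < axis_dist (hs ! j) x"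
      using x(1) by blast
  qed (use l \<alpha> inc in auto)
  then interpret ordered_coalition l \<alpha> hs .
  have eq: "critical_set \<alpha> l X = critical_set \<alpha> l (set hs)" using critical_set_active[OF l \<alpha>(1) X] set by simp
  show ?thesis unfolding eq using Phi_critical[of z] critical_Phi[OF _ z] by blast
qed


section \<open>The two games and the theorem\<close>

lemma crosses_target_line:
  assumes \<Omega>: "{z \<in> \<Omega>. snd z = 0} = target_line l"
    and e: "continuous_on {0..t} e" "\<And>s. s \<in> {0..t} \<Longrightarrow> e s \<in> \<Omega>" "(0::real) \<le> t" "snd (e 0 :: point) < 0"
    and "e t \<in> target_region \<Omega>"
  shows "\<exists>s\<in>{0..t}. e s \<in> target_line l"
proof -
  have "continuous_on {0..t} (\<lambda>s. snd (e s))" using e(1) by (intro continuous_intros)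
  moreover have "0 \<le> snd (e t)" using assms(6) by (simp add: target_region_def)
  ultimately obtain s where s: "0 \<le> s" "s \<le> t" "snd (e s) = 0"
    using IVT'[of "\<lambda>s. snd (e s)" 0 0 t] e(3,4) by auto
  then have "e s \<in> {z \<in> \<Omega>. snd z = 0}" using e(2)[of s] by simp
  then show ?thesis using s \<Omega> by auto
qed

lemma reach_game_domain:
  assumes "game_domain \<Omega> l" "0 < vE" "vE < vP"
  shows "reach_game \<Omega> (target_region \<Omega>) (target_line l) l vP vE (vE / vP)"
proof -
  have d: "l > 0" "bounded \<Omega>" "convex \<Omega>" "{z \<in> \<Omega>. snd z = 0} = target_line l" "compact (target_region \<Omega>)"
    using assms(1) by (auto simp: game_domain_def)
  then have sub: "target_line l \<subseteq> \<Omega>" by auto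
  show ?thesis
  proof
    show "target_line l \<subseteq> target_region \<Omega>" unfolding d(4)[symmetric] by (auto simp: target_region_def)
    show "\<exists>s\<in>{0..t}. e s \<in> target_line l"
      if "continuous_on {0..t} e" "\<And>s. s \<in> {0..t} \<Longrightarrow> e s \<in> \<Omega>" "0 \<le> t" "snd (e 0) < 0" "e t \<in> target_region \<Omega>"
      for e :: "real \<Rightarrow> point" and t
      using crosses_target_line[OF d(4) that] .
  qed (use assms d sub inner_approximable_bounded compact_imp_closed in \<open>auto simp: target_region_def\<close>)
qed

lemma reach_game_plane:
  assumes "l > 0" "0 < vE" "vE < vP"
  shows "reach_game UNIV (target_line l) (target_line l) l vP vE (vE / vP)"
proof
  show "\<exists>s\<in>{0..t}. e s \<in> target_line l" if "0 \<le> t" "e t \<in> target_line l" for e :: "real \<Rightarrow> point" and t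
    using that by auto
  show "closed (target_line l)" by (simp add: target_line_def)
qed (use assms inner_approximable_UNIV in \<open>auto simp: target_line_eq\<close>)

lemma barrier_eq:
  assumes "game_domain \<Omega> l" "0 < vE" "vE < vP" "finite X" "X \<noteq> {}" "X \<subseteq> \<Omega>"
  shows "barrier \<Omega> vP vE X = critical_set (vE / vP) l X \<inter> play_region \<Omega>"
proof -
  interpret reach_game \<Omega> "target_region \<Omega>" "target_line l" l vP vE "vE / vP"
    using assms(1-3) by (rule reach_game_domain)
  show ?thesis
  proof (rule set_eqI)
    fix z
    show "z \<in> barrier \<Omega> vP vE X \<longleftrightarrow> z \<in> critical_set (vE / vP) l X \<inter> play_region \<Omega>"
    proof (cases "z \<in> play_region \<Omega>")
      case True
      then have "z \<in> \<Omega>" "snd z < 0" by (auto simp: play_region_def)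
      from barrier_iff[OF assms(4-6) this] show ?thesis using True by (simp add: barrier_def critical_set_def)
    qed (simp add: barrier_def)
  qed
qed

lemma free_barrier_eq:
  assumes "l > 0" "0 < vE" "vE < vP" "finite X" "X \<noteq> {}"
  shows "free_barrier l vP vE X = critical_set (vE / vP) l X \<inter> {z. snd z < 0}"
proof -
  interpret reach_game UNIV "target_line l" "target_line l" l vP vE "vE / vP"
    using assms(1-3) by (rule reach_game_plane)
  show ?thesis
  proof (rule set_eqI)
    fix z
    show "z \<in> free_barrier l vP vE X \<longleftrightarrow> z \<in> critical_set (vE / vP) l X \<inter> {z. snd z < 0}"
    proof (cases "snd z < 0")
      case True
      from barrier_iff[OF assms(4,5) subset_UNIV UNIV_I this] show ?thesis
        using True by (simp add: free_barrier_def critical_set_def)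
    qed (simp add: free_barrier_def)
  qed
qed

lemma critical_set_mirror:
  assumes "l > 0" "0 < \<alpha>"
  shows "critical_set \<alpha> l (X1 \<union> mirror ` X2) = critical_set \<alpha> l (X1 \<union> X2)"
proof -
  have "margin \<alpha> z (mirror h) x = margin \<alpha> z h x" for z h x
    by (simp add: margin_def axis_dist_def mirror_def)
  then show ?thesis
    by (simp add: set_eq_iff critical_set_iff[OF assms] ball_Un bex_Un)
qed

theorem corollary1:
  fixes \<Omega> :: "point set" and l vP vE \<alpha> :: real
    and Np Ne :: nat and xP xE :: "nat \<Rightarrow> point"
    and K :: "nat set" and X X1 X2 :: "point set"
  assumes "game_domain \<Omega> l"
    and "vP > 0" and "vE > 0" and "\<alpha> = vE / vP" and "0 < \<alpha>" and "\<alpha> < 1"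
    and "\<forall>i\<in>{1..Np}. xP i \<in> \<Omega>"
    and "\<forall>j\<in>{1..Ne}. xE j \<in> play_region \<Omega>"
    and "inj_on xP {1..Np}" and "inj_on xE {1..Ne}"
    and "\<forall>i\<in>{1..Np}. \<forall>j\<in>{1..Ne}. xP i \<noteq> xE j"
    and "\<forall>i\<in>{1..Np}. \<forall>j\<in>{1..Np}. xP i \<in> target_region \<Omega> \<and> j \<noteq> i \<longrightarrow> mirror (xP i) \<noteq> xP j"
    and "K \<subseteq> {1..Np}" and "K \<noteq> {}"
    and "X = xP ` K"
    and "X1 = X \<inter> play_region \<Omega>" and "X2 = X \<inter> target_region \<Omega>"
  shows "barrier \<Omega> vP vE X = mixed_barrier \<Omega> l vP vE X1 (mirror ` X2) \<and>
    (\<exists>hs. lists_increasing hs (active l (X1 \<union> mirror ` X2))) \<and>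
    (\<forall>hs. lists_increasing hs (active l (X1 \<union> mirror ` X2)) \<longrightarrow>
       mixed_barrier \<Omega> l vP vE X1 (mirror ` X2) = Phi \<alpha> l hs \<inter> play_region \<Omega>)"
proof -
  have l: "l > 0" using assms(1) by (simp add: game_domain_def)
  have v: "0 < vE" "vE < vP" using assms(2-4,6) by (simp_all add: pos_divide_less_eq)
  have X: "finite X" "X \<noteq> {}" "X \<subseteq> \<Omega>"
    using assms(7,13-15) by (auto intro: finite_subset)
  have split: "X1 \<union> X2 = X"
    using X(3) assms(16,17) by (auto simp: play_region_def target_region_def)
  \<comment> \<open>Reflection brings all pursuers to \<open>snd h \<le> 0\<close>, where the
    abscissa and the distance to one axis point determine a pursuer, as
    \<open>nearest_active\<close> requires.\<close>
  define Y where "Y = X1 \<union> mirror ` X2"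
  have Y: "finite Y" "Y \<noteq> {}" "\<And>h. h \<in> Y \<Longrightarrow> snd h \<le> 0"
    using X(1,2) split assms(16,17) unfolding Y_def
    by (auto simp: play_region_def target_region_def mirror_def)
  have crit: "critical_set \<alpha> l Y = critical_set \<alpha> l X"
    using critical_set_mirror[OF l assms(5)] split by (simp add: Y_def)
  have B: "barrier \<Omega> vP vE X = critical_set \<alpha> l X \<inter> play_region \<Omega>"
    using barrier_eq[OF assms(1) v X] assms(4) by simp
  have M: "mixed_barrier \<Omega> l vP vE X1 (mirror ` X2) = critical_set \<alpha> l X \<inter> play_region \<Omega>"
  proof (cases "X2 = {}")
    case True
    then show ?thesis using B split by (simp add: mixed_barrier_def)
  next
    \<comment> \<open>With virtual pursuers the game is the one in the plane, which has the same
      critical set.\<close>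
    case False
    then have "mixed_barrier \<Omega> l vP vE X1 (mirror ` X2) = free_barrier l vP vE Y \<inter> play_region \<Omega>"
      by (simp add: mixed_barrier_def Y_def)
    also have "\<dots> = critical_set \<alpha> l Y \<inter> {z. snd z < 0} \<inter> play_region \<Omega>"
      using free_barrier_eq[OF l v Y(1,2)] assms(4) by simp
    finally show ?thesis using crit by (auto simp: play_region_def)
  qed
  have "critical_set \<alpha> l X \<inter> play_region \<Omega> = Phi \<alpha> l hs \<inter> play_region \<Omega>" if "lists_increasing hs (active l Y)" for hs
    using critical_set_Phi[OF l assms(5,6) Y that] crit by (auto simp: play_region_def)
  then show ?thesis
    using B M active_list_exists[OF l Y(1)] unfolding Y_def[symmetric] by simp
qed

end
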